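(* Let $K$ be a field, $P$ a finite poset, and $L=\mathcal{I}(P)$ the distributive lattice of poset ideals of $P$, and suppose $L$ is non-planar. Then \[ |P|-1\ \ge\ \operatorname{reg} R(L)\ \ge\ \max\{|Q| : Q\subseteq P \text{ is a set of pairwise incomparable join-irreducible elements of } L\}-1. \]
   Context: By Birkhoff's theorem, $P$ is identified with the subposet of join-irreducible elements of $L=\mathcal{I}(P)$. For a finite distributive lattice $L$, $K[L]$ is the polynomial ring over $K$ in the elements of $L$, $I_L$ is generated by $ab-(a\vee b)(a\wedge b)$ for all incomparable $a,b\in L$, $R(L)=K[L]/I_L$, and $\operatorname{reg} R(L)$ is its Castelnuovo–Mumford regularity as a graded $K[L]$-module. A planar distributive lattice is a finite sublattice $L$ of $\mathbb{N}^2$ (componentwise order) with $(0,0)\in L$ such that any two comparable elements are joined by a chain in $L$ along which the coordinate sum increases by exactly $1$ at each step; $L$ is non-planar if it is not isomorphic to such a lattice. *)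

theory Defs
  imports Main "HOL-Library.Poly_Mapping"
begin

definition is_poset :: "'a set \<Rightarrow> ('a \<Rightarrow> 'a \<Rightarrow> bool) \<Rightarrow> bool" where
  "is_poset P le \<longleftrightarrow>
     (\<forall>x\<in>P. le x x) \<and>
     (\<forall>x\<in>P. \<forall>y\<in>P. le x y \<and> le y x \<longrightarrow> x = y) \<and>
     (\<forall>x\<in>P. \<forall>y\<in>P. \<forall>z\<in>P. le x y \<and> le y z \<longrightarrow> le x z)"

text \<open>Poset ideals (down-sets) of P; the distributive lattice I(P), ordered by inclusion,
  with join = union and meet = intersection.\<close>
definition poset_ideals :: "'a set \<Rightarrow> ('a \<Rightarrow> 'a \<Rightarrow> bool) \<Rightarrow> 'a set set" where
  "poset_ideals P le = {A. A \<subseteq> P \<and> (\<forall>x\<in>A. \<forall>y\<in>P. le y x \<longrightarrow> y \<in> A)}"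

definition join_irreducibles :: "'b set set \<Rightarrow> 'b set set" where
  "join_irreducibles L = {a \<in> L. a \<noteq> \<Inter>L \<and>
      (\<forall>b\<in>L. \<forall>c\<in>L. a = b \<union> c \<longrightarrow> a = b \<or> a = c)}"

definition ji_antichain :: "'b set set \<Rightarrow> 'b set set \<Rightarrow> bool" where
  "ji_antichain L Q \<longleftrightarrow> Q \<subseteq> join_irreducibles L \<and>
      (\<forall>a\<in>Q. \<forall>b\<in>Q. a \<noteq> b \<longrightarrow> \<not> a \<subseteq> b \<and> \<not> b \<subseteq> a)"

definition le2 :: "nat \<times> nat \<Rightarrow> nat \<times> nat \<Rightarrow> bool" where
  "le2 x y \<longleftrightarrow> fst x \<le> fst y \<and> snd x \<le> snd y"

definition planar_dist_lattice :: "(nat \<times> nat) set \<Rightarrow> bool" where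
  "planar_dist_lattice S \<longleftrightarrow> finite S \<and> (0, 0) \<in> S \<and>
     (\<forall>x\<in>S. \<forall>y\<in>S. (max (fst x) (fst y), max (snd x) (snd y)) \<in> S \<and>
                    (min (fst x) (fst y), min (snd x) (snd y)) \<in> S) \<and>
     (\<forall>x\<in>S. \<forall>y\<in>S. le2 x y \<longrightarrow>
        (\<exists>cs. cs \<noteq> [] \<and> hd cs = x \<and> last cs = y \<and> set cs \<subseteq> S \<and>
           (\<forall>j. Suc j < length cs \<longrightarrow> le2 (cs ! j) (cs ! Suc j) \<and>
               fst (cs ! Suc j) + snd (cs ! Suc j) = fst (cs ! j) + snd (cs ! j) + 1)))"

text \<open>A lattice of sets (ordered by inclusion) is planar iff it is isomorphic to a planar
  distributive lattice; lattice isomorphisms are exactly order isomorphisms.\<close>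
definition is_planar :: "'b set set \<Rightarrow> bool" where
  "is_planar L \<longleftrightarrow> (\<exists>S f. planar_dist_lattice S \<and> bij_betw f L S \<and>
      (\<forall>A\<in>L. \<forall>B\<in>L. A \<subseteq> B \<longleftrightarrow> le2 (f A) (f B)))"

text \<open>Polynomials in variables indexed by 'v with coefficients in 'k:
  finitely supported maps from monomials (exponent vectors) to coefficients.\<close>
type_synonym ('v, 'k) mpoly = "('v \<Rightarrow>\<^sub>0 nat) \<Rightarrow>\<^sub>0 'k"

definition mvar :: "'v \<Rightarrow> ('v, 'k::comm_ring_1) mpoly" where
  "mvar x = Poly_Mapping.single (Poly_Mapping.single x 1) 1"

definition mono_deg :: "('v \<Rightarrow>\<^sub>0 nat) \<Rightarrow> nat" where
  "mono_deg m = (\<Sum>x\<in>Poly_Mapping.keys m. Poly_Mapping.lookup m x)"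

definition poly_ring :: "'v set \<Rightarrow> ('v, 'k::comm_ring_1) mpoly set" where
  "poly_ring V = {p. \<forall>m\<in>Poly_Mapping.keys p. Poly_Mapping.keys m \<subseteq> V}"

definition homog :: "int \<Rightarrow> ('v, 'k::comm_ring_1) mpoly \<Rightarrow> bool" where
  "homog e p \<longleftrightarrow> (\<forall>m\<in>Poly_Mapping.keys p. int (mono_deg m) = e)"

definition ideal_gen :: "('v, 'k::comm_ring_1) mpoly set \<Rightarrow> ('v, 'k) mpoly set \<Rightarrow> ('v, 'k) mpoly set" where
  "ideal_gen S G = {p. \<exists>F r. finite F \<and> F \<subseteq> G \<and> (\<forall>g\<in>F. r g \<in> S) \<and> p = (\<Sum>g\<in>F. r g * g)}"

definition hibi_ideal :: "'b set set \<Rightarrow> ('b set, 'k::comm_ring_1) mpoly set" where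
  "hibi_ideal L = ideal_gen (poly_ring L)
     {mvar a * mvar b - mvar (a \<union> b) * mvar (a \<inter> b) | a b.
        a \<in> L \<and> b \<in> L \<and> \<not> a \<subseteq> b \<and> \<not> b \<subseteq> a}"

definition free_mod :: "('v, 'k::comm_ring_1) mpoly set \<Rightarrow> nat \<Rightarrow> (nat \<Rightarrow> ('v, 'k) mpoly) set" where
  "free_mod S b = {v. (\<forall>j<b. v j \<in> S) \<and> (\<forall>j\<ge>b. v j = 0)}"

text \<open>Applying the matrix M (rows indexed by the basis of the source S^b) to v.\<close>
definition mat_app :: "(nat \<Rightarrow> nat \<Rightarrow> ('v, 'k::comm_ring_1) mpoly) \<Rightarrow> nat \<Rightarrow> nat \<Rightarrow>
    (nat \<Rightarrow> ('v, 'k) mpoly) \<Rightarrow> (nat \<Rightarrow> ('v, 'k) mpoly)" where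
  "mat_app M b b' v = (\<lambda>l. if l < b' then (\<Sum>k<b. v k * M k l) else 0)"

text \<open>A finite graded free resolution of S/I over S:
   0 \<rightarrow> F_n \<rightarrow> ... \<rightarrow> F_1 \<rightarrow> F_0 = S \<rightarrow> S/I \<rightarrow> 0,
  with F_i = \<Oplus>_{k < b i} S(-a i k), differentials d i : F_i \<rightarrow> F_(i-1) given by
  matrices of homogeneous forms making them degree preserving.\<close>
definition graded_free_resolution ::
  "('v, 'k::comm_ring_1) mpoly set \<Rightarrow> ('v, 'k) mpoly set \<Rightarrow> nat \<Rightarrow> (nat \<Rightarrow> nat) \<Rightarrow>
   (nat \<Rightarrow> nat \<Rightarrow> int) \<Rightarrow> (nat \<Rightarrow> nat \<Rightarrow> nat \<Rightarrow> ('v, 'k) mpoly) \<Rightarrow> bool" where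
  "graded_free_resolution S I n b a d \<longleftrightarrow>
     b 0 = 1 \<and> a 0 0 = 0 \<and> (\<forall>i>n. b i = 0) \<and>
     (\<forall>i\<ge>1. \<forall>k<b i. \<forall>l<b (i - 1). d i k l \<in> S \<and> homog (a i k - a (i - 1) l) (d i k l)) \<and>
     (\<lambda>v. v 0) ` (mat_app (d 1) (b 1) 1 ` free_mod S (b 1)) = I \<and>
     (\<forall>i\<ge>1. {v \<in> free_mod S (b i). mat_app (d i) (b i) (b (i - 1)) v = (\<lambda>_. 0)}
              = mat_app (d (Suc i)) (b (Suc i)) (b i) ` free_mod S (b (Suc i)))"

definition res_reg :: "nat \<Rightarrow> (nat \<Rightarrow> nat) \<Rightarrow> (nat \<Rightarrow> nat \<Rightarrow> int) \<Rightarrow> int" where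
  "res_reg n b a = Max {a i k - int i | i k. i \<le> n \<and> k < b i}"

text \<open>Castelnuovo--Mumford regularity of S/I as a graded S-module: the maximum of
  a_{ij} - i over the minimal graded free resolution, which equals the minimum of this
  quantity over all finite graded free resolutions.\<close>
definition cm_reg :: "('v, 'k::comm_ring_1) mpoly set \<Rightarrow> ('v, 'k) mpoly set \<Rightarrow> int" where
  "cm_reg S I = (INF r \<in> {(n, b, a). \<exists>d. graded_free_resolution S I n b a d}.
                   (case r of (n, b, a) \<Rightarrow> res_reg n b a))"

text \<open>reg R(L) for R(L) = K[L]/I_L; the coefficient field is fixed by the type 'k.\<close>
definition reg_hibi :: "'k::field itself \<Rightarrow> 'b set set \<Rightarrow> int" where
  "reg_hibi (_ :: 'k itself) L = cm_reg (poly_ring L :: ('b set, 'k) mpoly set) (hibi_ideal L)"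

end

theory Submission
  imports Defs "HOL-Library.Function_Algebras" "HOL-Library.Multiset"
begin

text \<open>
  The Hibi ring R(L) is free over the polynomial ring in the rank sums
  \<open>\<theta>\<^sub>r\<close> (the sum of all poset ideals of cardinality r), with one basis monomial for each linear
  extension \<open>\<pi>\<close> of P, namely the product of the initial segments of \<open>\<pi>\<close> at the descents of \<open>\<pi>\<close> with
  respect to a weight that decreases strictly along P. This follows from a triangularity argument in the toric
  presentation: up to terms that are smaller for a suitable measure, the basis monomial of \<open>\<pi>\<close> times a
  monomial in the \<open>\<theta>\<^sub>r\<close> is the monomial obtained by replacing \<open>\<theta>\<^sub>r\<close> by the r-th initial segment of
  \<open>\<pi>\<close>, and each toric monomial arises exactly once in this way, by sorting P.

  If S/J is free over a polynomial subring T generated by some of the variables, then adjoining the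
  remaining variables y one at a time as mapping cones of the multiplication by \<open>y - \<phi>\<close>, where
  \<open>\<phi>\<close> lifts the action of y on S/J, gives a resolution in which every degree is at most the
  homological degree plus the top degree s of the basis, with equality at the last step. A
  comparison of resolutions shows that no other resolution does better. Hence the regularity is s, here the
  maximal number of descents of a linear extension. It is at most |P| - 1, and a linear extension
  that lists an antichain by increasing weight has a descent between any two consecutive elements of it.
\<close>

section \<open>Graded polynomial rings\<close>

text \<open>Regularity is an infimum over all finite graded resolutions, so the upper bound exhibits
  one resolution and the lower bound has to treat an arbitrary one.

  Two mismatches shape the construction. The cones adjoin variables, but the rank sums are not
  variables; an invertible linear change of coordinates exchanges them with the variables of the
  initial segments of one fixed linear extension without descents. Its own basis monomial is the
  empty product 1. Moreover, the cones start from a free module with one generator for each linear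
  extension, whereas a resolution by definition starts with S; the surplus generators are turned
  into second syzygies of unchanged degree, which only lowers degree minus index.

  The measure comes from convexity: among families of ideals of prescribed sizes, the sum of the
  squared multiplicities of the elements of P is the total size of all pairwise intersections, which
  is largest exactly for chains. Weights then single out the initial segments among the chains that
  contain the segments at the descents.\<close>

abbreviation keys :: "('a \<Rightarrow>\<^sub>0 'b::zero) \<Rightarrow> 'a set" where "keys \<equiv> Poly_Mapping.keys"
abbreviation lookup :: "('a \<Rightarrow>\<^sub>0 'b::zero) \<Rightarrow> 'a \<Rightarrow> 'b" where "lookup \<equiv> Poly_Mapping.lookup"
abbreviation single :: "'a \<Rightarrow> 'b \<Rightarrow> 'a \<Rightarrow>\<^sub>0 'b::zero" where "single \<equiv> Poly_Mapping.single"

lemma mono_deg_superset: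
  assumes "finite A" "keys m \<subseteq> A"
  shows "mono_deg m = (\<Sum>x\<in>A. lookup m x)"
  unfolding mono_deg_def using assms
  by (intro sum.mono_neutral_left) (auto simp: in_keys_iff)

lemma mono_deg_add: "mono_deg (m + n) = mono_deg m + mono_deg n"
proof -
  let ?A = "keys m \<union> keys n"
  have "keys (m + n) \<subseteq> ?A" by (rule keys_add)
  then show ?thesis
    by (subst (1 2 3) mono_deg_superset[where A = ?A]) (auto simp: lookup_add sum.distrib)
qed

lemma mono_deg_single [simp]: "mono_deg (single x c) = c"
  by (simp add: mono_deg_def)

lemma mono_deg_0 [simp]: "mono_deg 0 = 0"
  by (simp add: mono_deg_def)

lemma poly_mapping_sum_single:
  fixes p :: "'m \<Rightarrow>\<^sub>0 'k::comm_monoid_add"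
  assumes "finite A" "keys p \<subseteq> A"
  shows "p = (\<Sum>m\<in>A. single m (lookup p m))"
proof (rule poly_mapping_eqI)
  fix k
  have "(\<Sum>m\<in>A. lookup (single m (lookup p m)) k)
        = (\<Sum>m\<in>A. if m = k then lookup p k else 0)"
    by (rule sum.cong) (auto simp: lookup_single when_def)
  also have "\<dots> = (if k \<in> A then lookup p k else 0)"
    using assms(1) by simp
  also have "\<dots> = lookup p k"
    using assms(2) in_keys_iff[of k p] by auto
  finally show "lookup p k
    = lookup (\<Sum>m\<in>A. single m (lookup p m)) k"
    by (simp add: lookup_sum)
qed

text \<open>A polynomial is the finite sum of its terms. Restricting the term case to exponents in
  the support lets conditions on the support, such as membership in \<open>poly_ring V\<close>,
  enter the induction.\<close>

lemma poly_mapping_add_induct [case_names zero single add]: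
  fixes p :: "'m \<Rightarrow>\<^sub>0 'k::comm_monoid_add"
  assumes "P 0" "\<And>m c. m \<in> keys p \<Longrightarrow> P (single m c)"
    "\<And>q r. P q \<Longrightarrow> P r \<Longrightarrow> P (q + r)"
  shows "P p"
proof -
  have "P (\<Sum>m\<in>A. single m (lookup p m))"
    if "finite A" "A \<subseteq> keys p" for A
    using that by (induction A rule: finite_induct) (auto intro: assms)
  then show ?thesis
    by (metis finite_keys order_refl poly_mapping_sum_single)
qed

lemma poly_ring_induct [consumes 1, case_names zero single add]:
  assumes "p \<in> poly_ring V" "P 0"
    "\<And>m c. keys m \<subseteq> V \<Longrightarrow> P (single m c)"
    "\<And>q r. P q \<Longrightarrow> P r \<Longrightarrow> P (q + r)"
  shows "P p"
  using assms by (intro poly_mapping_add_induct[of P p]) (auto simp: poly_ring_def)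

lemma keys_multE:
  assumes "m \<in> keys (p * q)"
  obtains a b where "m = a + b" "a \<in> keys p" "b \<in> keys q"
  using keys_mult[of p q] assms by blast

lemma poly_ring_0 [simp]: "0 \<in> poly_ring V"
  by (simp add: poly_ring_def)

lemma poly_ring_1 [simp]: "1 \<in> poly_ring V"
  by (simp add: poly_ring_def)

lemma poly_ring_single: "keys m \<subseteq> V \<Longrightarrow> single m c \<in> poly_ring V"
  by (simp add: poly_ring_def)

lemma poly_ring_mvar [simp]: "x \<in> V \<Longrightarrow> mvar x \<in> poly_ring V"
  by (simp add: poly_ring_def mvar_def)

lemma poly_ring_add [simp]: "p \<in> poly_ring V \<Longrightarrow> q \<in> poly_ring V \<Longrightarrow> p + q \<in> poly_ring V"
  using keys_add[of p q] by (auto simp: poly_ring_def)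

lemma poly_ring_uminus [simp]: "p \<in> poly_ring V \<Longrightarrow> - p \<in> poly_ring V"
  by (auto simp: poly_ring_def in_keys_iff)

lemma poly_ring_diff [simp]: "p \<in> poly_ring V \<Longrightarrow> q \<in> poly_ring V \<Longrightarrow> p - q \<in> poly_ring V"
  using poly_ring_add[of p V "- q"] by simp

lemma poly_ring_mult [simp]: "p \<in> poly_ring V \<Longrightarrow> q \<in> poly_ring V \<Longrightarrow> p * q \<in> poly_ring V"
proof -
  assume "p \<in> poly_ring V" "q \<in> poly_ring V"
  then have "keys m \<subseteq> V" if *: "m \<in> keys (p * q)" for m
  proof -
    obtain a b where "m = a + b" "a \<in> keys p" "b \<in> keys q"
      using * by (rule keys_multE)
    then show ?thesis
      using keys_add[of a b] \<open>p \<in> _\<close> \<open>q \<in> _\<close> by (auto simp: poly_ring_def)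
  qed
  then show ?thesis by (simp add: poly_ring_def)
qed

lemma poly_ring_sum [simp]: "(\<And>i. i \<in> A \<Longrightarrow> f i \<in> poly_ring V) \<Longrightarrow> sum f A \<in> poly_ring V"
  by (induction A rule: infinite_finite_induct) auto

lemma poly_ring_prod [simp]: "(\<And>i. i \<in> A \<Longrightarrow> f i \<in> poly_ring V) \<Longrightarrow> prod f A \<in> poly_ring V"
  by (induction A rule: infinite_finite_induct) auto

lemma poly_ring_power [simp]: "p \<in> poly_ring V \<Longrightarrow> p ^ n \<in> poly_ring V"
  by (induction n) auto

lemma poly_ring_mono: "V \<subseteq> W \<Longrightarrow> poly_ring V \<subseteq> poly_ring W"
  by (auto simp: poly_ring_def)

lemma homog_0 [simp]: "homog e 0"
  by (simp add: homog_def)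

lemma homog_1 [simp]: "homog 0 1"
  by (simp add: homog_def)

lemma homog_single: "homog (int (mono_deg m)) (single m c)"
  by (simp add: homog_def)

lemma homog_mvar [simp]: "homog 1 (mvar x)"
  by (simp add: homog_def mvar_def)

lemma homog_add: "homog e p \<Longrightarrow> homog e q \<Longrightarrow> homog e (p + q)"
  using keys_add[of p q] by (auto simp: homog_def)

lemma homog_uminus: "homog e p \<Longrightarrow> homog e (- p)"
  by (auto simp: homog_def in_keys_iff)

lemma homog_diff: "homog e p \<Longrightarrow> homog e q \<Longrightarrow> homog e (p - q)"
  using homog_add[of e p "- q"] homog_uminus[of e q] by simp

lemma homog_sum: "(\<And>i. i \<in> A \<Longrightarrow> homog e (f i)) \<Longrightarrow> homog e (sum f A)"
  by (induction A rule: infinite_finite_induct) (auto intro: homog_add)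

lemma homog_mult: 
  assumes "homog d p" "homog e q" shows "homog (d + e) (p * q)"
  unfolding homog_def
proof
  fix m assume "m \<in> keys (p * q)"
  then obtain a b where "m = a + b" "a \<in> keys p" "b \<in> keys q"
    by (rule keys_multE)
  then show "int (mono_deg m) = d + e"
    using assms by (auto simp: homog_def mono_deg_add)
qed

lemma homog_mult': "homog d p \<Longrightarrow> homog e q \<Longrightarrow> f = d + e \<Longrightarrow> homog f (p * q)"
  by (simp add: homog_mult)

section \<open>Selecting terms of a polynomial; homogeneous components\<close>

lift_definition restr :: "('m \<Rightarrow> bool) \<Rightarrow> ('m \<Rightarrow>\<^sub>0 'k::zero) \<Rightarrow> ('m \<Rightarrow>\<^sub>0 'k)"
  is "\<lambda>A f m. if A m then f m else 0"
  by (rule finite_subset[rotated]) auto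

lemma lookup_restr: "lookup (restr A p) m = (if A m then lookup p m else 0)"
  by transfer simp

lemma keys_restr: "keys (restr A p) = {m \<in> keys p. A m}"
  by (auto simp: in_keys_iff lookup_restr split: if_splits)

lemma restr_add: "restr A (p + q) = restr A p + restr A (q :: _ \<Rightarrow>\<^sub>0 _ :: comm_monoid_add)"
  by (rule poly_mapping_eqI) (simp add: lookup_restr lookup_add)

lemma restr_diff: "restr A (p - q) = restr A p - restr A (q :: _ \<Rightarrow>\<^sub>0 _ :: ab_group_add)"
  by (rule poly_mapping_eqI) (simp add: lookup_restr lookup_minus)

lemma restr_0 [simp]: "restr A 0 = 0"
  by (rule poly_mapping_eqI) (simp add: lookup_restr)

lemma restr_sum: "restr A (sum f I) = (\<Sum>i\<in>I. restr A (f i :: _ \<Rightarrow>\<^sub>0 _ :: comm_monoid_add))"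
  by (induction I rule: infinite_finite_induct) (auto simp: restr_add)

lemma restr_id: "(\<And>m. m \<in> keys p \<Longrightarrow> A m) \<Longrightarrow> restr A p = p"
  by (rule poly_mapping_eqI) (auto simp: lookup_restr in_keys_iff)

lemma restr_eq_0: "(\<And>m. m \<in> keys p \<Longrightarrow> \<not> A m) \<Longrightarrow> restr A p = 0"
  by (rule poly_mapping_eqI) (auto simp: lookup_restr in_keys_iff)

text \<open>If every term of \<open>q\<close> turns the test \<open>A\<close> on a product into the
  same test \<open>B\<close> on the other factor, then the terms of \<open>p\<close> failing
  \<open>B\<close> produce only terms failing \<open>A\<close>. Two cases matter: \<open>q\<close>
  homogeneous with tests on the degree, and \<open>q\<close> free of a variable with tests on the
  exponent of that variable.\<close>

lemma restr_mult:
  fixes p q :: "'m::comm_monoid_add \<Rightarrow>\<^sub>0 'k::comm_ring_1"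
  assumes "\<And>m n. n \<in> keys q \<Longrightarrow> A (m + n) \<longleftrightarrow> B m"
  shows "restr A (p * q) = restr B p * q"
proof -
  have p: "p = restr B p + restr (\<lambda>m. \<not> B m) p"
    by (rule poly_mapping_eqI) (simp add: lookup_restr lookup_add)
  have 1: "restr A (restr B p * q) = restr B p * q"
    using assms by (intro restr_id) (auto simp: keys_restr elim!: keys_multE)
  have 2: "restr A (restr (\<lambda>m. \<not> B m) p * q) = 0"
    using assms by (intro restr_eq_0) (auto simp: keys_restr elim!: keys_multE)
  show ?thesis
    by (subst p) (simp add: ring_distribs restr_add 1 2)
qed

lemma restr_poly_ring: "p \<in> poly_ring V \<Longrightarrow> restr A p \<in> poly_ring V"
  by (auto simp: poly_ring_def keys_restr)

definition hpart :: "int \<Rightarrow> ('v, 'k::comm_ring_1) mpoly \<Rightarrow> ('v, 'k) mpoly" where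
  "hpart e = restr (\<lambda>m. int (mono_deg m) = e)"

lemma hpart_add: "hpart e (p + q) = hpart e p + hpart e q"
  by (simp add: hpart_def restr_add)

lemma hpart_diff: "hpart e (p - q) = hpart e p - hpart e q"
  by (simp add: hpart_def restr_diff)

lemma hpart_sum: "hpart e (sum f A) = (\<Sum>i\<in>A. hpart e (f i))"
  by (simp add: hpart_def restr_sum)

lemma hpart_homog [simp]: "homog e (hpart e p)"
  by (simp add: homog_def hpart_def keys_restr)

lemma hpart_id: "homog e p \<Longrightarrow> hpart e p = p"
  by (auto simp: homog_def hpart_def intro: restr_id)

lemma hpart_poly_ring [simp]: "p \<in> poly_ring V \<Longrightarrow> hpart e p \<in> poly_ring V"
  by (simp add: hpart_def restr_poly_ring)

lemma hpart_mult: "homog d q \<Longrightarrow> hpart e (p * q) = hpart (e - d) p * q"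
  unfolding hpart_def by (rule restr_mult) (auto simp: homog_def mono_deg_add)

section \<open>Expansion in powers of one variable\<close>

lemma lookup_single_mult:
  fixes m :: "'m::cancel_comm_monoid_add" and p :: "'m \<Rightarrow>\<^sub>0 'k::comm_ring_1"
  shows "lookup (single m c * p) (m + n) = c * lookup p n"
proof (induction p rule: poly_mapping_add_induct)
  case (single k d)
  show ?case by (simp add: mult_single lookup_single when_def)
qed (simp_all add: lookup_add ring_distribs)

lemma single_mult_eq_0:
  fixes m :: "'m::cancel_comm_monoid_add" and p :: "'m \<Rightarrow>\<^sub>0 'k::comm_ring_1"
  assumes "single m 1 * p = 0" shows "p = 0"
  using lookup_single_mult[of m 1 p] assms by (intro poly_mapping_eqI) simp

lemma single_power:
  "single m c ^ n = single (\<Sum>i<n. m) (c ^ n :: 'k::comm_semiring_1)"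
  by (induction n) (simp_all add: mult_single add.commute)

lemma mvar_power: "mvar y ^ n = single (single y n) 1"
proof -
  have "(\<Sum>i<n. single y (1::nat)) = single y n"
    by (rule poly_mapping_eqI) (simp add: lookup_sum lookup_single when_def)
  then show ?thesis by (simp add: mvar_def single_power)
qed

text \<open>The coefficients form an infinite sequence that vanishes from \<open>N\<close> on, so
  that two expansions can be padded to a common length and added.\<close>

lemma poly_ring_coeffs_ex:
  assumes "p \<in> poly_ring (insert y V)"
  shows "\<exists>N c. (\<forall>a. c a \<in> poly_ring V) \<and> (\<forall>a\<ge>N. c a = 0) \<and> p = (\<Sum>a<N. mvar y ^ a * c a)"
  using assms
proof (induction rule: poly_ring_induct)
  case zero
  show ?case by (intro exI[of _ 0] exI[of _ "\<lambda>_. 0"]) simp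
next
  case (single m k)
  let ?e = "lookup m y"
  define m' where "m' = restr (\<lambda>x. x \<noteq> y) m"
  have m: "m = single y ?e + m'"
    by (rule poly_mapping_eqI) (auto simp: m'_def lookup_add lookup_single lookup_restr when_def)
  have "keys m' \<subseteq> V" using single by (auto simp: m'_def keys_restr)
  then have "single m' k \<in> poly_ring V" by (simp add: poly_ring_single)
  moreover have "single m k = mvar y ^ ?e * single m' k"
    by (subst m) (simp add: mvar_power mult_single)
  ultimately show ?case
    by (intro exI[of _ "Suc ?e"] exI[of _ "\<lambda>a. if a = ?e then single m' k else 0"]) simp
next
  case (add q r)
  obtain N c where
    c: "\<forall>a. c a \<in> poly_ring V" "\<forall>a\<ge>N. c a = 0" "q = (\<Sum>a<N. mvar y ^ a * c a)"
    using add(1) by blast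
  obtain N' c' where
    c': "\<forall>a. c' a \<in> poly_ring V" "\<forall>a\<ge>N'. c' a = 0" "r = (\<Sum>a<N'. mvar y ^ a * c' a)"
    using add(2) by blast
  have "q = (\<Sum>a<max N N'. mvar y ^ a * c a)" 
    unfolding c(3) by (rule sum.mono_neutral_left) (use c(2) in auto)
  moreover have "r = (\<Sum>a<max N N'. mvar y ^ a * c' a)" 
    unfolding c'(3) by (rule sum.mono_neutral_left) (use c'(2) in auto)
  ultimately show ?case using c c'
    by (intro exI[of _ "max N N'"] exI[of _ "\<lambda>a. c a + c' a"]) (simp add: sum.distrib ring_distribs)
qed

text \<open>The coefficients do not involve \<open>y\<close>, hence the terms with exponent
  \<open>a\<close> in \<open>y\<close> are precisely those of one summand; selecting them isolates
  it, and multiplication by a monomial is injective.\<close>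

lemma poly_ring_coeffs_zero:
  assumes "y \<notin> V" "\<And>a. c a \<in> poly_ring V" "(\<Sum>a<N. mvar y ^ a * c a) = (0 :: ('v,'k::comm_ring_1) mpoly)" "a < N"
  shows "c a = 0"
proof -
  let ?A = "\<lambda>m. lookup m y = a"
  have y0: "lookup m y = 0" if "m \<in> keys (c i)" for m i
    using assms(1) assms(2)[of i] that in_keys_iff[of y m] unfolding poly_ring_def by blast
  have "restr ?A (mvar y ^ i * c i) = (if i = a then mvar y ^ a * c a else 0)" for i
  proof -
    have "restr ?A (mvar y ^ i * c i) = restr ?A (mvar y ^ i) * c i"
      by (rule restr_mult) (use y0 in \<open>auto simp: lookup_add\<close>)
    moreover have "restr ?A (mvar y ^ i :: ('v,'k) mpoly) = (if i = a then mvar y ^ i else 0)"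
      by (rule poly_mapping_eqI) (auto simp: lookup_restr mvar_power lookup_single when_def)
    ultimately show ?thesis by simp
  qed
  then have "restr ?A (\<Sum>a<N. mvar y ^ a * c a) = (\<Sum>i<N. if i = a then mvar y ^ a * c a else 0)"
    unfolding restr_sum by (rule sum.cong[OF refl])
  also have "\<dots> = mvar y ^ a * c a"
    using assms(4) by (subst sum.delta) auto
  finally have "single (single y a) 1 * c a = 0"
    using assms(3) unfolding mvar_power by simp
  then show ?thesis by (rule single_mult_eq_0)
qed

section \<open>Linear maps between free modules\<close>

definition smul :: "'r::times \<Rightarrow> (nat \<Rightarrow> 'r) \<Rightarrow> nat \<Rightarrow> 'r" where
  "smul c v = (\<lambda>l. c * v l)"

lemma smul_apply [simp]: "smul c v l = c * v l"
  by (simp add: smul_def)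

text \<open>\<open>D k\<close> is the image of the k-th basis vector; the map acts on vectors of length b.\<close>
definition lc :: "(nat \<Rightarrow> nat \<Rightarrow> 'r::comm_ring_1) \<Rightarrow> nat \<Rightarrow> (nat \<Rightarrow> 'r) \<Rightarrow> nat \<Rightarrow> 'r" where
  "lc D b v = (\<lambda>l. \<Sum>k<b. v k * D k l)"

definition unit_vec :: "nat \<Rightarrow> nat \<Rightarrow> 'r::comm_ring_1" where
  "unit_vec k = (\<lambda>l. if l = k then 1 else 0)"

lemma lc_0 [simp]: "lc D b 0 = 0"
  by (simp add: lc_def fun_eq_iff)

lemma lc_zero_dim [simp]: "lc D 0 v = 0"
  by (simp add: lc_def fun_eq_iff)

lemma lc_add: "lc D b (u + v) = lc D b u + lc D b v"
  by (simp add: lc_def fun_eq_iff ring_distribs sum.distrib)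

lemma lc_uminus: "lc D b (- v) = - lc D b v"
  by (simp add: lc_def fun_eq_iff sum_negf)

lemma lc_diff: "lc D b (u - v) = lc D b u - lc D b v"
  by (simp add: lc_def fun_eq_iff ring_distribs sum_subtractf)

lemma lc_smul: "lc D b (smul c v) = smul c (lc D b v)"
  by (simp add: lc_def fun_eq_iff sum_distrib_left mult.assoc)

lemma lc_sum: "lc D b (\<Sum>i\<in>A. f i) = (\<Sum>i\<in>A. lc D b (f i))"
  using sum_comp_morphism[of "lc D b" f A] by (simp add: lc_add o_def)

lemma lc_map_uminus: "lc (\<lambda>k. - D k) b v = - lc D b v"
  by (simp add: lc_def fun_eq_iff sum_negf)

lemma lc_map_diff: "lc (\<lambda>k. D k - E k) b v = lc D b v - lc E b v"
  by (simp add: lc_def fun_eq_iff ring_distribs sum_subtractf)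

lemma lc_map_smul: "lc (\<lambda>k. smul c (D k)) b v = smul c (lc D b v)"
  by (simp add: lc_def fun_eq_iff sum_distrib_left mult_ac)

lemma lc_cong: "(\<And>k. k < b \<Longrightarrow> D k = E k) \<Longrightarrow> (\<And>k. k < b \<Longrightarrow> u k = v k) \<Longrightarrow> lc D b u = lc E b v"
  by (simp add: lc_def fun_eq_iff)

lemma lc_lc: "lc D b (lc E c v) = lc (\<lambda>k. lc D b (E k)) c v"
proof
  fix l
  have "lc D b (lc E c v) l = (\<Sum>i<b. \<Sum>k<c. v k * E k i * D i l)"
    by (simp add: lc_def sum_distrib_right)
  also have "\<dots> = (\<Sum>k<c. \<Sum>i<b. v k * E k i * D i l)" by (rule sum.swap)
  finally show "lc D b (lc E c v) l = lc (\<lambda>k. lc D b (E k)) c v l"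
    by (simp add: lc_def sum_distrib_left mult.assoc)
qed

lemma lc_unit_vec: 
  assumes "k < b" shows "lc D b (unit_vec k) = D k"
proof
  fix l
  have "lc D b (unit_vec k) l = (\<Sum>i<b. if i = k then D k l else 0)"
    unfolding lc_def unit_vec_def by (rule sum.cong) auto
  also have "\<dots> = D k l" using assms by (subst sum.delta) auto
  finally show "lc D b (unit_vec k) l = D k l" .
qed

lemma smul_sum: "smul (c::'r::comm_ring_1) (\<Sum>i\<in>A. f i) = (\<Sum>i\<in>A. smul c (f i))"
  by (induction A rule: infinite_finite_induct) (auto simp: fun_eq_iff ring_distribs)

lemma fun_sum_apply: "(\<Sum>i\<in>A. f i) x = (\<Sum>i\<in>A. f i x :: 'r::comm_monoid_add)"
  by (induction A rule: infinite_finite_induct) auto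

section \<open>Closure properties of free modules over polynomial rings\<close>

lemma free_mod_0 [simp]: "0 \<in> free_mod (poly_ring V) b"
  by (simp add: free_mod_def)

lemma free_mod_add [simp]:
  "u \<in> free_mod (poly_ring V) b \<Longrightarrow> v \<in> free_mod (poly_ring V) b \<Longrightarrow> u + v \<in> free_mod (poly_ring V) b"
  by (simp add: free_mod_def)

lemma free_mod_uminus [simp]: "u \<in> free_mod (poly_ring V) b \<Longrightarrow> - u \<in> free_mod (poly_ring V) b"
  by (simp add: free_mod_def)

lemma free_mod_diff [simp]:
  "u \<in> free_mod (poly_ring V) b \<Longrightarrow> v \<in> free_mod (poly_ring V) b \<Longrightarrow> u - v \<in> free_mod (poly_ring V) b"
  by (simp add: free_mod_def)

lemma free_mod_smul [simp]:
  "c \<in> poly_ring V \<Longrightarrow> v \<in> free_mod (poly_ring V) b \<Longrightarrow> smul c v \<in> free_mod (poly_ring V) b"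
  by (simp add: free_mod_def)

lemma free_mod_sum [simp]:
  "(\<And>i. i \<in> A \<Longrightarrow> f i \<in> free_mod (poly_ring V) b) \<Longrightarrow> sum f A \<in> free_mod (poly_ring V) b"
  by (induction A rule: infinite_finite_induct) auto

lemma free_mod_unit_vec [simp]: "k < b \<Longrightarrow> unit_vec k \<in> free_mod (poly_ring V) b"
  by (simp add: free_mod_def unit_vec_def)

lemma free_mod_mono: "V \<subseteq> W \<Longrightarrow> free_mod (poly_ring V) b \<subseteq> free_mod (poly_ring W) b"
  using poly_ring_mono[of V W] by (auto simp: free_mod_def)

lemma free_mod_poly_ring: "v \<in> free_mod S b \<Longrightarrow> k < b \<Longrightarrow> v k \<in> S"
  by (simp add: free_mod_def)

lemma free_mod_out: "v \<in> free_mod S b \<Longrightarrow> b \<le> k \<Longrightarrow> v k = 0"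
  by (simp add: free_mod_def)

lemma free_mod_dim_0 [simp]: "free_mod S 0 = {0}"
  by (auto simp: free_mod_def fun_eq_iff)

lemma lc_free_mod [simp]:
  assumes "\<And>k. k < b \<Longrightarrow> D k \<in> free_mod (poly_ring V) b'" "v \<in> free_mod (poly_ring V) b"
  shows "lc D b v \<in> free_mod (poly_ring V) b'"
  using assms by (auto simp: free_mod_def lc_def intro!: poly_ring_sum poly_ring_mult)

lemma lc_unit_vec_id: "v \<in> free_mod S b \<Longrightarrow> lc unit_vec b v = v"
proof
  fix l assume v: "v \<in> free_mod S b"
  have "lc unit_vec b v l = (\<Sum>k<b. if k = l then v l else 0)"
    unfolding lc_def unit_vec_def by (rule sum.cong) auto
  also have "\<dots> = v l"
    using free_mod_out[OF v, of l] by (subst sum.delta) auto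
  finally show "lc unit_vec b v l = v l" .
qed

section \<open>Homogeneous vectors\<close>

definition ghom :: "(nat \<Rightarrow> int) \<Rightarrow> nat \<Rightarrow> int \<Rightarrow> (nat \<Rightarrow> ('v,'k::comm_ring_1) mpoly) \<Rightarrow> bool" where
  "ghom a b e v \<longleftrightarrow> (\<forall>l<b. homog (e - a l) (v l))"

lemma ghom_0 [simp]: "ghom a b e 0"
  by (simp add: ghom_def)

lemma ghom_diff: "ghom a b e u \<Longrightarrow> ghom a b e v \<Longrightarrow> ghom a b e (u - v)"
  by (simp add: ghom_def homog_diff)

lemma ghom_uminus: "ghom a b e u \<Longrightarrow> ghom a b e (- u)"
  by (simp add: ghom_def homog_uminus)

lemma ghom_smul: "homog d c \<Longrightarrow> ghom a b e u \<Longrightarrow> f = d + e \<Longrightarrow> ghom a b f (smul c u)"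
  by (auto simp: ghom_def intro!: homog_mult'[of d])

lemma ghom_lc:
  assumes "\<And>k. k < b \<Longrightarrow> ghom a' b' (a k + d) (D k)" "ghom a b e v" "f = e + d"
  shows "ghom a' b' f (lc D b v)"
  unfolding ghom_def lc_def
proof (intro allI impI homog_sum)
  fix l k assume "l < b'" "k \<in> {..<b}"
  then show "homog (f - a' l) (v k * D k l)"
    using assms by (intro homog_mult'[of "e - a k" _ "a k + d - a' l"]) (auto simp: ghom_def)
qed

lemma ghom_unit_vec: "ghom a b (a k) (unit_vec k)"
  by (simp add: ghom_def unit_vec_def)

text \<open>Since \<open>D\<close> preserves degrees, replacing each coordinate of a preimage by its
  component of the matching degree does not change the image of degree \<open>e\<close>.\<close>

lemma graded_preimage:
  assumes D: "\<And>k. k < b \<Longrightarrow> D k \<in> free_mod (poly_ring V) b'" "\<And>k. k < b \<Longrightarrow> ghom a' b' (a k) (D k)"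
    and u: "u \<in> free_mod (poly_ring V) b" and e: "ghom a' b' e (lc D b u)"
  obtains w where "w \<in> free_mod (poly_ring V) b" "ghom a b e w" "lc D b w = lc D b u"
proof
  define w where "w = (\<lambda>k. if k < b then hpart (e - a k) (u k) else 0)"
  show "w \<in> free_mod (poly_ring V) b" "ghom a b e w"
    using u by (auto simp: free_mod_def w_def ghom_def)
  show "lc D b w = lc D b u"
  proof
    fix l
    show "lc D b w l = lc D b u l"
    proof (cases "l < b'")
      case True
      have "lc D b u l = hpart (e - a' l) (lc D b u l)"
        using e True by (simp add: ghom_def hpart_id)
      also have "\<dots> = (\<Sum>k<b. hpart (e - a' l) (u k * D k l))"
        by (simp add: lc_def hpart_sum)
      also have "\<dots> = (\<Sum>k<b. hpart (e - a k) (u k) * D k l)"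
      proof (rule sum.cong)
        fix k assume "k \<in> {..<b}"
        then have "homog (a k - a' l) (D k l)" using D(2) True by (auto simp: ghom_def)
        then show "hpart (e - a' l) (u k * D k l) = hpart (e - a k) (u k) * D k l"
          by (simp add: hpart_mult)
      qed simp
      also have "\<dots> = lc D b w l" by (simp add: lc_def w_def)
      finally show ?thesis by simp
    next
      case False
      then have "D k l = 0" if "k < b" for k using D(1)[OF that] free_mod_out by force
      then show ?thesis by (simp add: lc_def)
    qed
  qed
qed

section \<open>Concatenation of vectors, for direct sums of free modules\<close>

definition cat :: "nat \<Rightarrow> (nat \<Rightarrow> 'r) \<Rightarrow> (nat \<Rightarrow> 'r) \<Rightarrow> nat \<Rightarrow> 'r" where
  "cat c u v = (\<lambda>l. if l < c then u l else v (l - c))"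

lemma cat_lt [simp]: "l < c \<Longrightarrow> cat c u v l = u l"
  and cat_ge [simp]: "cat c u v (c + l) = v l"
  by (simp_all add: cat_def)

lemma cat_free_mod: "u \<in> free_mod S c \<Longrightarrow> v \<in> free_mod S d \<Longrightarrow> cat c u v \<in> free_mod S (c + d)"
  by (auto simp: free_mod_def cat_def)

lemma cat_split:
  assumes "w \<in> free_mod S (c + d)" "0 \<in> S"
  obtains u v where "u \<in> free_mod S c" "v \<in> free_mod S d" "w = cat c u v"
proof
  show "(\<lambda>l. if l < c then w l else 0) \<in> free_mod S c" "(\<lambda>l. w (c + l)) \<in> free_mod S d"
    "w = cat c (\<lambda>l. if l < c then w l else 0) (\<lambda>l. w (c + l))"
    using assms by (auto simp: free_mod_def cat_def)
qed

lemma cat_inject: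
  assumes "u \<in> free_mod S c" "u' \<in> free_mod S c"
  shows "cat c u v = cat c u' v' \<longleftrightarrow> u = u' \<and> v = v'"
proof
  assume *: "cat c u v = cat c u' v'"
  have "u l = u' l" for l
    using assms fun_cong[OF *, of l] by (cases "l < c") (auto simp: free_mod_out)
  moreover have "v l = v' l" for l using fun_cong[OF *, of "c + l"] by simp
  ultimately show "u = u' \<and> v = v'" by auto
qed auto

lemma cat_0 [simp]: "cat c 0 0 = (0 :: nat \<Rightarrow> 'r::zero)"
  by (simp add: cat_def fun_eq_iff)

lemma cat_add: "cat c u v + cat c u' v' = cat c (u + u') (v + v' :: nat \<Rightarrow> 'r::plus)"
  by (simp add: cat_def fun_eq_iff)

lemma ghom_cat:
  "ghom a b e u \<Longrightarrow> ghom a' b' e v \<Longrightarrow> ghom (cat b a a') (b + b') e (cat b u v)"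
  by (auto simp: ghom_def cat_def)

lemma sum_lessThan_plus: "(\<Sum>k<c + d::nat. f k) = (\<Sum>k<c. f k) + (\<Sum>k<d. f (c + k) :: 'r::comm_monoid_add)"
  by (induction d) (simp_all add: add.assoc)

lemma lc_cat: "lc (cat c D E) (c + d) (cat c u v) = lc D c u + lc E d v"
  by (simp add: lc_def fun_eq_iff sum_lessThan_plus)

lemma lc_to_cat: "lc (\<lambda>k. cat c (D k) (E k)) b v = cat c (lc D b v) (lc E b v)"
  by (auto simp: lc_def fun_eq_iff cat_def)

lemma free_mod_coeffs_ex:
  assumes "v \<in> free_mod (poly_ring (insert y V)) b"
  shows "\<exists>N c. (\<forall>a. c a \<in> free_mod (poly_ring V) b) \<and> (\<forall>a\<ge>N. c a = 0) \<and> v = (\<Sum>a<N. smul (mvar y ^ a) (c a))"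
proof -
  have "\<forall>k. \<exists>N c. k < b \<longrightarrow> (\<forall>a. c a \<in> poly_ring V) \<and> (\<forall>a\<ge>N. c a = 0) \<and> v k = (\<Sum>a<N. mvar y ^ a * c a)"
  proof
    fix k
    show "\<exists>N c. k < b \<longrightarrow> (\<forall>a. c a \<in> poly_ring V) \<and> (\<forall>a\<ge>N. c a = 0) \<and> v k = (\<Sum>a<N. mvar y ^ a * c a)"
    proof (cases "k < b")
      case True
      show ?thesis using poly_ring_coeffs_ex[OF free_mod_poly_ring[OF assms True]] by (simp only: True simp_thms)
    qed simp
  qed
  from choice[OF this] obtain N where "\<forall>k. \<exists>c. k < b \<longrightarrow> (\<forall>a. c a \<in> poly_ring V) \<and> (\<forall>a\<ge>N k. c a = 0)
      \<and> v k = (\<Sum>a<N k. mvar y ^ a * c a)" ..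
  from choice[OF this] obtain c where c: "\<And>k. k < b \<Longrightarrow> (\<forall>a. c k a \<in> poly_ring V) \<and> (\<forall>a\<ge>N k. c k a = 0)
      \<and> v k = (\<Sum>a<N k. mvar y ^ a * c k a)" by blast
  \<comment> \<open>The sum of the finitely many lengths serves as a common bound for the expansions
    of all coordinates.\<close>
  define M where "M = (\<Sum>k<b. N k)"
  have M: "N k \<le> M" if "k < b" for k unfolding M_def using that by (intro member_le_sum) auto
  define d where "d a k = (if k < b then c k a else 0)" for a k
  have "v k = (\<Sum>a<M. mvar y ^ a * d a k)" for k
  proof (cases "k < b")
    case True
    have "(\<Sum>a<N k. mvar y ^ a * c k a) = (\<Sum>a<M. mvar y ^ a * c k a)"
      by (rule sum.mono_neutral_left) (use c[OF True] M[OF True] in auto)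
    then show ?thesis using True c by (simp add: d_def)
  qed (use assms in \<open>simp add: d_def free_mod_out\<close>)
  moreover have "d a \<in> free_mod (poly_ring V) b" for a using c by (simp add: free_mod_def d_def)
  moreover have "d a = 0" if "M \<le> a" for a 
  proof
    fix k show "d a k = 0 k" using c[of k] M[of k] that by (auto simp: d_def)
  qed
  ultimately show ?thesis by (intro exI[of _ M] exI[of _ d]) (auto simp: fun_eq_iff fun_sum_apply)
qed

lemma free_mod_coeffs_zero:
  assumes "y \<notin> V" "\<And>a. c a \<in> free_mod (poly_ring V) b" "(\<Sum>a<N. smul (mvar y ^ a) (c a)) = 0" "a < N"
  shows "c a = (0 :: nat \<Rightarrow> ('v,'k::comm_ring_1) mpoly)"
proof
  fix k
  show "c a k = 0 k"
  proof (cases "k < b")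
    case True
    have "(\<Sum>a<N. mvar y ^ a * c a k) = 0"
      using fun_cong[OF assms(3), of k] by (simp add: fun_sum_apply)
    then show ?thesis
      using poly_ring_coeffs_zero[of y V "\<lambda>a. c a k" N a] assms True by (auto simp: free_mod_def)
  qed (use assms(2)[of a] in \<open>simp add: free_mod_out\<close>)
qed

section \<open>Comparison of graded free resolutions\<close>

text \<open>The augmentation of a resolution: coefficients go to the corresponding combination of
  the elements \<open>\<beta> k\<close>. Both sit in the same ring S, although the coefficients will
  be confined to a subring of it.\<close>

definition ev :: "(nat \<Rightarrow> 'r::comm_ring_1) \<Rightarrow> nat \<Rightarrow> (nat \<Rightarrow> 'r) \<Rightarrow> 'r" where
  "ev \<beta> b v = (\<Sum>k<b. v k * \<beta> k)"

lemma ev_0 [simp]: "ev \<beta> b 0 = 0"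
  by (simp add: ev_def)

lemma ev_add: "ev \<beta> b (u + v) = ev \<beta> b u + ev \<beta> b v"
  by (simp add: ev_def ring_distribs sum.distrib)

lemma ev_diff: "ev \<beta> b (u - v) = ev \<beta> b u - ev \<beta> b v"
  by (simp add: ev_def ring_distribs sum_subtractf)

lemma ev_smul: "ev \<beta> b (smul c v) = c * ev \<beta> b v"
  by (simp add: ev_def sum_distrib_left mult_ac)

lemma ev_lc: "ev \<beta> b (lc D c v) = ev (\<lambda>k. ev \<beta> b (D k)) c v"
proof -
  have "ev \<beta> b (lc D c v) = (\<Sum>i<b. \<Sum>k<c. v k * D k i * \<beta> i)"
    by (simp add: ev_def lc_def sum_distrib_right)
  also have "\<dots> = (\<Sum>k<c. \<Sum>i<b. v k * D k i * \<beta> i)" by (rule sum.swap)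
  finally show ?thesis by (simp add: ev_def sum_distrib_left mult.assoc)
qed

lemma ev_unit_vec: 
  assumes "k < b" shows "ev \<beta> b (unit_vec k) = \<beta> k"
proof -
  have "ev \<beta> b (unit_vec k) = (\<Sum>i<b. if i = k then \<beta> k else 0)"
    unfolding ev_def unit_vec_def by (rule sum.cong) auto
  then show ?thesis using assms by simp
qed

lemma ev_map_diff: "ev (\<lambda>k. \<beta> k - \<gamma> k) b v = ev \<beta> b v - ev \<gamma> b v"
  by (simp add: ev_def ring_distribs sum_subtractf)

lemma ev_poly_ring [simp]:
  "(\<And>k. k < b \<Longrightarrow> \<beta> k \<in> poly_ring W) \<Longrightarrow> (\<And>k. k < b \<Longrightarrow> v k \<in> poly_ring W) \<Longrightarrow> ev \<beta> b v \<in> poly_ring W"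
  by (auto simp: ev_def intro!: poly_ring_sum poly_ring_mult)

lemma ev_homog:
  assumes "\<And>k. k < b \<Longrightarrow> homog (a k) (\<beta> k)" "ghom a b e v"
  shows "homog e (ev \<beta> b v)"
  unfolding ev_def using assms
  by (intro homog_sum homog_mult'[of "e - a k" for k]) (auto simp: ghom_def)

text \<open>With \<open>D i\<close> starting in degree \<open>Suc i\<close>, no dummy differential
  out of degree 0 arises. The ranks form an infinite sequence; a finite complex is one whose ranks
  are eventually 0.\<close>

definition cpx :: "'v set \<Rightarrow> (nat \<Rightarrow> nat) \<Rightarrow> (nat \<Rightarrow> nat \<Rightarrow> int) \<Rightarrow>
    (nat \<Rightarrow> nat \<Rightarrow> nat \<Rightarrow> ('v,'k::comm_ring_1) mpoly) \<Rightarrow> bool" where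
  "cpx V b a D \<longleftrightarrow>
     (\<forall>i. \<forall>k<b (Suc i). D i k \<in> free_mod (poly_ring V) (b i)) \<and>
     (\<forall>i. \<forall>k<b (Suc i). ghom (a i) (b i) (a (Suc i) k) (D i k)) \<and>
     (\<forall>i. \<forall>k<b (Suc (Suc i)). lc (D i) (b (Suc i)) (D (Suc i) k) = 0)"

lemma cpxD:
  assumes "cpx V b a D"
  shows "k < b (Suc i) \<Longrightarrow> D i k \<in> free_mod (poly_ring V) (b i)"
    "k < b (Suc i) \<Longrightarrow> ghom (a i) (b i) (a (Suc i) k) (D i k)"
    "k < b (Suc (Suc i)) \<Longrightarrow> lc (D i) (b (Suc i)) (D (Suc i) k) = 0"
  using assms by (auto simp: cpx_def)

lemma cpx_lc_lc:
  assumes "cpx V b a D"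
  shows "lc (D i) (b (Suc i)) (lc (D (Suc i)) (b (Suc (Suc i))) v) = 0"
proof -
  have "lc (\<lambda>k. lc (D i) (b (Suc i)) (D (Suc i) k)) (b (Suc (Suc i))) v = lc (\<lambda>k. 0) (b (Suc (Suc i))) v"
    using cpxD(3)[OF assms] by (intro lc_cong) auto
  then show ?thesis by (simp add: lc_lc) (simp add: lc_def fun_eq_iff)
qed

text \<open>Exponents are natural numbers, so a factor of positive degree forces the product into
  the ideal generated by the variables. The constant term is what later tells the identity from a
  null-homotopic map.\<close>

lemma lookup_0_mult_homog:
  assumes "homog d p" "d > 0"
  shows "lookup (p * q) 0 = (0 :: 'k::comm_ring_1)"
proof (rule ccontr)
  assume "lookup (p * q) 0 \<noteq> 0"
  then have "0 \<in> keys (p * q)" by (simp add: in_keys_iff)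
  then obtain m n where mn: "0 = m + n" "m \<in> keys p" by (rule keys_multE)
  then have "mono_deg m + mono_deg n = 0" using mono_deg_add[of m n] by simp
  then show False using assms mn(2) by (auto simp: homog_def)
qed

text \<open>\<open>J\<close> plays the role of a homogeneous ideal of S, given through its closure
  properties; closure under \<open>hpart\<close> is the homogeneity.\<close>

locale quotient =
  fixes W :: "'v set" and J :: "('v, 'k::comm_ring_1) mpoly set"
  assumes J_0: "0 \<in> J"
    and J_add: "p \<in> J \<Longrightarrow> q \<in> J \<Longrightarrow> p + q \<in> J"
    and J_mult: "c \<in> poly_ring W \<Longrightarrow> p \<in> J \<Longrightarrow> c * p \<in> J"
    and J_hpart: "p \<in> J \<Longrightarrow> hpart e p \<in> J"
begin

lemma J_uminus: "p \<in> J \<Longrightarrow> - p \<in> J"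
  using J_mult[of "-1" p] by simp

lemma J_diff: "p \<in> J \<Longrightarrow> q \<in> J \<Longrightarrow> p - q \<in> J"
  using J_add[of p "- q"] J_uminus[of q] by simp

lemma J_sum: "(\<And>i. i \<in> A \<Longrightarrow> f i \<in> J) \<Longrightarrow> sum f A \<in> J"
  by (induction A rule: infinite_finite_induct) (auto intro: J_0 J_add)

lemma J_ev: "(\<And>k. k < b \<Longrightarrow> v k \<in> poly_ring W) \<Longrightarrow> (\<And>k. k < b \<Longrightarrow> \<beta> k \<in> J) \<Longrightarrow> ev \<beta> b v \<in> J"
  unfolding ev_def by (intro J_sum J_mult) auto

text \<open>A graded free resolution of S/J over the subring \<open>poly_ring V\<close>, where S is \<open>poly_ring W\<close>: the k-th
  basis vector in homological degree 0 goes to the class of \<open>\<beta> k\<close>, and \<open>D i\<close> maps degree \<open>Suc i\<close> to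
  degree i.\<close>
definition resol :: "'v set \<Rightarrow> (nat \<Rightarrow> nat) \<Rightarrow> (nat \<Rightarrow> nat \<Rightarrow> int) \<Rightarrow>
    (nat \<Rightarrow> nat \<Rightarrow> nat \<Rightarrow> ('v,'k) mpoly) \<Rightarrow> (nat \<Rightarrow> ('v,'k) mpoly) \<Rightarrow> bool" where
  "resol V b a D \<beta> \<longleftrightarrow> V \<subseteq> W \<and> cpx V b a D \<and>
     (\<forall>k<b 0. \<beta> k \<in> poly_ring W \<and> homog (a 0 k) (\<beta> k)) \<and>
     (\<forall>k<b (Suc 0). ev \<beta> (b 0) (D 0 k) \<in> J) \<and>
     (\<forall>v\<in>free_mod (poly_ring V) (b 0). ev \<beta> (b 0) v \<in> J \<longrightarrow>
        (\<exists>u\<in>free_mod (poly_ring V) (b (Suc 0)). v = lc (D 0) (b (Suc 0)) u)) \<and>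
     (\<forall>i. \<forall>v\<in>free_mod (poly_ring V) (b (Suc i)). lc (D i) (b (Suc i)) v = 0 \<longrightarrow>
        (\<exists>u\<in>free_mod (poly_ring V) (b (Suc (Suc i))). v = lc (D (Suc i)) (b (Suc (Suc i))) u)) \<and>
     (\<forall>p\<in>poly_ring W. \<exists>v\<in>free_mod (poly_ring V) (b 0). p - ev \<beta> (b 0) v \<in> J)"

lemma resolD:
  assumes "resol V b a D \<beta>"
  shows "V \<subseteq> W" "cpx V b a D"
    "k < b 0 \<Longrightarrow> \<beta> k \<in> poly_ring W" "k < b 0 \<Longrightarrow> homog (a 0 k) (\<beta> k)"
    "k < b (Suc 0) \<Longrightarrow> ev \<beta> (b 0) (D 0 k) \<in> J"
    "v \<in> free_mod (poly_ring V) (b 0) \<Longrightarrow> ev \<beta> (b 0) v \<in> J \<Longrightarrow>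
       \<exists>u\<in>free_mod (poly_ring V) (b (Suc 0)). v = lc (D 0) (b (Suc 0)) u"
    "v \<in> free_mod (poly_ring V) (b (Suc i)) \<Longrightarrow> lc (D i) (b (Suc i)) v = 0 \<Longrightarrow>
        \<exists>u\<in>free_mod (poly_ring V) (b (Suc (Suc i))). v = lc (D (Suc i)) (b (Suc (Suc i))) u"
    "p \<in> poly_ring W \<Longrightarrow> \<exists>v\<in>free_mod (poly_ring V) (b 0). p - ev \<beta> (b 0) v \<in> J"
  using assms unfolding resol_def by blast+

lemma free_mod_W: "V \<subseteq> W \<Longrightarrow> v \<in> free_mod (poly_ring V) b \<Longrightarrow> k < b \<Longrightarrow> v k \<in> poly_ring W"
  using poly_ring_mono[of V W] by (auto simp: free_mod_def)

text \<open>Truncation to components of the matching degree, as for preimages under a graded map;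
  the error term stays in \<open>J\<close> because \<open>J\<close> is homogeneous.\<close>

lemma surj_graded:
  assumes R: "resol V b a D \<beta>" and p: "p \<in> poly_ring W" "homog e p"
  obtains v where "v \<in> free_mod (poly_ring V) (b 0)" "ghom (a 0) (b 0) e v" "ev \<beta> (b 0) v - p \<in> J"
proof -
  obtain v where v: "v \<in> free_mod (poly_ring V) (b 0)" "p - ev \<beta> (b 0) v \<in> J"
    using resolD(8)[OF R p(1)] by blast
  define w where "w = (\<lambda>k. if k < b 0 then hpart (e - a 0 k) (v k) else 0)"
  have "hpart e (p - ev \<beta> (b 0) v) = p - ev \<beta> (b 0) w"
    using resolD(4)[OF R] p(2)
    by (auto simp: hpart_diff hpart_id ev_def hpart_sum w_def intro!: sum.cong hpart_mult)
  then have "p - ev \<beta> (b 0) w \<in> J" using J_hpart[OF v(2), of e] by (simp only:)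
  then have "ev \<beta> (b 0) w - p \<in> J" using J_uminus by fastforce
  moreover have "w \<in> free_mod (poly_ring V) (b 0)" "ghom (a 0) (b 0) e w"
    using v by (auto simp: free_mod_def ghom_def w_def)
  ultimately show ?thesis using that by blast
qed

text \<open>The comparison theorem: images of basis vectors are lifted degree by degree through an
  exact target. The source is merely a complex augmented to S/J, with its own degrees and its own
  \<open>\<beta>\<close>. This freedom allows two uses: between two resolutions, and for lifting
  multiplication by a variable from a complex to itself.\<close>

lemma comparison:
  assumes C: "cpx V b a D" "\<And>k. k < b 0 \<Longrightarrow> \<beta> k \<in> poly_ring W \<and> homog (a 0 k) (\<beta> k)"
    "\<And>k. k < b (Suc 0) \<Longrightarrow> ev \<beta> (b 0) (D 0 k) \<in> J"
    and R: "resol V b' a' D' \<beta>'"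
  obtains f where "\<And>i k. k < b i \<Longrightarrow> f i k \<in> free_mod (poly_ring V) (b' i)"
    "\<And>i k. k < b i \<Longrightarrow> ghom (a' i) (b' i) (a i k) (f i k)"
    "\<And>k. k < b 0 \<Longrightarrow> ev \<beta>' (b' 0) (f 0 k) - \<beta> k \<in> J"
    "\<And>i k. k < b (Suc i) \<Longrightarrow> lc (D' i) (b' (Suc i)) (f (Suc i) k) = lc (f i) (b i) (D i k)"
proof -
  note CR = resolD(2)[OF R]
  \<comment> \<open>Dependent choice sees only the latest map \<open>F\<close>. The invariant
    therefore already records that the images of the next boundaries lie in the image of
    \<open>D' n\<close>, which is all that the next lift requires.\<close>
  define P where "P n F \<longleftrightarrow> 
    (\<forall>k<b n. F k \<in> free_mod (poly_ring V) (b' n) \<and> ghom (a' n) (b' n) (a n k) (F k)) \<and>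
    (n = 0 \<longrightarrow> (\<forall>k<b 0. ev \<beta>' (b' 0) (F k) - \<beta> k \<in> J)) \<and>
    (\<forall>k<b (Suc n). \<exists>u\<in>free_mod (poly_ring V) (b' (Suc n)). lc F (b n) (D n k) = lc (D' n) (b' (Suc n)) u)"
    for n F
  define Q where "Q n F F' \<longleftrightarrow> (\<forall>k<b (Suc n). lc (D' n) (b' (Suc n)) (F' k) = lc F (b n) (D n k))" for n F F'
  have "\<exists>f. \<forall>n. P n (f n) \<and> Q n (f n) (f (Suc n))"
  proof (rule dependent_nat_choice)
    have "\<forall>k. \<exists>v. k < b 0 \<longrightarrow> v \<in> free_mod (poly_ring V) (b' 0) \<and> ghom (a' 0) (b' 0) (a 0 k) v
            \<and> ev \<beta>' (b' 0) v - \<beta> k \<in> J"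
    proof
      fix k
      show "\<exists>v. k < b 0 \<longrightarrow> v \<in> free_mod (poly_ring V) (b' 0) \<and> ghom (a' 0) (b' 0) (a 0 k) v
            \<and> ev \<beta>' (b' 0) v - \<beta> k \<in> J"
      proof (cases "k < b 0")
        case True
        obtain v where "v \<in> free_mod (poly_ring V) (b' 0)" "ghom (a' 0) (b' 0) (a 0 k) v"
            "ev \<beta>' (b' 0) v - \<beta> k \<in> J"
          using C(2)[OF True] by (blast intro: surj_graded[OF R])
        then show ?thesis by blast
      qed auto
    qed
    then obtain F where F: "\<And>k. k < b 0 \<Longrightarrow> F k \<in> free_mod (poly_ring V) (b' 0)"
        "\<And>k. k < b 0 \<Longrightarrow> ghom (a' 0) (b' 0) (a 0 k) (F k)"
        "\<And>k. k < b 0 \<Longrightarrow> ev \<beta>' (b' 0) (F k) - \<beta> k \<in> J" by metis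
    have "\<exists>u\<in>free_mod (poly_ring V) (b' (Suc 0)). lc F (b 0) (D 0 k) = lc (D' 0) (b' (Suc 0)) u"
      if k: "k < b (Suc 0)" for k
    proof (rule resolD(6)[OF R])
      show "lc F (b 0) (D 0 k) \<in> free_mod (poly_ring V) (b' 0)"
        using F(1) cpxD(1)[OF C(1) k] by (rule lc_free_mod)
      have "ev (\<lambda>k. ev \<beta>' (b' 0) (F k) - \<beta> k) (b 0) (D 0 k) \<in> J"
        using F(3) free_mod_W[OF resolD(1)[OF R] cpxD(1)[OF C(1) k]] by (intro J_ev) auto
      then have "ev \<beta>' (b' 0) (lc F (b 0) (D 0 k)) - ev \<beta> (b 0) (D 0 k) \<in> J"
        by (simp add: ev_map_diff ev_lc)
      then show "ev \<beta>' (b' 0) (lc F (b 0) (D 0 k)) \<in> J"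
        using J_add[OF _ C(3)[OF k]] by fastforce
    qed
    then show "\<exists>F. P 0 F" using F unfolding P_def by blast
  next
    fix F n assume P: "P n F"
    have "\<exists>v. k < b (Suc n) \<longrightarrow> v \<in> free_mod (poly_ring V) (b' (Suc n)) 
         \<and> ghom (a' (Suc n)) (b' (Suc n)) (a (Suc n) k) v \<and> lc (D' n) (b' (Suc n)) v = lc F (b n) (D n k)" for k
    proof (cases "k < b (Suc n)")
      case k: True
      then obtain u where u: "u \<in> free_mod (poly_ring V) (b' (Suc n))" 
          "lc F (b n) (D n k) = lc (D' n) (b' (Suc n)) u"
        using P unfolding P_def by blast
      have "ghom (a' n) (b' n) (a (Suc n) k) (lc F (b n) (D n k))"
        using P cpxD(2)[OF C(1) k] unfolding P_def by (intro ghom_lc[of _ _ _ "a n" 0]) auto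
      then have "ghom (a' n) (b' n) (a (Suc n) k) (lc (D' n) (b' (Suc n)) u)" unfolding u(2) .
      then obtain w where "w \<in> free_mod (poly_ring V) (b' (Suc n))"
          "ghom (a' (Suc n)) (b' (Suc n)) (a (Suc n) k) w" "lc (D' n) (b' (Suc n)) w = lc (D' n) (b' (Suc n)) u"
        using graded_preimage[of "b' (Suc n)" "D' n" V "b' n" "a' n" "a' (Suc n)" u "a (Suc n) k"]
          cpxD(1,2)[OF CR, where i = n] u(1) by blast
      then show ?thesis unfolding u(2) by blast
    qed auto
    then obtain F' where F': "\<And>k. k < b (Suc n) \<Longrightarrow> F' k \<in> free_mod (poly_ring V) (b' (Suc n)) 
         \<and> ghom (a' (Suc n)) (b' (Suc n)) (a (Suc n) k) (F' k) \<and> 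
         lc (D' n) (b' (Suc n)) (F' k) = lc F (b n) (D n k)"
      by metis
    have "\<exists>u\<in>free_mod (poly_ring V) (b' (Suc (Suc n))). 
        lc F' (b (Suc n)) (D (Suc n) k) = lc (D' (Suc n)) (b' (Suc (Suc n))) u"
      if k: "k < b (Suc (Suc n))" for k
    proof (rule resolD(7)[OF R])
      show "lc F' (b (Suc n)) (D (Suc n) k) \<in> free_mod (poly_ring V) (b' (Suc n))"
        using F' cpxD(1)[OF C(1) k] by (intro lc_free_mod) auto
      have "lc (D' n) (b' (Suc n)) (lc F' (b (Suc n)) (D (Suc n) k)) 
          = lc (\<lambda>j. lc F (b n) (D n j)) (b (Suc n)) (D (Suc n) k)"
        unfolding lc_lc using F' by (intro lc_cong) auto
      also have "\<dots> = 0" using cpxD(3)[OF C(1) k] by (simp flip: lc_lc)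
      finally show "lc (D' n) (b' (Suc n)) (lc F' (b (Suc n)) (D (Suc n) k)) = 0" .
    qed
    then have "P (Suc n) F'" "Q n F F'" using F' unfolding P_def Q_def by auto
    then show "\<exists>F'. P (Suc n) F' \<and> Q n F F'" by blast
  qed
  then obtain f where f: "\<And>n. P n (f n)" "\<And>n. Q n (f n) (f (Suc n))" by blast
  show ?thesis by (rule that[of f]) (use f in \<open>auto simp: P_def Q_def\<close>)
qed

text \<open>A chain self-map of a resolution inducing zero on S/J is homotopic to zero, by
  successive lifting. The homotopy is not claimed to be homogeneous: its later use exploits only the
  degrees of the differentials.\<close>

lemma null_homotopy:
  assumes R: "resol V b a D \<beta>"
    and \<phi>: "\<And>i k. k < b i \<Longrightarrow> \<phi> i k \<in> free_mod (poly_ring V) (b i)"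
      "\<And>k. k < b 0 \<Longrightarrow> ev \<beta> (b 0) (\<phi> 0 k) \<in> J"
      "\<And>i k. k < b (Suc i) \<Longrightarrow> lc (D i) (b (Suc i)) (\<phi> (Suc i) k) = lc (\<phi> i) (b i) (D i k)"
  obtains h where "\<And>i k. k < b i \<Longrightarrow> h i k \<in> free_mod (poly_ring V) (b (Suc i))"
    "\<And>k. k < b 0 \<Longrightarrow> \<phi> 0 k = lc (D 0) (b (Suc 0)) (h 0 k)"
    "\<And>i k. k < b (Suc i) \<Longrightarrow> \<phi> (Suc i) k = lc (D (Suc i)) (b (Suc (Suc i))) (h (Suc i) k) + lc (h i) (b i) (D i k)"
proof -
  note C = resolD(2)[OF R]
  \<comment> \<open>The last clause says that the map in degree \<open>Suc n\<close>, corrected by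
    the homotopy found so far, takes values in cycles; exactness then yields the next stage of the
    homotopy.\<close>
  define P where "P n H \<longleftrightarrow> 
    (\<forall>k<b n. H k \<in> free_mod (poly_ring V) (b (Suc n))) \<and>
    (n = 0 \<longrightarrow> (\<forall>k<b 0. \<phi> 0 k = lc (D 0) (b (Suc 0)) (H k))) \<and>
    (\<forall>k<b (Suc n). lc (D n) (b (Suc n)) (\<phi> (Suc n) k - lc H (b n) (D n k)) = 0)"
    for n H
  define Q where "Q n H H' \<longleftrightarrow> (\<forall>k<b (Suc n).
     \<phi> (Suc n) k = lc (D (Suc n)) (b (Suc (Suc n))) (H' k) + lc H (b n) (D n k))" for n H H'
  have "\<exists>f. \<forall>n. P n (f n) \<and> Q n (f n) (f (Suc n))"
  proof (rule dependent_nat_choice)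
    obtain H where H: "\<And>k. k < b 0 \<Longrightarrow> H k \<in> free_mod (poly_ring V) (b (Suc 0))"
        "\<And>k. k < b 0 \<Longrightarrow> \<phi> 0 k = lc (D 0) (b (Suc 0)) (H k)" 
      using resolD(6)[OF R \<phi>(1,2)] by metis
    have "lc (D 0) (b (Suc 0)) (\<phi> (Suc 0) k - lc H (b 0) (D 0 k)) = 0"
      if k: "k < b (Suc 0)" for k
    proof -
      have "lc (\<lambda>j. lc (D 0) (b (Suc 0)) (H j)) (b 0) (D 0 k) = lc (\<phi> 0) (b 0) (D 0 k)"
        using H(2) by (intro lc_cong) auto
      then show ?thesis using \<phi>(3)[OF k] by (simp add: lc_diff lc_lc)
    qed
    then show "\<exists>H. P 0 H" using H unfolding P_def by blast
  next
    fix H n assume P: "P n H"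
    have "\<exists>v. k < b (Suc n) \<longrightarrow> v \<in> free_mod (poly_ring V) (b (Suc (Suc n))) 
         \<and> \<phi> (Suc n) k = lc (D (Suc n)) (b (Suc (Suc n))) v + lc H (b n) (D n k)" for k
    proof (cases "k < b (Suc n)")
      case k: True
      have "lc H (b n) (D n k) \<in> free_mod (poly_ring V) (b (Suc n))"
        using P cpxD(1)[OF C k] unfolding P_def by (intro lc_free_mod) auto
      then have "\<phi> (Suc n) k - lc H (b n) (D n k) \<in> free_mod (poly_ring V) (b (Suc n))"
        using \<phi>(1)[OF k] by simp
      then obtain v where "v \<in> free_mod (poly_ring V) (b (Suc (Suc n)))"
        "\<phi> (Suc n) k - lc H (b n) (D n k) = lc (D (Suc n)) (b (Suc (Suc n))) v"
        using resolD(7)[OF R] P k unfolding P_def by blast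
      then show ?thesis by (metis diff_add_cancel)
    qed auto
    then obtain H' where H': "\<And>k. k < b (Suc n) \<Longrightarrow> H' k \<in> free_mod (poly_ring V) (b (Suc (Suc n)))"
       "\<And>k. k < b (Suc n) \<Longrightarrow> \<phi> (Suc n) k = lc (D (Suc n)) (b (Suc (Suc n))) (H' k) + lc H (b n) (D n k)"
      by metis
    have "lc (D (Suc n)) (b (Suc (Suc n))) (\<phi> (Suc (Suc n)) k - lc H' (b (Suc n)) (D (Suc n) k)) = 0"
      if k: "k < b (Suc (Suc n))" for k
    proof -
      have "lc (\<lambda>j. lc (D (Suc n)) (b (Suc (Suc n))) (H' j)) (b (Suc n)) (D (Suc n) k)
          = lc (\<lambda>j. \<phi> (Suc n) j - lc H (b n) (D n j)) (b (Suc n)) (D (Suc n) k)"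
        using H'(2) by (intro lc_cong) auto
      also have "\<dots> = lc (\<phi> (Suc n)) (b (Suc n)) (D (Suc n) k)"
        using cpxD(3)[OF C k] by (simp add: lc_map_diff flip: lc_lc)
      finally show ?thesis using \<phi>(3)[OF k] by (simp add: lc_diff lc_lc)
    qed
    then have "P (Suc n) H'" "Q n H H'" using H' unfolding P_def Q_def by auto
    then show "\<exists>H'. P (Suc n) H' \<and> Q n H H'" by blast
  qed
  then obtain h where h: "\<And>n. P n (h n)" "\<And>n. Q n (h n) (h (Suc n))" by blast
  show ?thesis by (rule that[of h]) (use h in \<open>auto simp: P_def Q_def\<close>)
qed

text \<open>A chain map through F sends the basis vector of top degree into the maximal ideal, and so
  does its boundary, so that the identity cannot be homotopic to it.\<close>
lemma resol_degree_bound: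
  assumes G: "resol V b a D \<beta>" and F: "resol V b' a' D' \<beta>'"
    and s: "b (Suc n) = 0" "k0 < b n" "a n k0 = int n + s" "\<And>i k. k < b i \<Longrightarrow> a i k \<le> int i + s"
  shows "\<exists>i k. k < b' i \<and> a' i k \<ge> int i + s"
proof (rule ccontr)
  assume "\<not> ?thesis"
  then have small: "a' i k < int i + s" if "k < b' i" for i k using that by force
  note VW = resolD(1)[OF G]
  note CG = resolD(2)[OF G] and CF = resolD(2)[OF F]
  obtain f where f: "\<And>i k. k < b i \<Longrightarrow> f i k \<in> free_mod (poly_ring V) (b' i)"
    "\<And>i k. k < b i \<Longrightarrow> ghom (a' i) (b' i) (a i k) (f i k)"
    "\<And>k. k < b 0 \<Longrightarrow> ev \<beta>' (b' 0) (f 0 k) - \<beta> k \<in> J"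
    "\<And>i k. k < b (Suc i) \<Longrightarrow> lc (D' i) (b' (Suc i)) (f (Suc i) k) = lc (f i) (b i) (D i k)"
    by (rule comparison[OF CG conjI[OF resolD(3,4)[OF G]] resolD(5)[OF G] F]) auto
  obtain g where g: "\<And>i k. k < b' i \<Longrightarrow> g i k \<in> free_mod (poly_ring V) (b i)"
    "\<And>k. k < b' 0 \<Longrightarrow> ev \<beta> (b 0) (g 0 k) - \<beta>' k \<in> J"
    "\<And>i k. k < b' (Suc i) \<Longrightarrow> lc (D i) (b (Suc i)) (g (Suc i) k) = lc (g i) (b' i) (D' i k)"
    by (rule comparison[OF CF conjI[OF resolD(3,4)[OF F]] resolD(5)[OF F] G]) auto
  \<comment> \<open>The composite through the second resolution minus the identity; it induces zero
    on S/J.\<close>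
  define \<phi> where "\<phi> i k = lc (g i) (b' i) (f i k) - unit_vec k" for i k
  have "\<phi> i k \<in> free_mod (poly_ring V) (b i)" if "k < b i" for i k
    unfolding \<phi>_def using that g(1) f(1) by (intro free_mod_diff lc_free_mod) auto
  moreover have "ev \<beta> (b 0) (\<phi> 0 k) \<in> J" if k: "k < b 0" for k
  proof -
    have "ev (\<lambda>j. ev \<beta> (b 0) (g 0 j) - \<beta>' j) (b' 0) (f 0 k) \<in> J"
      using g(2) free_mod_W[OF VW f(1)[OF k]] by (intro J_ev) auto
    from J_add[OF this f(3)[OF k]] show ?thesis
      using k by (simp add: \<phi>_def ev_map_diff ev_diff ev_lc ev_unit_vec)
  qed
  moreover have "lc (D i) (b (Suc i)) (\<phi> (Suc i) k) = lc (\<phi> i) (b i) (D i k)" if k: "k < b (Suc i)" for i k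
  proof -
    have "lc (D i) (b (Suc i)) (lc (g (Suc i)) (b' (Suc i)) (f (Suc i) k))
        = lc (\<lambda>j. lc (g i) (b' i) (D' i j)) (b' (Suc i)) (f (Suc i) k)"
      unfolding lc_lc using g(3) by (intro lc_cong) auto
    also have "\<dots> = lc (g i) (b' i) (lc (f i) (b i) (D i k))"
      using f(4)[OF k] by (simp flip: lc_lc)
    finally show ?thesis
      using k cpxD(1)[OF CG k] unfolding \<phi>_def 
      by (simp add: lc_diff lc_unit_vec lc_map_diff lc_unit_vec_id flip: lc_lc)
  qed
  ultimately obtain h where h: "\<And>i k. k < b i \<Longrightarrow> h i k \<in> free_mod (poly_ring V) (b (Suc i))"
    "\<And>k. k < b 0 \<Longrightarrow> \<phi> 0 k = lc (D 0) (b (Suc 0)) (h 0 k)"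
    "\<And>i k. k < b (Suc i) \<Longrightarrow> \<phi> (Suc i) k = lc (D (Suc i)) (b (Suc (Suc i))) (h (Suc i) k) + lc (h i) (b i) (D i k)"
    by (rule null_homotopy[OF G, of \<phi>]) auto
  have 1: "lookup (lc (g n) (b' n) (f n k0) k0) 0 = 0"
    unfolding lc_def lookup_sum
  proof (rule sum.neutral, rule ballI)
    fix j assume "j \<in> {..<b' n}"
    then show "lookup (f n k0 j * g n j k0) 0 = 0"
      using f(2)[OF s(2)] small[of j n] s(3)
      by (intro lookup_0_mult_homog[of "a n k0 - a' n j"]) (auto simp: ghom_def)
  qed
  \<comment> \<open>As \<open>b (Suc n) = 0\<close>, the part of the homotopy that passes through
    the next module vanishes. The other part starts with the differential of the basis vector
    \<open>k0\<close>, whose entries have degree at least one because all degrees in the preceding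
    module are at most \<open>int n - 1 + s\<close>.\<close>
  have 2: "lookup (\<phi> n k0 k0) 0 = 0"
  proof (cases n)
    case 0
    then show ?thesis using h(2)[of k0] s(1,2) by simp
  next
    case (Suc m)
    have "\<phi> n k0 = lc (h m) (b m) (D m k0)" using h(3)[of k0 m] s(1,2) Suc by simp
    moreover have "lookup (lc (h m) (b m) (D m k0) k0) 0 = 0"
      unfolding lc_def lookup_sum
    proof (rule sum.neutral, rule ballI)
      fix j assume "j \<in> {..<b m}"
      then show "lookup (D m k0 j * h m j k0) 0 = 0"
        using cpxD(2)[OF CG, of k0 m] s(2,3) s(4)[of j m] Suc
        by (intro lookup_0_mult_homog[of "a n k0 - a m j"]) (auto simp: ghom_def)
    qed
    ultimately show ?thesis by simp
  qed
  from 1 2 show False by (simp add: \<phi>_def lookup_minus unit_vec_def)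
qed

end

section \<open>Adjoining a variable\<close>

lemma free_mod_coeffs_eventually:
  assumes "v \<in> free_mod (poly_ring (insert y V)) b"
  shows "\<exists>N c. (\<forall>a. c a \<in> free_mod (poly_ring V) b) \<and> (\<forall>a\<ge>N. c a = 0)
     \<and> (\<forall>K\<ge>N. v = (\<Sum>a<K. smul (mvar y ^ a) (c a)))"
proof -
  obtain N c where *: "\<forall>a. c a \<in> free_mod (poly_ring V) b" "\<forall>a\<ge>N. c a = 0" "v = (\<Sum>a<N. smul (mvar y ^ a) (c a))"
    using free_mod_coeffs_ex[OF assms] by blast
  have "v = (\<Sum>a<K. smul (mvar y ^ a) (c a))" if "N \<le> K" for K
    unfolding *(3) using that *(2) by (intro sum.mono_neutral_left) (auto simp: smul_def zero_fun_def)
  then show ?thesis using * by (intro exI[of _ N] exI[of _ c]) simp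
qed

lemma lc_coeffs: "lc D b (\<Sum>a<K. smul (t a) (c a)) = (\<Sum>a<K. smul (t a) (lc D b (c a)))"
  by (simp add: lc_sum lc_smul)

lemma smul_diff: "smul (t::'r::comm_ring_1) (u - v) = smul t u - smul t v"
  by (simp add: fun_eq_iff ring_distribs)

lemma smul_add: "smul (t::'r::comm_ring_1) (u + v) = smul t u + smul t v"
  by (simp add: fun_eq_iff ring_distribs)

lemma smul_smul: "smul (s::'r::comm_ring_1) (smul t v) = smul (s * t) v"
  by (simp add: fun_eq_iff mult.assoc)

lemma nat_less_add_cases:
  fixes k m n :: nat
  assumes "k < m + n" "\<And>j. j < m \<Longrightarrow> P j" "\<And>j. j < n \<Longrightarrow> P (m + j)"
  shows "P k"
  using assms(1) assms(2)[of k] assms(3)[of "k - m"] by (cases "k < m") auto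

context quotient
begin

text \<open>Let T be the ring in the variables \<open>V\<close> and M the module S/J over T. The
  given complex, with coefficients extended to T[y], resolves M[y]. The module M with its action of
  y is the cokernel of the endomorphism of M[y] given by y minus that action, which is injective by
  comparison of top powers of y. Hence the mapping cone of a lift resolves M over T[y]. Its second
  summand is a copy of the old complex moved up by one index, with degrees raised by one, the degree
  of y.\<close>

lemma cone_step:
  assumes R: "resol V b a D \<beta>" and y: "y \<in> W" "y \<notin> V"
  defines "b2 \<equiv> (\<lambda>i. case i of 0 \<Rightarrow> b 0 | Suc j \<Rightarrow> b (Suc j) + b j)"
    and "a2 \<equiv> (\<lambda>i. case i of 0 \<Rightarrow> a 0 | Suc j \<Rightarrow> cat (b (Suc j)) (a (Suc j)) (\<lambda>k. a j k + 1))"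
  shows "\<exists>D2. resol (insert y V) b2 a2 D2 \<beta>"
proof -
  define S where "S = (poly_ring V :: ('v,'k) mpoly set)"
  define S' where "S' = (poly_ring (insert y V) :: ('v,'k) mpoly set)"
  define t where "t = (mvar y :: ('v,'k) mpoly)"
  have t[simp]: "t \<in> S'" "t ^ n \<in> S'" for n by (simp_all add: t_def S'_def)
  note C = resolD(2)[OF R] and V = resolD(1)[OF R]
  have SS': "v \<in> free_mod S n \<Longrightarrow> v \<in> free_mod S' n" for v n
    using free_mod_mono[of V "insert y V"] by (auto simp: S_def S'_def)
  have zero[simp]: "0 \<in> free_mod S n" "0 \<in> free_mod S' n" for n by (simp_all add: S_def S'_def)
  \<comment> \<open>The complex with all degrees raised by one and augmentation multiplied by
    \<open>t\<close> is compared with the original, so \<open>\<phi>\<close> has entries over the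
    old ring and lifts the action of y with degree one.\<close>
  obtain \<phi> where \<phi>: "\<And>i k. k < b i \<Longrightarrow> \<phi> i k \<in> free_mod S (b i)"
    "\<And>i k. k < b i \<Longrightarrow> ghom (a i) (b i) (a i k + 1) (\<phi> i k)"
    "\<And>k. k < b 0 \<Longrightarrow> ev \<beta> (b 0) (\<phi> 0 k) - t * \<beta> k \<in> J"
    "\<And>i k. k < b (Suc i) \<Longrightarrow> lc (D i) (b (Suc i)) (\<phi> (Suc i) k) = lc (\<phi> i) (b i) (D i k)"
    unfolding S_def
  proof (rule comparison[where V = V and D = D and b = b and a = "\<lambda>i k. a i k + 1" and \<beta> = "\<lambda>k. t * \<beta> k"])
    show "cpx V b (\<lambda>i k. a i k + 1) D" using C by (auto simp: cpx_def ghom_def)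
    show "t * \<beta> k \<in> poly_ring W \<and> homog (a 0 k + 1) (t * \<beta> k)" if "k < b 0" for k
      using resolD(3,4)[OF R that] y(1) by (auto simp: t_def intro!: homog_mult'[OF homog_mvar])
    show "ev (\<lambda>k. t * \<beta> k) (b 0) (D 0 k) \<in> J" if "k < b (Suc 0)" for k
    proof -
      have "ev (\<lambda>k. t * \<beta> k) (b 0) (D 0 k) = t * ev \<beta> (b 0) (D 0 k)"
        by (simp add: ev_def sum_distrib_left mult_ac)
      then show ?thesis using J_mult[OF _ resolD(5)[OF R that]] y(1) by (simp add: t_def)
    qed
  qed (use R in auto)
  define \<psi> where "\<psi> i k = smul t (unit_vec k) - \<phi> i k" for i k
  define Dm where "Dm i = lc (D i) (b (Suc i))" for i
  define \<phi>m where "\<phi>m i = lc (\<phi> i) (b i)" for i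
  define \<psi>m where "\<psi>m i = lc (\<psi> i) (b i)" for i
  have \<psi>m: "\<psi>m i v = smul t v - \<phi>m i v" if "v \<in> free_mod S' (b i)" for i v
  proof -
    have "\<psi> i = (\<lambda>k. smul t (unit_vec k) - \<phi> i k)" by (simp add: \<psi>_def fun_eq_iff)
    then show ?thesis
      using lc_unit_vec_id[OF that] by (simp add: \<psi>m_def \<phi>m_def lc_map_diff lc_map_smul)
  qed
  have \<psi>_mem: "\<psi> i k \<in> free_mod S' (b i)" if "k < b i" for i k
    using SS'[OF \<phi>(1)[OF that]] that by (auto simp: \<psi>_def S'_def t_def)
  have \<psi>_gh: "ghom (a i) (b i) (a i k + 1) (\<psi> i k)" if "k < b i" for i k
    unfolding \<psi>_def using \<phi>(2)[OF that] ghom_unit_vec[of "a i" "b i" k]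
    by (intro ghom_diff ghom_smul[of 1]) (auto simp: t_def)
  have \<psi>_ev: "ev \<beta> (b 0) (\<psi> 0 k) \<in> J" if "k < b 0" for k
    using J_uminus[OF \<phi>(3)[OF that]] that by (simp add: \<psi>_def ev_diff ev_smul ev_unit_vec)
  have \<phi>_Dm: "Dm i (\<phi>m (Suc i) v) = \<phi>m i (Dm i v)" for i v
    unfolding Dm_def \<phi>m_def lc_lc using \<phi>(4) by (intro lc_cong) auto
  have \<psi>_D: "Dm i (\<psi> (Suc i) k) = \<psi>m i (D i k)" if "k < b (Suc i)" for i k
    using \<phi>(4)[OF that] \<psi>m[OF SS'[unfolded S_def, OF cpxD(1)[OF C that]]] lc_unit_vec[OF that, of "D i"]
    by (simp add: \<psi>_def Dm_def \<phi>m_def lc_diff lc_smul)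
  have \<psi>_Dm: "Dm i (\<psi>m (Suc i) v) = \<psi>m i (Dm i v)" for i v
    unfolding Dm_def \<psi>m_def lc_lc using \<psi>_D[unfolded Dm_def \<psi>m_def] by (intro lc_cong) auto
  have Dm_mem: "Dm i v \<in> free_mod S (b i)" if "v \<in> free_mod S (b (Suc i))" for i v
    using that cpxD(1)[OF C] unfolding Dm_def S_def by (intro lc_free_mod) auto
  have Dm_mem': "Dm i v \<in> free_mod S' (b i)" if "v \<in> free_mod S' (b (Suc i))" for i v
    using that SS'[unfolded S_def, OF cpxD(1)[OF C]] unfolding Dm_def S'_def by (intro lc_free_mod) auto
  have \<phi>m_mem: "\<phi>m i v \<in> free_mod S (b i)" if "v \<in> free_mod S (b i)" for i v
    using that \<phi>(1) unfolding \<phi>m_def S_def by (intro lc_free_mod) auto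
  have \<psi>m_mem: "\<psi>m i v \<in> free_mod S' (b i)" if "v \<in> free_mod S' (b i)" for i v
    using that \<psi>_mem unfolding \<psi>m_def S'_def by (intro lc_free_mod) auto
  have lift: "(\<Sum>a<K. smul (t ^ a) (c a)) \<in> free_mod S' n" if "\<And>a. c a \<in> free_mod S n" for c K n
    using SS'[OF that] unfolding S'_def t_def by (intro free_mod_sum free_mod_smul) auto
  have coeffs: "\<exists>N c. (\<forall>a. c a \<in> free_mod S n) \<and> (\<forall>a\<ge>N. c a = 0)
     \<and> (\<forall>K\<ge>N. v = (\<Sum>a<K. smul (t ^ a) (c a)))" if "v \<in> free_mod S' n" for v n
    using free_mod_coeffs_eventually[OF that[unfolded S'_def]] unfolding S_def t_def .
  \<comment> \<open>The matrices of the old complex do not involve y, so a cycle over the larger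
    ring is a cycle coefficient by coefficient.\<close>
  have exact: "\<exists>u\<in>free_mod S' (b (Suc (Suc i))). v = Dm (Suc i) u"
    if v: "v \<in> free_mod S' (b (Suc i))" "Dm i v = 0" for i v
  proof -
    obtain N c where "(\<forall>a. c a \<in> free_mod S (b (Suc i))) \<and> (\<forall>a\<ge>N. c a = 0)
        \<and> (\<forall>K\<ge>N. v = (\<Sum>a<K. smul (t ^ a) (c a)))"
      using coeffs[OF v(1)] by (elim exE)
    then have c: "\<And>a. c a \<in> free_mod S (b (Suc i))" "v = (\<Sum>a<N. smul (t ^ a) (c a))"
      by simp_all
    have "\<exists>u\<in>free_mod S (b (Suc (Suc i))). c a = Dm (Suc i) u" if "a < N" for a
    proof -
      have "(\<Sum>a<N. smul (t ^ a) (Dm i (c a))) = 0"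
        using v(2) unfolding c(2) Dm_def lc_coeffs .
      then have "Dm i (c a) = 0"
        using free_mod_coeffs_zero[OF y(2), of "\<lambda>a. Dm i (c a)"] Dm_mem[OF c(1)] that
        unfolding S_def t_def by blast
      then show ?thesis using resolD(7)[OF R] c(1) unfolding Dm_def S_def by blast
    qed
    then obtain u where u: "\<And>a. a < N \<Longrightarrow> u a \<in> free_mod S (b (Suc (Suc i)))" "\<And>a. a < N \<Longrightarrow> c a = Dm (Suc i) (u a)"
      by metis
    have "v = Dm (Suc i) (\<Sum>a<N. smul (t ^ a) (u a))"
      unfolding c(2) Dm_def lc_coeffs by (rule sum.cong) (use u(2) Dm_def in auto)
    moreover have "(\<Sum>a<N. smul (t ^ a) (u a)) \<in> free_mod S' (b (Suc (Suc i)))"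
      using SS'[OF u(1)] unfolding S'_def t_def by (intro free_mod_sum free_mod_smul) auto
    ultimately show ?thesis by blast
  qed
  \<comment> \<open>Injectivity of y minus its action, one level up: a vector sent to a boundary is
    a boundary. Comparing coefficients of the power \<open>Suc a\<close> expresses
    \<open>c a\<close> through \<open>\<phi>m 0 (c (Suc a))\<close> and a boundary, and the
    coefficients vanish for large indices, so the claim descends from the top.\<close>
  have inj: "\<exists>w\<in>free_mod S' (b (Suc 0)). v = Dm 0 w"
    if vu: "v \<in> free_mod S' (b 0)" "u \<in> free_mod S' (b (Suc 0))" "\<psi>m 0 v = Dm 0 u" for v u
  proof -
    obtain N c where "(\<forall>a. c a \<in> free_mod S (b 0)) \<and> (\<forall>a\<ge>N. c a = 0)
        \<and> (\<forall>K\<ge>N. v = (\<Sum>a<K. smul (t ^ a) (c a)))"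
      using coeffs[OF vu(1)] by (elim exE)
    then have c: "\<And>a. c a \<in> free_mod S (b 0)" "\<And>a. N \<le> a \<Longrightarrow> c a = 0"
      "\<And>K. N \<le> K \<Longrightarrow> v = (\<Sum>a<K. smul (t ^ a) (c a))"
      by simp_all
    obtain M d where "(\<forall>a. d a \<in> free_mod S (b (Suc 0))) \<and> (\<forall>a\<ge>M. d a = 0)
        \<and> (\<forall>K\<ge>M. u = (\<Sum>a<K. smul (t ^ a) (d a)))"
      using coeffs[OF vu(2)] by (elim exE)
    then have d: "\<And>a. d a \<in> free_mod S (b (Suc 0))" "\<And>a. M \<le> a \<Longrightarrow> d a = 0"
      "\<And>K. M \<le> K \<Longrightarrow> u = (\<Sum>a<K. smul (t ^ a) (d a))"
      by simp_all
    define K where "K = max N M"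
    \<comment> \<open>The coefficients of \<open>smul t v\<close>: those of \<open>v\<close>, one
      power higher.\<close>
    define c' where "c' a = (case a of 0 \<Rightarrow> 0 | Suc j \<Rightarrow> c j)" for a
    have c'_mem: "c' a \<in> free_mod S (b 0)" for a using c(1) by (auto simp: c'_def split: nat.split)
    have tv: "smul t v = (\<Sum>a<Suc K. smul (t ^ a) (c' a))"
    proof -
      have "(\<Sum>a<Suc K. smul (t ^ a) (c' a)) = (\<Sum>a<K. smul (t ^ Suc a) (c a)) + smul (t ^ 0) 0"
        unfolding sum.lessThan_Suc_shift by (simp add: c'_def add.commute)
      also have "\<dots> = smul t (\<Sum>a<K. smul (t ^ a) (c a))"
        by (simp add: smul_sum smul_smul) (simp add: fun_eq_iff)
      finally show ?thesis using c(3)[of K] by (simp add: K_def)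
    qed
    have "(\<Sum>a<Suc K. smul (t ^ a) (c' a - \<phi>m 0 (c a) - Dm 0 (d a))) 
        = smul t v - \<phi>m 0 (\<Sum>a<Suc K. smul (t ^ a) (c a)) - Dm 0 (\<Sum>a<Suc K. smul (t ^ a) (d a))"
      unfolding tv \<phi>m_def Dm_def lc_coeffs by (simp only: smul_diff sum_subtractf)
    also have "\<dots> = 0"
      using c(3)[of "Suc K"] d(3)[of "Suc K"] vu(3) \<psi>m[OF vu(1)] by (simp add: K_def)
    finally have sum0: "(\<Sum>a<Suc K. smul (t ^ a) (c' a - \<phi>m 0 (c a) - Dm 0 (d a))) = 0" .
    have rel: "c' a = \<phi>m 0 (c a) + Dm 0 (d a)" if "a < Suc K" for a
    proof -
      have "c' a - \<phi>m 0 (c a) - Dm 0 (d a) \<in> free_mod S (b 0)" for a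
        using c'_mem \<phi>m_mem[OF c(1)] Dm_mem[OF d(1)] unfolding S_def by (intro free_mod_diff) auto
      then have "c' a - \<phi>m 0 (c a) - Dm 0 (d a) = 0"
        using free_mod_coeffs_zero[OF y(2) _ sum0[unfolded t_def] that] unfolding S_def by blast
      then show ?thesis by (simp add: algebra_simps)
    qed
    have "\<exists>w\<in>free_mod S (b (Suc 0)). c a = Dm 0 w" for a
    proof (induction "K - a" arbitrary: a)
      case 0
      then have "c a = Dm 0 0" using c(2)[of a] by (simp add: K_def Dm_def)
      then show ?case using zero by blast
    next
      case (Suc x)
      then obtain w where w: "w \<in> free_mod S (b (Suc 0))" "c (Suc a) = Dm 0 w"
        by (metis diff_Suc_Suc diff_Suc_diff_eq1 Suc_diff_Suc zero_less_Suc zero_less_diff nat.inject)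
      have "c a = \<phi>m 0 (Dm 0 w) + Dm 0 (d (Suc a))" 
        using rel[of "Suc a"] Suc(2) w(2) by (simp add: c'_def)
      also have "\<dots> = Dm 0 (\<phi>m (Suc 0) w + d (Suc a))"
        by (simp flip: \<phi>_Dm) (simp add: Dm_def lc_add)
      finally show ?case using \<phi>m_mem[OF w(1)] d(1)[of "Suc a"] free_mod_add unfolding S_def by blast
    qed
    then obtain w where w: "\<And>a. w a \<in> free_mod S (b (Suc 0))" "\<And>a. c a = Dm 0 (w a)" by metis
    have "v = Dm 0 (\<Sum>a<K. smul (t ^ a) (w a))"
      using c(3)[of K] unfolding Dm_def lc_coeffs w(2) by (simp add: K_def)
    then show ?thesis using lift[of w, OF w(1)] by blast
  qed
  \<comment> \<open>Division with remainder by an operator monic in y, carried out by the Horner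
    scheme; the remainder \<open>v'\<close> is free of y.\<close>
  have red: "\<exists>v'\<in>free_mod S (b 0). \<exists>w\<in>free_mod S' (b 0). v = v' + \<psi>m 0 w"
    if v: "v \<in> free_mod S' (b 0)" for v
  proof -
    have "\<exists>v'\<in>free_mod S (b 0). \<exists>w\<in>free_mod S' (b 0). (\<Sum>a<K. smul (t ^ a) (c a)) = v' + \<psi>m 0 w"
      if "\<And>a. c a \<in> free_mod S (b 0)" for c K
      using that
    proof (induction K arbitrary: c)
      case 0
      have "(\<Sum>a<0. smul (t ^ a) (c a)) = 0 + \<psi>m 0 0" by (simp add: \<psi>m_def)
      then show ?case using zero by blast
    next
      case (Suc K)
      from Suc.IH[of "\<lambda>a. c (Suc a)", OF Suc.prems] obtain v' w where 
        v': "v' \<in> free_mod S (b 0)" and w: "w \<in> free_mod S' (b 0)" and 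
        eq: "(\<Sum>a<K. smul (t ^ a) (c (Suc a))) = v' + \<psi>m 0 w" by blast
      have "(\<Sum>a<Suc K. smul (t ^ a) (c a)) = c 0 + smul t (\<Sum>a<K. smul (t ^ a) (c (Suc a)))"
        unfolding sum.lessThan_Suc_shift by (simp add: smul_sum smul_smul) (simp add: fun_eq_iff)
      also have "\<dots> = c 0 + smul t v' + smul t (\<psi>m 0 w)"
        by (simp add: eq smul_add)
      also have "smul t v' = \<phi>m 0 v' + \<psi>m 0 v'" using \<psi>m[OF SS'[OF v']] by simp
      also have "smul t (\<psi>m 0 w) = \<psi>m 0 (smul t w)" by (simp add: \<psi>m_def lc_smul)
      finally have "(\<Sum>a<Suc K. smul (t ^ a) (c a)) = (c 0 + \<phi>m 0 v') + \<psi>m 0 (v' + smul t w)"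
        by (simp only: \<psi>m_def lc_add add_ac)
      moreover have "c 0 + \<phi>m 0 v' \<in> free_mod S (b 0)"
        using Suc.prems[of 0] \<phi>m_mem[OF v'] unfolding S_def by (rule free_mod_add)
      moreover have "v' + smul t w \<in> free_mod S' (b 0)"
        using SS'[OF v'] w t unfolding S'_def by (intro free_mod_add free_mod_smul) auto
      ultimately show ?case by blast
    qed
    note * = this
    obtain N c where "(\<forall>a. c a \<in> free_mod S (b 0)) \<and> (\<forall>a\<ge>N. c a = 0)
        \<and> (\<forall>K\<ge>N. v = (\<Sum>a<K. smul (t ^ a) (c a)))"
      using coeffs[OF v] by (elim exE)
    then have "\<And>a. c a \<in> free_mod S (b 0)" "v = (\<Sum>a<N. smul (t ^ a) (c a))" by simp_all
    with *[of c N] show ?thesis by simp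
  qed
  \<comment> \<open>The cone differential sends a pair u, v to \<open>Dm u + \<psi>m v\<close> and
    \<open>- Dm v\<close>. The sign makes its square vanish, because \<open>\<psi>m\<close> commutes
    with \<open>Dm\<close>.\<close>
  define D2 where "D2 i = (case i of 0 \<Rightarrow> cat (b (Suc 0)) (D 0) (\<psi> 0)
    | Suc j \<Rightarrow> cat (b (Suc (Suc j))) (\<lambda>k. cat (b (Suc j)) (D (Suc j) k) 0)
        (\<lambda>k. cat (b (Suc j)) (\<psi> (Suc j) k) (- D j k)))" for i
  have b2: "b2 0 = b 0" "b2 (Suc i) = b (Suc i) + b i" for i by (simp_all add: b2_def)
  have a2: "a2 0 = a 0" "a2 (Suc i) = cat (b (Suc i)) (a (Suc i)) (\<lambda>k. a i k + 1)" for i by (simp_all add: a2_def)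
  have D2_0: "lc (D2 0) (b2 (Suc 0)) (cat (b (Suc 0)) u v) = Dm 0 u + \<psi>m 0 v" for u v
    by (simp add: D2_def b2 lc_cat Dm_def \<psi>m_def)
  have lc0: "lc (\<lambda>k. 0) n v = (0 :: nat \<Rightarrow> ('v,'k) mpoly)" for n v by (simp add: lc_def fun_eq_iff)
  have D2_S: "lc (D2 (Suc i)) (b2 (Suc (Suc i))) (cat (b (Suc (Suc i))) u v) 
      = cat (b (Suc i)) (Dm (Suc i) u + \<psi>m (Suc i) v) (- Dm i v)" for i u v
    by (simp add: D2_def b2 lc_cat lc_to_cat Dm_def \<psi>m_def cat_add lc0 lc_map_uminus)
  have DmDm: "Dm i (Dm (Suc i) v) = 0" for i v unfolding Dm_def by (rule cpx_lc_lc[OF C])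
  have sp: "\<exists>u\<in>free_mod S' (b (Suc i)). \<exists>v\<in>free_mod S' (b i). w = cat (b (Suc i)) u v"
    if "w \<in> free_mod S' (b2 (Suc i))" for w i
    using cat_split[OF that[unfolded b2]] by (metis S'_def poly_ring_0)
  have D2_mem: "D2 i k \<in> free_mod S' (b2 i)" if "k < b2 (Suc i)" for i k
    using that unfolding b2
  proof (rule nat_less_add_cases)
    fix j assume j: "j < b (Suc i)"
    note SS'[unfolded S_def, OF cpxD(1)[OF C j]]
    then show "D2 i j \<in> free_mod S' (b2 i)"
      using j by (cases i) (auto simp: D2_def b2 intro!: cat_free_mod)
  next
    fix j assume j: "j < b i"
    show "D2 i (b (Suc i) + j) \<in> free_mod S' (b2 i)"
    proof (cases i)
      case (Suc m)
      have "D m j \<in> free_mod S' (b m)" using SS'[unfolded S_def, OF cpxD(1)[OF C]] j Suc by auto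
      then have "- D m j \<in> free_mod S' (b m)" by (simp add: S'_def)
      then show ?thesis using \<psi>_mem[OF j] Suc by (simp add: D2_def b2 cat_free_mod)
    qed (use \<psi>_mem[OF j] in \<open>auto simp: D2_def b2\<close>)
  qed
  have D2_gh: "ghom (a2 i) (b2 i) (a2 (Suc i) k) (D2 i k)" if "k < b2 (Suc i)" for i k
    using that unfolding b2(2)
  proof (rule nat_less_add_cases)
    fix j assume j: "j < b (Suc i)"
    note cpxD(2)[OF C j]
    then show "ghom (a2 i) (b2 i) (a2 (Suc i) j) (D2 i j)"
      using j by (cases i) (auto simp: D2_def b2 a2 intro!: ghom_cat)
  next
    fix j assume j: "j < b i"
    show "ghom (a2 i) (b2 i) (a2 (Suc i) (b (Suc i) + j)) (D2 i (b (Suc i) + j))"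
    proof (cases i)
      case (Suc m)
      have "ghom (a m) (b m) (a i j) (D m j)" using cpxD(2)[OF C, of j m] j Suc by auto
      then have "ghom (\<lambda>k. a m k + 1) (b m) (a i j + 1) (- D m j)" by (intro ghom_uminus) (simp add: ghom_def)
      then show ?thesis using \<psi>_gh[OF j] Suc by (simp add: D2_def b2 a2 ghom_cat)
    qed (use \<psi>_gh[OF j] in \<open>auto simp: D2_def b2 a2\<close>)
  qed
  have D2_D2: "lc (D2 i) (b2 (Suc i)) (D2 (Suc i) k) = 0" if "k < b2 (Suc (Suc i))" for i k
    using that unfolding b2(2)[of "Suc i"]
  proof (rule nat_less_add_cases)
    fix j assume j: "j < b (Suc (Suc i))"
    have "Dm i (D (Suc i) j) = 0" using cpxD(3)[OF C j] by (simp add: Dm_def)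
    then show "lc (D2 i) (b2 (Suc i)) (D2 (Suc i) j) = 0"
      using j D2_0 D2_S by (cases i) (auto simp: D2_def[of "Suc _"] Dm_def \<psi>m_def)
  next
    fix j assume j: "j < b (Suc i)"
    have D0: "Dm m (D i j) = 0" if "i = Suc m" for m using cpxD(3)[OF C, of j m] j that by (simp add: Dm_def)
    have D2e: "D2 (Suc i) (b (Suc (Suc i)) + j) = cat (b (Suc i)) (\<psi> (Suc i) j) (- D i j)" by (simp add: D2_def)
    have "Dm i (\<psi> (Suc i) j) + \<psi>m i (- D i j) = 0"
      using \<psi>_D[OF j] by (simp add: \<psi>m_def lc_uminus)
    moreover have "- Dm m (- D i j) = 0" if "i = Suc m" for m using D0[OF that] by (simp add: Dm_def lc_uminus)
    ultimately show "lc (D2 i) (b2 (Suc i)) (D2 (Suc i) (b (Suc (Suc i)) + j)) = 0"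
      using D2_0 D2_S unfolding D2e by (cases i) auto
  qed
  \<comment> \<open>For a cycle with parts u and v, first \<open>v = Dm i x\<close>: by
    \<open>inj\<close> at the bottom and by \<open>exact\<close> elsewhere. Then
    \<open>u + \<psi>m (Suc i) x\<close> is a cycle of the old complex, hence some
    \<open>Dm (Suc i) z\<close>, and the pair z, \<open>- x\<close> is the desired preimage.\<close>
  have ex2: "\<exists>z\<in>free_mod S' (b2 (Suc (Suc i))). w = lc (D2 (Suc i)) (b2 (Suc (Suc i))) z"
    if w: "w \<in> free_mod S' (b2 (Suc i))" "lc (D2 i) (b2 (Suc i)) w = 0" for i w
  proof -
    obtain u v where uv: "u \<in> free_mod S' (b (Suc i))" "v \<in> free_mod S' (b i)" "w = cat (b (Suc i)) u v"
      using sp[OF w(1)] by blast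
    have eq: "Dm i u + \<psi>m i v = 0" and Dv: "i = Suc m \<Longrightarrow> Dm m v = 0" for m
    proof -
      have "Dm i u + \<psi>m i v = 0 \<and> (i = Suc m \<longrightarrow> Dm m v = 0)" for m
      proof (cases i)
        case 0
        then show ?thesis using w(2) uv(3) D2_0 by simp
      next
        case (Suc n)
        have "cat (b (Suc n)) (Dm (Suc n) u + \<psi>m (Suc n) v) (- Dm n v) = cat (b (Suc n)) 0 0"
          using w(2) unfolding uv(3) Suc D2_S by simp
        moreover have "Dm (Suc n) u + \<psi>m (Suc n) v \<in> free_mod S' (b (Suc n))"
          using Dm_mem'[OF uv(1)] \<psi>m_mem[OF uv(2)] free_mod_add unfolding Suc S'_def by blast
        ultimately have "Dm (Suc n) u + \<psi>m (Suc n) v = 0 \<and> - Dm n v = 0"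
          using cat_inject[OF _ zero(2)] by blast
        then show ?thesis using Suc by auto
      qed
      then show "Dm i u + \<psi>m i v = 0" "i = Suc m \<Longrightarrow> Dm m v = 0" by auto
    qed
    have "\<exists>w\<in>free_mod S' (b (Suc i)). v = Dm i w"
    proof (cases i)
      case 0
      have "\<psi>m 0 v = Dm 0 (- u)" using eq 0 by (simp add: Dm_def lc_uminus eq_neg_iff_add_eq_0 add.commute)
      moreover have "- u \<in> free_mod S' (b (Suc 0))" using uv(1) 0 by (simp add: S'_def)
      ultimately show ?thesis using inj uv(2) 0 by blast
    next
      case (Suc m)
      then show ?thesis using exact[of v m] uv(2) Dv by blast
    qed
    then obtain x where x: "x \<in> free_mod S' (b (Suc i))" "v = Dm i x" by blast
    have "Dm i (u + \<psi>m (Suc i) x) = Dm i u + \<psi>m i v" 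
      unfolding x(2) \<psi>_Dm[symmetric] by (simp add: Dm_def lc_add)
    then have "Dm i (u + \<psi>m (Suc i) x) = 0" using eq by simp
    moreover have "u + \<psi>m (Suc i) x \<in> free_mod S' (b (Suc i))"
      using uv(1) \<psi>m_mem[OF x(1)] free_mod_add unfolding S'_def by blast
    ultimately obtain z where z: "z \<in> free_mod S' (b (Suc (Suc i)))" "u + \<psi>m (Suc i) x = Dm (Suc i) z"
      using exact by blast
    have "w = lc (D2 (Suc i)) (b2 (Suc (Suc i))) (cat (b (Suc (Suc i))) z (- x))"
      unfolding uv(3) D2_S z(2)[symmetric] x(2) by (simp add: \<psi>m_def Dm_def lc_uminus)
    moreover have "- x \<in> free_mod S' (b (Suc i))" using x(1) by (simp add: S'_def)
    ultimately show ?thesis using cat_free_mod[OF z(1)] unfolding b2 by blast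
  qed
  have "resol (insert y V) b2 a2 D2 \<beta>"
    unfolding resol_def S'_def[symmetric]
  proof (intro conjI ballI allI impI)
    show "insert y V \<subseteq> W" using V y by simp
    show "cpx (insert y V) b2 a2 D2"
      unfolding cpx_def using D2_mem D2_gh D2_D2 unfolding S'_def by blast
    fix k assume "k < b2 0"
    then show "\<beta> k \<in> poly_ring W" "homog (a2 0 k) (\<beta> k)" using resolD(3,4)[OF R] by (auto simp: b2 a2)
  next
    fix k assume "k < b2 (Suc 0)"
    then show "ev \<beta> (b2 0) (D2 0 k) \<in> J"
      unfolding b2 by (rule nat_less_add_cases) (use \<psi>_ev resolD(5)[OF R] in \<open>auto simp: D2_def\<close>)
  next
    \<comment> \<open>Values of \<open>\<psi>m 0\<close> are augmented into \<open>J\<close>, so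
      only the remainder over the old ring matters, where exactness is known.\<close>
    fix v assume v: "v \<in> free_mod S' (b2 0)" "ev \<beta> (b2 0) v \<in> J"
    obtain v' w where vw: "v' \<in> free_mod S (b 0)" "w \<in> free_mod S' (b 0)" "v = v' + \<psi>m 0 w"
      using red v(1) unfolding b2 by blast
    have wW: "w k \<in> poly_ring W" if "k < b 0" for k
      using free_mod_poly_ring[OF vw(2) that] poly_ring_mono[of "insert y V" W] V y(1) by (auto simp: S'_def)
    have "ev (\<lambda>k. ev \<beta> (b 0) (\<psi> 0 k)) (b 0) w \<in> J"
      by (rule J_ev) (use wW \<psi>_ev in auto)
    from J_diff[OF v(2) this] have "ev \<beta> (b 0) v' \<in> J"
      by (simp add: vw(3) b2 ev_add \<psi>m_def ev_lc)
    then obtain u where u: "u \<in> free_mod S (b (Suc 0))" "v' = Dm 0 u"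
      using resolD(6)[OF R] vw(1) unfolding S_def Dm_def by blast
    have "v = lc (D2 0) (b2 (Suc 0)) (cat (b (Suc 0)) u w)" unfolding vw(3) D2_0 u(2) ..
    then show "\<exists>u\<in>free_mod S' (b2 (Suc 0)). v = lc (D2 0) (b2 (Suc 0)) u"
      using cat_free_mod[OF SS'[OF u(1)] vw(2)] unfolding b2 by blast
  next
    fix p :: "('v,'k) mpoly" assume "p \<in> poly_ring W"
    then obtain v where "v \<in> free_mod S (b 0)" "p - ev \<beta> (b 0) v \<in> J" using resolD(8)[OF R] by (auto simp: S_def)
    then show "\<exists>v\<in>free_mod S' (b2 0). p - ev \<beta> (b2 0) v \<in> J" using SS' by (auto simp: b2)
  qed (use ex2 in blast)
  then show ?thesis by blast
qed

end

section \<open>Regularity from a free basis over a parameter ring\<close>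

lemma cat_zero_right: "u \<in> free_mod S c \<Longrightarrow> cat c u 0 = u"
  by (auto simp: cat_def free_mod_def fun_eq_iff)

lemma smul_0: "smul 0 v = (0 :: nat \<Rightarrow> 'r::comm_ring_1)"
  by (simp add: fun_eq_iff)

lemma mat_app_lc: "mat_app d n n' v = lc (\<lambda>k l. if l < n' then d k l else 0) n v"
  by (auto simp: mat_app_def lc_def fun_eq_iff)

lemma res_reg_set: "{a i k - int i | i k. i \<le> n \<and> k < b i} = (\<lambda>(i,k). a i k - int i) ` (SIGMA i:{..n}. {..<b i :: nat})"
  by force

context quotient
begin

text \<open>For empty \<open>Y\<close>, a basis is itself a resolution: \<open>B\<close> generators
  and no syzygies. Each further variable is one cone, which keeps index 0 and therefore the
  generators \<open>\<beta>\<close> unchanged.\<close>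

lemma resol_of_basis:
  assumes fin: "finite Y" and disj: "Z \<inter> Y = {}" and sub: "Z \<union> Y \<subseteq> W"
    and \<beta>: "\<And>k. k < B \<Longrightarrow> \<beta> k \<in> poly_ring W" "\<And>k. k < B \<Longrightarrow> homog (d k) (\<beta> k)"
    and span: "\<And>p. p \<in> poly_ring W \<Longrightarrow> \<exists>v\<in>free_mod (poly_ring Z) B. p - ev \<beta> B v \<in> J"
    and indep: "\<And>v. v \<in> free_mod (poly_ring Z) B \<Longrightarrow> ev \<beta> B v \<in> J \<Longrightarrow> v = 0"
    and s: "\<And>k. k < B \<Longrightarrow> d k \<le> s" "k0 < B" "d k0 = s"
  shows "\<exists>b a D. resol (Y \<union> Z) b a D \<beta> \<and> b 0 = B \<and> a 0 = d \<and> (\<forall>i>card Y. b i = 0) \<and>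
    (\<exists>k<b (card Y). a (card Y) k = int (card Y) + s) \<and> (\<forall>i k. k < b i \<longrightarrow> a i k \<le> int i + s)"
  using fin disj sub
proof (induction Y rule: finite_induct)
  case empty
  define b where "b i = (if i = 0 then B else 0)" for i :: nat
  define a where "a i = d" for i :: nat
  define D :: "nat \<Rightarrow> nat \<Rightarrow> nat \<Rightarrow> ('v,'k) mpoly" where "D i k = 0" for i k
  have "resol Z b a D \<beta>"
    unfolding resol_def
  proof (intro conjI allI ballI impI)
    show "Z \<subseteq> W" using empty by simp
    fix v :: "nat \<Rightarrow> ('v,'k) mpoly" assume "v \<in> free_mod (poly_ring Z) (b 0)" "ev \<beta> (b 0) v \<in> J"
    then have "v = 0" using indep by (simp add: b_def)
    then show "\<exists>u\<in>free_mod (poly_ring Z) (b (Suc 0)). v = lc (D 0) (b (Suc 0)) u" by (simp add: b_def)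
  qed (use \<beta> span in \<open>auto simp: cpx_def b_def a_def\<close>)
  moreover have "b 0 = B \<and> a 0 = d \<and> (\<forall>i>card {}. b i = 0) \<and>
    (\<exists>k<b (card {}). a (card {}) k = int (card {}) + s) \<and> (\<forall>i k. k < b i \<longrightarrow> a i k \<le> int i + s)"
    using s by (auto simp: b_def a_def)
  ultimately show ?case unfolding Un_empty_left by blast
next
  case (insert y Y)
  then obtain b a D where R: "resol (Y \<union> Z) b a D \<beta>" and b: "b 0 = B" "a 0 = d" "\<forall>i>card Y. b i = 0"
    and top: "\<exists>k<b (card Y). a (card Y) k = int (card Y) + s" and le: "\<forall>i k. k < b i \<longrightarrow> a i k \<le> int i + s"
    by auto
  define b2 where "b2 \<equiv> (\<lambda>i. case i of 0 \<Rightarrow> b 0 | Suc j \<Rightarrow> b (Suc j) + b j)"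
  define a2 where "a2 \<equiv> (\<lambda>i. case i of 0 \<Rightarrow> a 0 | Suc j \<Rightarrow> cat (b (Suc j)) (a (Suc j)) (\<lambda>k. a j k + 1))"
  obtain D2 where D2: "resol (insert y (Y \<union> Z)) b2 a2 D2 \<beta>"
    using cone_step[OF R, of y] insert unfolding b2_def a2_def by auto
  have card: "card (insert y Y) = Suc (card Y)" using insert by simp
  obtain k where k: "k < b (card Y)" "a (card Y) k = int (card Y) + s" using top by blast
  have "b2 i = 0" if "i > Suc (card Y)" for i using that b(3) by (cases i) (auto simp: b2_def)
  \<comment> \<open>Since \<open>b (Suc (card Y)) = 0\<close>, the new last module is nothing but
    the shifted copy of the old last one; the same \<open>k\<close> thus witnesses the extremal
    degree.\<close>
  moreover have "k < b2 (Suc (card Y))" "a2 (Suc (card Y)) k = int (Suc (card Y)) + s"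
    using k b(3) by (auto simp: b2_def a2_def cat_def)
  moreover have "a2 i k \<le> int i + s" if "k < b2 i" for i k
  proof (cases i)
    case 0
    then show ?thesis using that le[rule_format, of k 0] by (auto simp: b2_def a2_def)
  next
    case (Suc j)
    have "k < b (Suc j) + b j" using that Suc by (simp add: b2_def)
    then have "a2 (Suc j) k \<le> int (Suc j) + s"
      by (rule nat_less_add_cases) (use le[rule_format, of _ "Suc j"] le[rule_format, of _ j] in \<open>auto simp: a2_def\<close>)
    then show ?thesis using Suc by simp
  qed
  ultimately show ?case
    using D2 b unfolding card 
    by (intro exI[of _ b2] exI[of _ a2] exI[of _ D2]) (auto simp: b2_def a2_def)
qed

text \<open>Generator 0 maps to 1, so the other \<open>c\<close> generators of index 0 are
  redundant. Keeping the module in index 1, the map to S becomes the augmentation after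
  \<open>D 0\<close>; its kernel grows by lifts \<open>w k\<close> of the relations that express the
  redundant generators through generator 0. Adding one generator for each \<open>w k\<close> in
  index 2 restores exactness, and it creates no new relations because the \<open>rel k\<close> are
  linearly independent.\<close>

lemma resol_cyclic:
  assumes R: "resol W b a D \<beta>" and b0: "b 0 = Suc c" and \<beta>0: "\<beta> 0 = 1" "a 0 0 = 0"
  defines "b' \<equiv> (\<lambda>i. if i = 0 then 1 else if i = 2 then b 2 + c else b i)"
    and "a' \<equiv> (\<lambda>i. if i = 0 then (\<lambda>_. 0) else if i = 2 then cat (b 2) (a 2) (\<lambda>k. a 0 (Suc k)) else a i)"
  shows "\<exists>D'. resol W b' a' D' (\<lambda>_. 1)"
proof -
  let ?F = "free_mod (poly_ring W)"
  define e where "e = (unit_vec :: nat \<Rightarrow> nat \<Rightarrow> ('v,'k) mpoly)"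
  define rel where "rel k = e (Suc k) - smul (\<beta> (Suc k)) (e 0)" for k
  note C = resolD(2)[OF R]
  have e: "k < b i \<Longrightarrow> e k \<in> ?F (b i)" "k < b 0 \<Longrightarrow> ev \<beta> (b 0) (e k) = \<beta> k" for k i
    by (simp_all add: e_def ev_unit_vec)
  have rel: "rel k \<in> ?F (b 0)" "ev \<beta> (b 0) (rel k) = 0" "ghom (a 0) (b 0) (a 0 (Suc k)) (rel k)"
    if "k < c" for k
    using that b0 \<beta>0 e[of 0] e[of "Suc k"] resolD(3)[OF R, of "Suc k"] resolD(4)[OF R, of "Suc k"]
      ghom_unit_vec[of "a 0" "b 0" "Suc k"] ghom_unit_vec[of "a 0" "b 0" 0]
    by (auto simp: rel_def ev_diff ev_smul e_def intro!: ghom_diff ghom_smul)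
  have "\<exists>w. k < c \<longrightarrow> w \<in> ?F (b (Suc 0)) \<and> ghom (a (Suc 0)) (b (Suc 0)) (a 0 (Suc k)) w \<and> 
      lc (D 0) (b (Suc 0)) w = rel k" for k
  proof (cases "k < c")
    case True
    have "ev \<beta> (b 0) (rel k) \<in> J" using rel(2)[OF True] J_0 by simp
    then obtain u where u: "u \<in> ?F (b (Suc 0))" "rel k = lc (D 0) (b (Suc 0)) u"
      using resolD(6)[OF R rel(1)[OF True]] by blast
    have "ghom (a 0) (b 0) (a 0 (Suc k)) (lc (D 0) (b (Suc 0)) u)" using rel(3)[OF True] u(2) by simp
    then obtain w where "w \<in> ?F (b (Suc 0))" "ghom (a (Suc 0)) (b (Suc 0)) (a 0 (Suc k)) w" 
      "lc (D 0) (b (Suc 0)) w = lc (D 0) (b (Suc 0)) u"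
      using graded_preimage[of "b (Suc 0)" "D 0" W "b 0" "a 0" "a (Suc 0)" u "a 0 (Suc k)"]
        cpxD(1,2)[OF C, where i = 0] u(1) by blast
    then show ?thesis using u(2) by auto
  qed auto
  then have "\<forall>k. \<exists>w. k < c \<longrightarrow> w \<in> ?F (b (Suc 0)) \<and> ghom (a (Suc 0)) (b (Suc 0)) (a 0 (Suc k)) w \<and> 
      lc (D 0) (b (Suc 0)) w = rel k" ..
  from choice[OF this] obtain w where w: "\<And>k. k < c \<Longrightarrow> w k \<in> ?F (b (Suc 0))"
      "\<And>k. k < c \<Longrightarrow> ghom (a (Suc 0)) (b (Suc 0)) (a 0 (Suc k)) (w k)"
      "\<And>k. k < c \<Longrightarrow> lc (D 0) (b (Suc 0)) (w k) = rel k"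
    by blast
  have Dw: "lc (D 0) (b (Suc 0)) (lc w c x) = lc rel c x" for x
    unfolding lc_lc using w(3) by (intro lc_cong) auto
  \<comment> \<open>Coordinate \<open>Suc k\<close> occurs in \<open>rel k\<close> alone, with
    coefficient 1: this is the linear independence of the relations.\<close>
  have lc_rel: "lc rel c x (Suc k) = x k" if "k < c" for x k
  proof -
    have "lc rel c x (Suc k) = (\<Sum>j<c. if j = k then x k else 0)"
      unfolding lc_def by (rule sum.cong) (auto simp: rel_def e_def unit_vec_def)
    then show ?thesis using that by simp
  qed
  \<comment> \<open>Modulo the relations every vector is a multiple of \<open>e 0\<close>, the
    factor being its augmentation. In particular the kernel of the augmentation to S is spanned by
    the relations.\<close>
  have decomp: "v = smul (ev \<beta> (b 0) v) (e 0) + lc rel c (\<lambda>k. v (Suc k))" if v: "v \<in> ?F (b 0)" for v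
  proof
    fix l
    consider (z) "l = 0" | (m) k where "l = Suc k" "k < c" | (o) k where "l = Suc k" "k \<ge> c"
      by (cases l) (auto simp: not_less[symmetric])
    then show "v l = (smul (ev \<beta> (b 0) v) (e 0) + lc rel c (\<lambda>k. v (Suc k))) l"
    proof cases
      case z
      have "ev \<beta> (b 0) v = v 0 + (\<Sum>k<c. v (Suc k) * \<beta> (Suc k))"
        unfolding ev_def b0 sum.lessThan_Suc_shift using \<beta>0 by simp
      moreover have "lc rel c (\<lambda>k. v (Suc k)) 0 = - (\<Sum>k<c. v (Suc k) * \<beta> (Suc k))"
        by (simp add: lc_def rel_def e_def unit_vec_def sum_negf)
      ultimately show ?thesis by (simp add: z e_def unit_vec_def)
    next
      case (m k)
      then show ?thesis by (simp add: lc_rel e_def unit_vec_def)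
    next
      case (o k)
      have "lc rel c (\<lambda>k. v (Suc k)) (Suc k) = 0"
        unfolding lc_def by (rule sum.neutral) (use o in \<open>auto simp: rel_def e_def unit_vec_def\<close>)
      moreover have "v (Suc k) = 0" using free_mod_out[OF v] b0 o by simp
      ultimately show ?thesis using o by (simp add: e_def unit_vec_def)
    qed
  qed
  \<comment> \<open>From index 2 on the matrices are unchanged: the images of \<open>D 2\<close>
    have zero entries in the added block.\<close>
  define D' where "D' i = (if i = 0 then (\<lambda>k. smul (ev \<beta> (b 0) (D 0 k)) (e 0))
     else if i = 1 then cat (b 2) (D 1) w else D i)" for i
  have D'0: "lc (D' 0) (b' (Suc 0)) v = smul (ev \<beta> (b 0) (lc (D 0) (b (Suc 0)) v)) (e 0)" for v
    by (simp add: D'_def b'_def ev_lc ev_def[of "\<lambda>k. ev \<beta> (b 0) (D 0 k)"])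
      (simp add: lc_def fun_eq_iff sum_distrib_right mult.assoc)
  have D'1: "lc (D' 1) (b' 2) (cat (b 2) u x) = lc (D 1) (b 2) u + lc w c x" for u x
    by (simp add: D'_def b'_def lc_cat)
  have D'i: "D' (Suc (Suc i)) = D (Suc (Suc i))" for i by (simp add: D'_def)
  have b': "b' 0 = 1" "b' (Suc 0) = b (Suc 0)" "b' 2 = b 2 + c" "b' (Suc (Suc (Suc i))) = b (Suc (Suc (Suc i)))" for i
    by (simp_all add: b'_def)
  have a': "a' 0 = (\<lambda>_. 0)" "a' (Suc 0) = a (Suc 0)" "a' 2 = cat (b 2) (a 2) (\<lambda>k. a 0 (Suc k))" 
    "a' (Suc (Suc (Suc i))) = a (Suc (Suc (Suc i)))" for i
    by (simp_all add: a'_def)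
  have D0_W: "D 0 k l \<in> poly_ring W" if "k < b (Suc 0)" "l < b 0" for k l
    using cpxD(1)[OF C that(1)] that(2) by (rule free_mod_poly_ring)
  have evD: "ev \<beta> (b 0) (D 0 k) \<in> poly_ring W" if "k < b (Suc 0)" for k
    using resolD(3)[OF R] D0_W[OF that] by (rule ev_poly_ring)
  have D'1k: "D' 1 j = D 1 j" if "j < b 2" for j using that by (simp add: D'_def)
  have D'1w: "D' 1 (b 2 + j) = w j" for j by (simp add: D'_def)
  have D2_mem: "D 2 k \<in> ?F (b 2)" if "k < b 3" for k
    using cpxD(1)[OF C, of k 2] that by (simp add: numeral_2_eq_2 numeral_3_eq_3)
  have mem: "D' i k \<in> ?F (b' i)" if k: "k < b' (Suc i)" for i k
  proof -
    consider (0) "i = 0" | (1) "i = Suc 0" | (2) "i = 2" | (3) j where "i = Suc (Suc (Suc j))"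
      by (metis numeral_2_eq_2 old.nat.exhaust)
    then show ?thesis
    proof cases
      case 0
      then show ?thesis using evD[of k] k by (auto simp: D'_def b'_def e_def)
    next
      case 1
      have "k < b 2 + c" using k 1 by (simp add: b'_def)
      then have "D' 1 k \<in> ?F (b (Suc 0))"
        by (rule nat_less_add_cases) (use cpxD(1)[OF C, of _ "Suc 0"] w(1) D'1k D'1w in \<open>auto simp: numeral_2_eq_2\<close>)
      then show ?thesis using 1 by (simp add: b')
    next
      case 2
      then show ?thesis using cat_free_mod[OF D2_mem[of k], of 0 c] cat_zero_right[OF D2_mem[of k]] k
        by (simp add: b' D'_def b'_def numeral_3_eq_3)
    next
      case 3
      then show ?thesis using cpxD(1)[OF C, of k i] k by (simp add: b' D'i)
    qed
  qed
  have gh: "ghom (a' i) (b' i) (a' (Suc i) k) (D' i k)" if k: "k < b' (Suc i)" for i k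
  proof -
    consider (0) "i = 0" | (1) "i = Suc 0" | (2) "i = 2" | (3) j where "i = Suc (Suc (Suc j))"
      by (metis numeral_2_eq_2 old.nat.exhaust)
    then show ?thesis
    proof cases
      case 0
      have "homog (a (Suc 0) k) (ev \<beta> (b 0) (D 0 k))"
        using cpxD(2)[OF C, of k 0] k 0 resolD(4)[OF R] by (intro ev_homog[where a = "a 0"]) (auto simp: b')
      then show ?thesis using 0 by (simp add: a' b' D'_def ghom_def e_def unit_vec_def)
    next
      case 1
      have "k < b 2 + c" using k 1 by (simp add: b'_def)
      then have "ghom (a (Suc 0)) (b (Suc 0)) (a' 2 k) (D' 1 k)"
        by (rule nat_less_add_cases) 
          (use cpxD(2)[OF C, of _ "Suc 0"] w(2) D'1k D'1w in \<open>auto simp: numeral_2_eq_2 a'[unfolded numeral_2_eq_2]\<close>)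
      then show ?thesis using 1 by (simp add: a' b' numeral_2_eq_2)
    next
      case 2
      have k3: "k < b 3" using k 2 by (simp add: b'_def)
      have "ghom (a 2) (b 2) (a 3 k) (D 2 k)" using cpxD(2)[OF C, of k 2] k3 by (simp add: numeral_3_eq_3)
      then have "ghom (cat (b 2) (a 2) (\<lambda>k. a 0 (Suc k))) (b 2 + c) (a 3 k) (cat (b 2) (D 2 k) 0)"
        by (intro ghom_cat) auto
      then show ?thesis using 2 cat_zero_right[OF D2_mem[OF k3]] by (simp add: a'_def b'_def D'_def)
    next
      case 3
      then show ?thesis using cpxD(2)[OF C, of k i] k by (simp add: a' b' D'i)
    qed
  qed
  have comp: "lc (D' i) (b' (Suc i)) (D' (Suc i) k) = 0" if k: "k < b' (Suc (Suc i))" for i k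
  proof -
    consider (0) "i = 0" | (1) "i = Suc 0" | (2) j where "i = Suc (Suc j)" by (metis old.nat.exhaust)
    then show ?thesis
    proof cases
      case 0
      have "k < b 2 + c" using k 0 by (simp add: b'_def)
      then have "lc (D' 0) (b' (Suc 0)) (D' 1 k) = 0"
        by (rule nat_less_add_cases) 
          (use cpxD(3)[OF C, of _ 0] rel w(3) D'1k D'1w in \<open>auto simp: D'0 numeral_2_eq_2 smul_0\<close>)
      then show ?thesis using 0 by simp
    next
      case 1
      have k3: "k < b 3" using k 1 by (simp add: b'_def numeral_3_eq_3)
      have "lc (D' 1) (b' 2) (cat (b 2) (D 2 k) 0) = 0"
        unfolding D'1 using cpxD(3)[OF C, of k 1] k3 by (simp add: numeral_2_eq_2 numeral_3_eq_3)
      then show ?thesis using 1 cat_zero_right[OF D2_mem[OF k3]] by (simp add: D'_def numeral_2_eq_2)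
    next
      case 2
      then show ?thesis using cpxD(3)[OF C, of k i] k by (simp add: b' D'i)
    qed
  qed
  have exact: "\<exists>u\<in>?F (b' (Suc (Suc i))). v = lc (D' (Suc i)) (b' (Suc (Suc i))) u"
    if v: "v \<in> ?F (b' (Suc i))" "lc (D' i) (b' (Suc i)) v = 0" for i v
  proof -
    consider (0) "i = 0" | (1) "i = Suc 0" | (2) j where "i = Suc (Suc j)" by (metis old.nat.exhaust)
    then show ?thesis
    proof cases
      case 0
      define x where "x = lc (D 0) (b (Suc 0)) v"
      define x' where "x' = (\<lambda>k. if k < c then x (Suc k) else 0)"
      have v': "v \<in> ?F (b (Suc 0))" using v(1) 0 by (simp add: b')
      have x: "x \<in> ?F (b 0)" using v' cpxD(1)[OF C] unfolding x_def by (intro lc_free_mod) auto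
      then have x'F: "x' \<in> ?F c" using b0 by (auto simp: x'_def free_mod_def)
      have "smul (ev \<beta> (b 0) x) (e 0) = 0" using v(2) D'0[of v] 0 by (simp add: x_def)
      then have "x = lc rel c x'" using decomp[OF x] by (simp add: x'_def cong: lc_cong)
      then have "lc (D 0) (b (Suc 0)) (v - lc w c x') = 0" by (simp add: lc_diff Dw flip: x_def)
      moreover have "v - lc w c x' \<in> ?F (b (Suc 0))" using v' w(1) x'F by (intro free_mod_diff lc_free_mod) auto
      ultimately obtain u where u: "u \<in> ?F (b (Suc (Suc 0)))" "v - lc w c x' = lc (D (Suc 0)) (b (Suc (Suc 0))) u"
        using resolD(7)[OF R] by blast
      have "v = lc (D' 1) (b' 2) (cat (b 2) u x')"
        unfolding D'1 using u(2) by (simp add: numeral_2_eq_2 algebra_simps)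
      moreover have "cat (b 2) u x' \<in> ?F (b' 2)"
        unfolding b'(3) using cat_free_mod[OF u(1) x'F] by (simp add: numeral_2_eq_2)
      ultimately show ?thesis using 0 by (auto simp: numeral_2_eq_2)
    next
      case 1
      have "v \<in> ?F (b 2 + c)" using v(1) 1 by (simp add: b'_def)
      then obtain u x where ux: "u \<in> ?F (b 2)" "x \<in> ?F c" "v = cat (b 2) u x" by (rule cat_split) auto
      have 0: "lc (D 1) (b 2) u + lc w c x = 0" using v(2) 1 D'1[of u x] ux(3) by (simp add: numeral_2_eq_2)
      have "lc (D 0) (b (Suc 0)) (lc (D 1) (b 2) u) + lc rel c x = 0"
        using arg_cong[OF 0, of "lc (D 0) (b (Suc 0))"] by (simp add: lc_add Dw)
      then have "lc rel c x = 0" using cpx_lc_lc[OF C, of 0 u] by (simp add: numeral_2_eq_2)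
      then have "x k = 0" if "k < c" for k using lc_rel[OF that, of x] by simp
      then have x0: "x = 0" using free_mod_out[OF ux(2)] by (metis ext linorder_not_less zero_fun_apply)
      then have "lc (D (Suc 0)) (b (Suc (Suc 0))) u = 0" using 0 by (simp add: numeral_2_eq_2)
      then obtain z where "z \<in> ?F (b (Suc (Suc (Suc 0))))" "u = lc (D (Suc (Suc 0))) (b (Suc (Suc (Suc 0)))) z"
        using resolD(7)[OF R, of u "Suc 0"] ux(1) by (auto simp: numeral_2_eq_2)
      then show ?thesis using 1 ux(3) x0 cat_zero_right[OF ux(1)] by (auto simp: b' D'i)
    next
      case 2
      then show ?thesis using resolD(7)[OF R, of v i] v by (simp add: b' D'i)
    qed
  qed
  have "resol W b' a' D' (\<lambda>_. 1)"
    unfolding resol_def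
  proof (intro conjI allI ballI impI)
    show "cpx W b' a' D'" unfolding cpx_def using mem gh comp by blast
  next
    fix k assume "k < b' (Suc 0)"
    then show "ev (\<lambda>_. 1) (b' 0) (D' 0 k) \<in> J" 
      using resolD(5)[OF R] by (simp add: b' ev_def[of "\<lambda>_. 1"] D'_def e_def unit_vec_def)
  next
    fix v assume v: "v \<in> ?F (b' 0)" "ev (\<lambda>_. 1) (b' 0) v \<in> J"
    have p: "v 0 \<in> poly_ring W" "v 0 \<in> J" and v1: "v = smul (v 0) (e 0)"
      using v by (auto simp: b' free_mod_def ev_def e_def unit_vec_def fun_eq_iff)
    have "smul (v 0) (e 0) \<in> ?F (b 0)" using p(1) b0 by (simp add: e_def)
    moreover have "ev \<beta> (b 0) (smul (v 0) (e 0)) = v 0" using e(2)[of 0] b0 \<beta>0 by (simp add: ev_smul)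
    ultimately obtain u where u: "u \<in> ?F (b (Suc 0))" "smul (v 0) (e 0) = lc (D 0) (b (Suc 0)) u"
      using resolD(6)[OF R] p(2) by metis
    have "lc (D' 0) (b' (Suc 0)) u = smul (v 0) (e 0)"
      unfolding D'0 u(2)[symmetric] using e(2)[of 0] b0 \<beta>0 by (simp add: ev_smul)
    then show "\<exists>u\<in>?F (b' (Suc 0)). v = lc (D' 0) (b' (Suc 0)) u" using v1 u(1) by (auto simp: b')
  next
    fix p :: "('v,'k) mpoly" assume "p \<in> poly_ring W"
    then have "smul p (e 0) \<in> ?F (b' 0)" "ev (\<lambda>_. 1) (b' 0) (smul p (e 0)) = p"
      by (auto simp: b' e_def ev_smul ev_unit_vec)
    then show "\<exists>v\<in>?F (b' 0). p - ev (\<lambda>_. 1) (b' 0) v \<in> J" using J_0 by force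
  qed (use exact in \<open>auto simp: a' b'\<close>)
  then show ?thesis by blast
qed

section \<open>Translation to and from graded free resolutions\<close>

lemma resol_imp_graded_free_resolution:
  assumes R: "resol W b a D (\<lambda>_. 1)" and b: "b 0 = 1" "a 0 0 = 0" "\<And>i. i > n \<Longrightarrow> b i = 0"
    and J: "J \<subseteq> poly_ring W"
  shows "graded_free_resolution (poly_ring W) J n b a (\<lambda>i. D (i - 1))"
proof -
  let ?F = "free_mod (poly_ring W)"
  note C = resolD(2)[OF R]
  have m: "mat_app (D i) (b (Suc i)) (b i) v = lc (D i) (b (Suc i)) v" for i v
    unfolding mat_app_lc
  proof (rule lc_cong)
    fix k assume "k < b (Suc i)"
    then show "(\<lambda>l. if l < b i then D i k l else 0) = D i k" 
      using free_mod_out[OF cpxD(1)[OF C]] by (auto simp: fun_eq_iff)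
  qed simp
  have 0: "(\<lambda>v. v 0) ` (mat_app (D 0) (b (Suc 0)) (b 0) ` ?F (b (Suc 0))) = J"
  proof (intro equalityI subsetI)
    fix p assume "p \<in> (\<lambda>v. v 0) ` (mat_app (D 0) (b (Suc 0)) (b 0) ` ?F (b (Suc 0)))"
    then obtain u where u: "u \<in> ?F (b (Suc 0))" "p = lc (D 0) (b (Suc 0)) u 0" by (auto simp: m)
    have "ev (\<lambda>k. ev (\<lambda>_. 1) (b 0) (D 0 k)) (b (Suc 0)) u \<in> J"
      by (rule J_ev) (use resolD(5)[OF R] free_mod_poly_ring[OF u(1)] in auto)
    then show "p \<in> J" by (simp add: u(2) flip: ev_lc) (simp add: ev_def b)
  next
    fix p assume p: "p \<in> J"
    have "smul p (unit_vec 0) \<in> ?F (b 0)" using p J by (auto simp: b)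
    moreover have "ev (\<lambda>_. 1) (b 0) (smul p (unit_vec 0)) \<in> J"
      using p by (simp add: ev_smul ev_unit_vec b)
    ultimately obtain u where u: "u \<in> ?F (b (Suc 0))" "smul p (unit_vec 0) = lc (D 0) (b (Suc 0)) u"
      using resolD(6)[OF R] by blast
    have "p = lc (D 0) (b (Suc 0)) u 0" using fun_cong[OF u(2), of 0] by (simp add: unit_vec_def)
    then show "p \<in> (\<lambda>v. v 0) ` (mat_app (D 0) (b (Suc 0)) (b 0) ` ?F (b (Suc 0)))"
      using u(1) by (auto simp: m)
  qed
  have ex: "{v \<in> ?F (b (Suc i)). mat_app (D i) (b (Suc i)) (b i) v = (\<lambda>_. 0)}
      = mat_app (D (Suc i)) (b (Suc (Suc i))) (b (Suc i)) ` ?F (b (Suc (Suc i)))" for i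
  proof (intro equalityI subsetI)
    fix v assume "v \<in> {v \<in> ?F (b (Suc i)). mat_app (D i) (b (Suc i)) (b i) v = (\<lambda>_. 0)}"
    then show "v \<in> mat_app (D (Suc i)) (b (Suc (Suc i))) (b (Suc i)) ` ?F (b (Suc (Suc i)))"
      using resolD(7)[OF R, of v i] by (auto simp: m zero_fun_def)
  next
    fix v assume "v \<in> mat_app (D (Suc i)) (b (Suc (Suc i))) (b (Suc i)) ` ?F (b (Suc (Suc i)))"
    then obtain u where "u \<in> ?F (b (Suc (Suc i)))" "v = lc (D (Suc i)) (b (Suc (Suc i))) u" by (auto simp: m)
    then show "v \<in> {v \<in> ?F (b (Suc i)). mat_app (D i) (b (Suc i)) (b i) v = (\<lambda>_. 0)}"
      using cpx_lc_lc[OF C, of i u] cpxD(1)[OF C, of _ "Suc i"] by (auto simp: m zero_fun_def)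
  qed
  show ?thesis
    unfolding graded_free_resolution_def
  proof (intro conjI allI impI)
    show "(\<lambda>v. v 0) ` (mat_app (D (1 - 1)) (b 1) 1 ` ?F (b 1)) = J" using 0 b(1) by simp
  next
    fix i k l assume "1 \<le> i" "k < b i" "l < b (i - 1)"
    then show "D (i - 1) k l \<in> poly_ring W" "homog (a i k - a (i - 1) l) (D (i - 1) k l)"
      using cpxD(1,2)[OF C, of k "i - 1"] by (auto simp: ghom_def free_mod_def)
  next
    fix i :: nat assume "1 \<le> i"
    then show "{v \<in> ?F (b i). mat_app (D (i - 1)) (b i) (b (i - 1)) v = (\<lambda>_. 0)}
       = mat_app (D (Suc i - 1)) (b (Suc i)) (b i) ` ?F (b (Suc i))"
      using ex[of "i - 1"] by simp
  qed (use b in auto)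
qed

text \<open>Matrix entries beyond the target rank are unconstrained in the definition and ignored by
  \<open>mat_app\<close>, whereas images of basis vectors have to vanish there as vectors; they are
  therefore set to 0.\<close>

lemma graded_free_resolution_imp_resol:
  assumes G: "graded_free_resolution (poly_ring W) J n b a d"
  shows "resol W b a (\<lambda>i k l. if l < b i then d (Suc i) k l else 0) (\<lambda>_. 1)"
proof -
  let ?F = "free_mod (poly_ring W)"
  define D where "D = (\<lambda>i k l. if l < b i then d (Suc i) k l else 0)"
  have m: "mat_app (d (Suc i)) (b (Suc i)) (b i) v = lc (D i) (b (Suc i)) v" for i v
    by (simp add: mat_app_lc D_def)
  have b0: "b 0 = 1" "a 0 0 = 0" using G by (auto simp: graded_free_resolution_def)
  have d: "d (Suc i) k l \<in> poly_ring W" "homog (a (Suc i) k - a i l) (d (Suc i) k l)"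
    if "k < b (Suc i)" "l < b i" for i k l
  proof -
    have *: "\<forall>i\<ge>1. \<forall>k<b i. \<forall>l<b (i - 1). d i k l \<in> poly_ring W \<and> homog (a i k - a (i - 1) l) (d i k l)"
      using G unfolding graded_free_resolution_def by (elim conjE)
    then show "d (Suc i) k l \<in> poly_ring W" "homog (a (Suc i) k - a i l) (d (Suc i) k l)"
      using that *[rule_format, of "Suc i" k l] by auto
  qed
  have 0: "(\<lambda>v. v 0) ` (lc (D 0) (b (Suc 0)) ` ?F (b (Suc 0))) = J"
    using G m[of 0] b0 unfolding graded_free_resolution_def by simp
  have ex: "{v \<in> ?F (b (Suc i)). lc (D i) (b (Suc i)) v = 0} = lc (D (Suc i)) (b (Suc (Suc i))) ` ?F (b (Suc (Suc i)))" for i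
  proof -
    have "{v \<in> ?F (b (Suc i)). mat_app (d (Suc i)) (b (Suc i)) (b (Suc i - 1)) v = (\<lambda>_. 0)}
       = mat_app (d (Suc (Suc i))) (b (Suc (Suc i))) (b (Suc i)) ` ?F (b (Suc (Suc i)))"
    proof -
      have "\<forall>i\<ge>1. {v \<in> ?F (b i). mat_app (d i) (b i) (b (i - 1)) v = (\<lambda>_. 0)}
         = mat_app (d (Suc i)) (b (Suc i)) (b i) ` ?F (b (Suc i))"
        using G unfolding graded_free_resolution_def by (elim conjE)
      then show ?thesis by (elim allE[of _ "Suc i"]) simp
    qed
    then show ?thesis by (simp add: m zero_fun_def)
  qed
  have mem: "D i k \<in> ?F (b i)" if "k < b (Suc i)" for i k
    using d[OF that] by (auto simp: D_def free_mod_def)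
  have F1: "lc (D 0) (b (Suc 0)) u = smul (lc (D 0) (b (Suc 0)) u 0) (unit_vec 0)" for u
    using b0 by (auto simp: lc_def D_def unit_vec_def fun_eq_iff)
  have "resol W b a D (\<lambda>_. 1)"
    unfolding resol_def
  proof (intro conjI allI ballI impI)
    show "cpx W b a D"
      unfolding cpx_def
    proof (intro conjI allI impI)
      fix i k assume k: "k < b (Suc (Suc i))"
      have "D (Suc i) k \<in> lc (D (Suc i)) (b (Suc (Suc i))) ` ?F (b (Suc (Suc i)))"
        using lc_unit_vec[OF k, of "D (Suc i)"] k by (intro image_eqI[of _ _ "unit_vec k"]) auto
      then show "lc (D i) (b (Suc i)) (D (Suc i) k) = 0" using ex[of i] by blast
    qed (use mem d in \<open>auto simp: ghom_def D_def\<close>)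
  next
    fix k assume k: "k < b (Suc 0)"
    have "lc (D 0) (b (Suc 0)) (unit_vec k) 0 \<in> J"
      unfolding 0[symmetric] by (intro imageI) (simp add: k)
    then show "ev (\<lambda>_. 1) (b 0) (D 0 k) \<in> J" using b0 lc_unit_vec[OF k, of "D 0"] by (simp add: ev_def)
  next
    fix v assume v: "v \<in> ?F (b 0)" "ev (\<lambda>_. 1) (b 0) v \<in> J"
    have v1: "v = smul (v 0) (unit_vec 0)"
      using v b0 by (auto simp: free_mod_def unit_vec_def fun_eq_iff)
    have "v 0 \<in> J" using v(2) by (simp add: ev_def b0)
    then obtain u where u: "u \<in> ?F (b (Suc 0))" "v 0 = lc (D 0) (b (Suc 0)) u 0" unfolding 0[symmetric] by (elim imageE) simp
    have "v = lc (D 0) (b (Suc 0)) u" by (rule trans[OF v1 trans[OF _ F1[symmetric]]]) (simp add: u(2))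
    then show "\<exists>u\<in>?F (b (Suc 0)). v = lc (D 0) (b (Suc 0)) u" using u(1) by blast
  next
    fix i v assume "v \<in> ?F (b (Suc i))" "lc (D i) (b (Suc i)) v = 0"
    then have "v \<in> {v \<in> ?F (b (Suc i)). lc (D i) (b (Suc i)) v = 0}" by simp
    then show "\<exists>u\<in>?F (b (Suc (Suc i))). v = lc (D (Suc i)) (b (Suc (Suc i))) u"
      unfolding ex[of i] by (rule imageE) (rule bexI)
  next
    fix p :: "('v,'k) mpoly" assume "p \<in> poly_ring W"
    then show "\<exists>v\<in>?F (b 0). p - ev (\<lambda>_. 1) (b 0) v \<in> J"
      using J_0 b0 by (intro bexI[of _ "smul p (unit_vec 0)"]) (auto simp: ev_smul ev_unit_vec)
  qed (use b0 in auto)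
  then show ?thesis by (simp add: D_def)
qed

theorem cm_reg_eqI:
  assumes fin: "finite Y" and disj: "Z \<inter> Y = {}" and W: "W = Z \<union> Y" and J: "J \<subseteq> poly_ring W"
    and \<beta>: "\<And>k. k < B \<Longrightarrow> \<beta> k \<in> poly_ring W" "\<And>k. k < B \<Longrightarrow> homog (d k) (\<beta> k)"
    and span: "\<And>p. p \<in> poly_ring W \<Longrightarrow> \<exists>v\<in>free_mod (poly_ring Z) B. p - ev \<beta> B v \<in> J"
    and indep: "\<And>v. v \<in> free_mod (poly_ring Z) B \<Longrightarrow> ev \<beta> B v \<in> J \<Longrightarrow> v = 0"
    and s: "\<And>k. k < B \<Longrightarrow> d k \<le> s" "k0 < B" "d k0 = s" and \<beta>0: "\<beta> 0 = 1" "d 0 = 0"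
  shows "cm_reg (poly_ring W) J = s"
proof -
  obtain b a D where R: "resol W b a D \<beta>" and b: "b 0 = B" "a 0 = d" "\<forall>i>card Y. b i = 0"
    and top: "\<exists>k<b (card Y). a (card Y) k = int (card Y) + s" and le: "\<forall>i k. k < b i \<longrightarrow> a i k \<le> int i + s"
    using resol_of_basis[OF fin disj _ \<beta> span indep s] W by (auto simp: Un_commute)
  obtain k1 where k1: "k1 < b (card Y)" "a (card Y) k1 = int (card Y) + s" using top by blast
  obtain c where c: "B = Suc c" using s(2) by (cases B) auto
  define b' where "b' \<equiv> (\<lambda>i::nat. if i = 0 then 1 else if i = 2 then b 2 + c else b i)"
  define a' where "a' \<equiv> (\<lambda>i::nat. if i = 0 then (\<lambda>_. 0) else if i = 2 then cat (b 2) (a 2) (\<lambda>k. a 0 (Suc k)) else a i)"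
  obtain D' where R': "resol W b' a' D' (\<lambda>_. 1)"
    using resol_cyclic[OF R, of c] b c \<beta>0 unfolding b'_def a'_def by auto
  \<comment> \<open>The cones end at index \<open>card Y\<close>, but the generators moved to index
    2 may lie beyond that when \<open>Y\<close> has fewer than two elements.\<close>
  define n where "n = card Y + 2"
  have "graded_free_resolution (poly_ring W) J n b' a' (\<lambda>i. D' (i - 1))"
    using b(3) by (intro resol_imp_graded_free_resolution[OF R' _ _ _ J]) (auto simp: b'_def a'_def n_def)
  then have mem: "(n, b', a') \<in> {(n, b, a). \<exists>d. graded_free_resolution (poly_ring W) J n b a d}" by blast
  \<comment> \<open>The generator 1 has degree 0. This covers index 0 of the modified resolution,
    where S itself contributes the value 0.\<close>
  have s0: "s \<ge> 0" using s(1)[of 0] \<beta>0 c by simp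
  have "a' i k - int i \<le> s" if "k < b' i" for i k
  proof -
    consider "i = 0" | "i = 2" | "i \<noteq> 0" "i \<noteq> 2" by blast
    then show ?thesis
    proof cases
      case 2
      have "k < b 2 + c" using that 2 by (simp add: b'_def)
      then have "a' 2 k \<le> 2 + s"
      proof (rule nat_less_add_cases)
        fix j assume "j < c"
        then have "a 0 (Suc j) \<le> 0 + s" using le b(1) c by (metis Suc_less_eq of_nat_0)
        then show "a' 2 (b 2 + j) \<le> 2 + s" by (simp add: a'_def)
      qed (use le[rule_format, of _ 2] in \<open>auto simp: a'_def\<close>)
      then show ?thesis using 2 by simp
    next
      case 3
      then have "a i k \<le> int i + s" using le that by (auto simp: b'_def)
      then show ?thesis using 3 by (auto simp: a'_def)
    qed (use s0 in \<open>auto simp: a'_def\<close>)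
  qed
  moreover have "(0, 0) \<in> (SIGMA i:{..n}. {..<b' i})" by (simp add: b'_def)
  ultimately have upper: "res_reg n b' a' \<le> s"
    unfolding res_reg_def res_reg_set by (intro Max.boundedI) auto
  have lower: "s \<le> res_reg m b2 a2" if G: "graded_free_resolution (poly_ring W) J m b2 a2 d2" for m b2 a2 d2
  proof -
    have "\<exists>i k. k < b2 i \<and> a2 i k \<ge> int i + s"
      by (rule resol_degree_bound[OF R graded_free_resolution_imp_resol[OF G], of "card Y" k1 s])
        (use b(3) k1 le in auto)
    then obtain i k where ik: "k < b2 i" "a2 i k \<ge> int i + s" by blast
    moreover have "i \<le> m" using G ik(1) unfolding graded_free_resolution_def by (metis leI not_less0)
    ultimately have "a2 i k - int i \<le> res_reg m b2 a2"
      unfolding res_reg_def res_reg_set by (intro Max_ge) force+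
    then show ?thesis using ik by linarith
  qed
  show ?thesis
    unfolding cm_reg_def
  proof (rule antisym)
    let ?X = "{(n, b, a). \<exists>d. graded_free_resolution (poly_ring W) J n b a d}"
    show "s \<le> (INF r\<in>?X. case r of (n, b, a) \<Rightarrow> res_reg n b a)"
      using mem lower by (intro cINF_greatest) auto
    have "(INF r\<in>?X. case r of (n, b, a) \<Rightarrow> res_reg n b a) \<le> (case (n, b', a') of (n, b, a) \<Rightarrow> res_reg n b a)"
      using lower mem by (intro cINF_lower bdd_belowI[of _ s]) auto
    then show "(INF r\<in>?X. case r of (n, b, a) \<Rightarrow> res_reg n b a) \<le> s" using upper by simp
  qed
qed

end

section \<open>Substitutions\<close>

definition mono_subst :: "('v \<Rightarrow> ('w, 'k::comm_ring_1) mpoly) \<Rightarrow> ('v \<Rightarrow>\<^sub>0 nat) \<Rightarrow> ('w, 'k) mpoly" where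
  "mono_subst f m = (\<Prod>x\<in>keys m. f x ^ lookup m x)"

definition poly_subst :: "('v \<Rightarrow> ('w, 'k::comm_ring_1) mpoly) \<Rightarrow> ('v, 'k) mpoly \<Rightarrow> ('w, 'k) mpoly" where
  "poly_subst f p = (\<Sum>m\<in>keys p. single 0 (lookup p m) * mono_subst f m)"

lemma mono_subst_superset:
  assumes "finite A" "keys m \<subseteq> A"
  shows "mono_subst f m = (\<Prod>x\<in>A. f x ^ lookup m x)"
  unfolding mono_subst_def using assms
  by (intro prod.mono_neutral_left) (auto simp: in_keys_iff)

lemma mono_subst_add: "mono_subst f (m + n) = mono_subst f m * mono_subst f n"
proof -
  let ?A = "keys m \<union> keys n"
  have "keys (m + n) \<subseteq> ?A" by (rule keys_add)
  then show ?thesis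
    by (subst (1 2 3) mono_subst_superset[where A = ?A]) (auto simp: lookup_add power_add prod.distrib)
qed

lemma mono_subst_0 [simp]: "mono_subst f 0 = 1"
  by (simp add: mono_subst_def)

lemma mono_subst_single: "mono_subst f (single x n) = f x ^ n"
  by (simp add: mono_subst_def)

lemma poly_subst_superset:
  assumes "finite A" "keys p \<subseteq> A"
  shows "poly_subst f p = (\<Sum>m\<in>A. single 0 (lookup p m) * mono_subst f m)"
  unfolding poly_subst_def using assms
  by (intro sum.mono_neutral_left) (auto simp: in_keys_iff)

lemma poly_subst_add: "poly_subst f (p + q) = poly_subst f p + poly_subst f q"
proof -
  let ?A = "keys p \<union> keys q"
  have "keys (p + q) \<subseteq> ?A" by (rule keys_add)
  then show ?thesis
    by (subst (1 2 3) poly_subst_superset[where A = ?A])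
      (auto simp: lookup_add single_add ring_distribs sum.distrib)
qed

lemma poly_subst_0 [simp]: "poly_subst f 0 = 0"
  by (simp add: poly_subst_def)

lemma poly_subst_single: "poly_subst f (single m c) = single 0 c * mono_subst f m"
  by (cases "c = 0") (auto simp: poly_subst_def)

lemma poly_subst_mult: "poly_subst f (p * q) = poly_subst f p * poly_subst f q"
proof (induction p rule: poly_mapping_add_induct)
  case (single m c)
  show ?case
  proof (induction q rule: poly_mapping_add_induct)
    case (single n d)
    have *: "single 0 (c * d) = single 0 c * single 0 d"
      by (simp add: mult_single)
    show ?case
      unfolding mult_single unfolding poly_subst_single mono_subst_add * by (simp only: mult_ac)
  qed (simp_all add: poly_subst_add ring_distribs)
qed (simp_all add: poly_subst_add ring_distribs)

lemma poly_subst_1 [simp]: "poly_subst f 1 = 1"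
  using poly_subst_single[of f 0 1] by simp

lemma poly_subst_mvar [simp]: "poly_subst f (mvar x) = f x"
  by (simp add: mvar_def poly_subst_single mono_subst_single)

lemma poly_subst_uminus: "poly_subst f (- p) = - poly_subst f p"
  using poly_subst_add[of f p "- p"] by (simp add: eq_neg_iff_add_eq_0 add.commute)

lemma poly_subst_diff: "poly_subst f (p - q) = poly_subst f p - poly_subst f q"
  using poly_subst_add[of f p "- q"] by (simp add: poly_subst_uminus)

lemma poly_subst_sum: "poly_subst f (sum g A) = (\<Sum>i\<in>A. poly_subst f (g i))"
  by (induction A rule: infinite_finite_induct) (simp_all add: poly_subst_add)

lemma poly_subst_prod: "poly_subst f (prod g A) = (\<Prod>i\<in>A. poly_subst f (g i))"
  by (induction A rule: infinite_finite_induct) (simp_all add: poly_subst_mult)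

lemma poly_subst_power: "poly_subst f (p ^ n) = poly_subst f p ^ n"
  by (induction n) (simp_all add: poly_subst_mult)

lemma poly_subst_const [simp]: "poly_subst f (single 0 c) = single 0 c"
  by (simp add: poly_subst_single)

lemma poly_subst_poly_subst: "poly_subst f (poly_subst g p) = poly_subst (\<lambda>x. poly_subst f (g x)) p"
proof (induction p rule: poly_mapping_add_induct)
  case (single m c)
  show ?case by (simp add: poly_subst_single poly_subst_mult mono_subst_def poly_subst_prod poly_subst_power)
qed (simp_all add: poly_subst_add)

lemma prod_single:
  "(\<Prod>i\<in>A. single (g i) (c i :: 'k::comm_ring_1)) = single (\<Sum>i\<in>A. g i) (\<Prod>i\<in>A. c i)"
  by (induction A rule: infinite_finite_induct) (simp_all add: mult_single)

lemma mono_subst_mvar: "mono_subst mvar m = single m 1"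
proof -
  have "mono_subst mvar m = single (\<Sum>x\<in>keys m. single x (lookup m x)) 1"
    by (simp add: mono_subst_def mvar_power prod_single)
  then show ?thesis using poly_mapping_sum_single[of "keys m" m] by simp
qed

lemma poly_subst_mvar_id [simp]: "poly_subst mvar p = p"
  by (induction p rule: poly_mapping_add_induct)
    (simp_all add: poly_subst_add poly_subst_single mono_subst_mvar mult_single)

lemma mono_subst_poly_ring:
  assumes "keys m \<subseteq> V" "\<And>x. x \<in> V \<Longrightarrow> f x \<in> poly_ring W"
  shows "mono_subst f m \<in> poly_ring W"
  using assms by (auto simp: mono_subst_def intro!: poly_ring_prod poly_ring_power)

lemma poly_subst_poly_ring:
  assumes "p \<in> poly_ring V" "\<And>x. x \<in> V \<Longrightarrow> f x \<in> poly_ring W"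
  shows "poly_subst f p \<in> poly_ring W"
  using assms(1)
proof (induction rule: poly_ring_induct)
  case (single m c)
  have "single 0 c \<in> poly_ring W" "mono_subst f m \<in> poly_ring W"
    using mono_subst_poly_ring[OF single assms(2)] by (simp_all add: poly_ring_single)
  then show ?case by (simp only: poly_subst_single poly_ring_mult)
qed (simp_all add: poly_subst_add)

lemma homog_power: "homog d p \<Longrightarrow> homog (int n * d) (p ^ n)"
  by (induction n) (auto simp: ring_distribs intro: homog_mult')

lemma homog_prod: "(\<And>i. i \<in> A \<Longrightarrow> homog (d i) (f i)) \<Longrightarrow> homog (\<Sum>i\<in>A. d i) (\<Prod>i\<in>A. f i)"
  by (induction A rule: infinite_finite_induct) (auto intro: homog_mult)

lemma mono_subst_homog:
  assumes "\<And>x. x \<in> keys m \<Longrightarrow> homog 1 (f x)"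
  shows "homog (int (mono_deg m)) (mono_subst f m)"
proof -
  have "homog (\<Sum>x\<in>keys m. int (lookup m x)) (mono_subst f m)"
    unfolding mono_subst_def
  proof (rule homog_prod)
    fix x assume "x \<in> keys m"
    then show "homog (int (lookup m x)) (f x ^ lookup m x)"
      using homog_power[OF assms, of x "lookup m x"] by simp
  qed
  then show ?thesis by (simp add: mono_deg_def)
qed

lemma poly_subst_homog:
  assumes "homog e p" "\<And>x. homog 1 (f x)"
  shows "homog e (poly_subst f p)"
  unfolding poly_subst_def
proof (rule homog_sum)
  fix m assume m: "m \<in> keys p"
  have "homog (int (mono_deg m)) (mono_subst f m)" by (rule mono_subst_homog) (rule assms)
  then show "homog e (single 0 (lookup p m) * mono_subst f m)"
    using assms(1) m homog_single[of 0] by (intro homog_mult'[of 0]) (auto simp: homog_def)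
qed

section \<open>Invariance under linear changes of coordinates\<close>

lemma graded_free_resolution_subst:
  assumes inv: "\<And>x. poly_subst f (g x) = mvar x" "\<And>x. poly_subst g (f x) = mvar x"
    and V: "\<And>x. x \<in> V \<Longrightarrow> f x \<in> poly_ring V" "\<And>x. x \<in> V \<Longrightarrow> g x \<in> poly_ring V"
    and h: "\<And>x. homog 1 (f x)"
    and G: "graded_free_resolution (poly_ring V) I n b a d"
  shows "graded_free_resolution (poly_ring V) (poly_subst f ` I) n b a (\<lambda>i k l. poly_subst f (d i k l))"
proof -
  let ?F = "free_mod (poly_ring V)"
  \<comment> \<open>Substituting in every coordinate is a bijection on each free module with inverse
    \<open>t\<close>. It is not linear but carries each matrix to the substituted one, so kernels
    and images correspond.\<close>
  define s where "s v l = poly_subst f (v l)" for v and l :: nat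
  define t where "t v l = poly_subst g (v l)" for v and l :: nat
  have st: "s (t v) = v" "t (s v) = v" for v
    using inv by (auto simp: s_def t_def fun_eq_iff poly_subst_poly_subst)
  have F: "v \<in> ?F m \<Longrightarrow> s v \<in> ?F m" "v \<in> ?F m \<Longrightarrow> t v \<in> ?F m" for v m
    using V by (auto simp: free_mod_def s_def t_def intro: poly_subst_poly_ring)
  have sF: "s ` ?F m = ?F m" for m using F st by (auto intro!: image_eqI[of _ s "t _"])
  have s0: "s v = (\<lambda>_. 0) \<longleftrightarrow> v = (\<lambda>_. 0)" for v
  proof
    assume "s v = (\<lambda>_. 0)"
    then have "t (s v) = (\<lambda>_. 0)" by (simp add: t_def fun_eq_iff)
    then show "v = (\<lambda>_. 0)" by (simp add: st)
  qed (simp add: s_def fun_eq_iff)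
  have app: "mat_app (\<lambda>k l. poly_subst f (M k l)) m m' (s v) = s (mat_app M m m' v)" for M m m' v
    by (auto simp: mat_app_def s_def fun_eq_iff poly_subst_sum poly_subst_mult)
  have app_im: "mat_app (\<lambda>k l. poly_subst f (M k l)) m m' ` ?F m = s ` (mat_app M m m' ` ?F m)" for M m m'
    by (subst sF[symmetric]) (simp add: image_image app)
  have ker: "{v \<in> ?F m. mat_app (\<lambda>k l. poly_subst f (M k l)) m m' v = (\<lambda>_. 0)}
      = s ` {v \<in> ?F m. mat_app M m m' v = (\<lambda>_. 0)}" for M m m'
  proof (intro equalityI subsetI)
    fix v assume v: "v \<in> {v \<in> ?F m. mat_app (\<lambda>k l. poly_subst f (M k l)) m m' v = (\<lambda>_. 0)}"
    then have "s (mat_app M m m' (t v)) = (\<lambda>_. 0)" by (simp add: st flip: app)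
    then have "t v \<in> {v \<in> ?F m. mat_app M m m' v = (\<lambda>_. 0)}" using v F by (simp add: s0)
    then show "v \<in> s ` {v \<in> ?F m. mat_app M m m' v = (\<lambda>_. 0)}" 
      by (rule image_eqI[where f = s and x = "t v", OF st(1)[of v, symmetric]])
  qed (auto simp: app s0 F)
  have im0: "(\<lambda>v. v 0) ` (s ` X) = poly_subst f ` ((\<lambda>v. v 0) ` X)" for X
    by (simp add: image_image s_def)
  have G1: "b 0 = 1 \<and> a 0 0 = 0 \<and> (\<forall>i>n. b i = 0)"
    using G unfolding graded_free_resolution_def by (elim conjE) (intro conjI)
  have G2: "\<forall>i\<ge>1. \<forall>k<b i. \<forall>l<b (i - 1). d i k l \<in> poly_ring V \<and> homog (a i k - a (i - 1) l) (d i k l)"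
    using G unfolding graded_free_resolution_def by (elim conjE)
  have G3: "(\<lambda>v. v 0) ` (mat_app (d 1) (b 1) 1 ` ?F (b 1)) = I"
    using G unfolding graded_free_resolution_def by (elim conjE)
  have G4: "\<forall>i\<ge>1. {v \<in> ?F (b i). mat_app (d i) (b i) (b (i - 1)) v = (\<lambda>_. 0)}
              = mat_app (d (Suc i)) (b (Suc i)) (b i) ` ?F (b (Suc i))"
    using G unfolding graded_free_resolution_def by (elim conjE)
  show ?thesis
    unfolding graded_free_resolution_def app_im ker im0 G3
  proof (intro conjI allI impI)
    fix i k l assume "1 \<le> i" "k < b i" "l < b (i - 1)"
    then have "d i k l \<in> poly_ring V \<and> homog (a i k - a (i - 1) l) (d i k l)" using G2 by blast
    then show "poly_subst f (d i k l) \<in> poly_ring V" "homog (a i k - a (i - 1) l) (poly_subst f (d i k l))"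
      using poly_subst_poly_ring[of "d i k l" V f V] V(1) poly_subst_homog[of _ "d i k l" f] h by auto
  next
    fix i :: nat assume "1 \<le> i"
    then show "s ` {v \<in> ?F (b i). mat_app (d i) (b i) (b (i - 1)) v = (\<lambda>_. 0)}
        = s ` (mat_app (d (Suc i)) (b (Suc i)) (b i) ` ?F (b (Suc i)))"
      by (simp only: G4[rule_format])
  qed (use G1 in auto)
qed

text \<open>Both infima run over the same triples of length, ranks and degrees, since only the
  matrices change under the substitution.\<close>

lemma cm_reg_subst:
  assumes inv: "\<And>x. poly_subst f (g x) = mvar x" "\<And>x. poly_subst g (f x) = mvar x"
    and V: "\<And>x. x \<in> V \<Longrightarrow> f x \<in> poly_ring V" "\<And>x. x \<in> V \<Longrightarrow> g x \<in> poly_ring V"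
    and h: "\<And>x. homog 1 (f x)" "\<And>x. homog 1 (g x)"
  shows "cm_reg (poly_ring V) (poly_subst f ` I) = cm_reg (poly_ring V) I"
proof -
  have I: "poly_subst g ` (poly_subst f ` I) = I"
    using inv by (simp add: image_image poly_subst_poly_subst)
  have "(\<exists>d. graded_free_resolution (poly_ring V) (poly_subst f ` I) n b a d)
      \<longleftrightarrow> (\<exists>d. graded_free_resolution (poly_ring V) I n b a d)" for n b a
    using graded_free_resolution_subst[OF inv V h(1), of I n b a]
      graded_free_resolution_subst[OF inv(2,1) V(2,1) h(2), of "poly_subst f ` I" n b a]
    unfolding I by blast
  then show ?thesis by (simp add: cm_reg_def)
qed

section \<open>The toric presentation of the Hibi ring\<close>

lemma hpart_homog_eq: "homog d p \<Longrightarrow> hpart e p = (if e = d then p else 0)"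
  by (auto simp: hpart_id) (auto simp: hpart_def homog_def intro!: restr_eq_0)

lemma hpart_poly_subst:
  assumes "\<And>x. homog 1 (f x)"
  shows "hpart e (poly_subst f p) = poly_subst f (hpart e p)"
proof (induction p rule: poly_mapping_add_induct)
  case (single m c)
  have "homog (int (mono_deg m)) (single m c)" by (rule homog_single)
  then show ?case
    using poly_subst_homog[OF _ assms, of "int (mono_deg m)" "single m c"]
    by (simp add: hpart_homog_eq[of "int (mono_deg m)"])
next
  case zero
  show ?case by (simp add: hpart_def)
qed (simp_all add: hpart_add poly_subst_add)

lemma ideal_gen_0: "0 \<in> ideal_gen S G"
  unfolding ideal_gen_def by (auto intro!: exI[of _ "{}"])

lemma ideal_gen_gen: "g \<in> G \<Longrightarrow> g \<in> ideal_gen (poly_ring V) G"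
  unfolding ideal_gen_def by (auto intro!: exI[of _ "{g}"] exI[of _ "\<lambda>_. 1"])

lemma ideal_gen_add:
  assumes "p \<in> ideal_gen (poly_ring V) G" "q \<in> ideal_gen (poly_ring V) G"
  shows "p + q \<in> ideal_gen (poly_ring V) G"
proof -
  obtain F r where p: "finite F" "F \<subseteq> G" "\<forall>g\<in>F. r g \<in> poly_ring V" "p = (\<Sum>g\<in>F. r g * g)"
    using assms(1) unfolding ideal_gen_def by blast
  obtain F' r' where q: "finite F'" "F' \<subseteq> G" "\<forall>g\<in>F'. r' g \<in> poly_ring V" "q = (\<Sum>g\<in>F'. r' g * g)"
    using assms(2) unfolding ideal_gen_def by blast
  define r2 where "r2 g = (if g \<in> F then r g else 0) + (if g \<in> F' then r' g else 0)" for g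
  have "p = (\<Sum>g\<in>F \<union> F'. (if g \<in> F then r g else 0) * g)"
    unfolding p(4) using p(1) q(1) by (intro sum.mono_neutral_cong_left) auto
  moreover have "q = (\<Sum>g\<in>F \<union> F'. (if g \<in> F' then r' g else 0) * g)"
    unfolding q(4) using p(1) q(1) by (intro sum.mono_neutral_cong_left) auto
  ultimately have "p + q = (\<Sum>g\<in>F \<union> F'. r2 g * g)"
    by (simp add: r2_def ring_distribs sum.distrib)
  moreover have "\<forall>g\<in>F \<union> F'. r2 g \<in> poly_ring V" using p(3) q(3) by (auto simp: r2_def)
  ultimately show ?thesis using p(1,2) q(1,2) unfolding ideal_gen_def
    by (intro CollectI exI[of _ "F \<union> F'"] exI[of _ r2]) auto
qed

lemma ideal_gen_mult:
  assumes "c \<in> poly_ring V" "p \<in> ideal_gen (poly_ring V) G"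
  shows "c * p \<in> ideal_gen (poly_ring V) G"
proof -
  obtain F r where p: "finite F" "F \<subseteq> G" "\<forall>g\<in>F. r g \<in> poly_ring V" "p = (\<Sum>g\<in>F. r g * g)"
    using assms(2) unfolding ideal_gen_def by blast
  then have "c * p = (\<Sum>g\<in>F. (c * r g) * g)" by (simp add: sum_distrib_left mult.assoc)
  then show ?thesis using p assms(1) unfolding ideal_gen_def
    by (intro CollectI exI[of _ F] exI[of _ "\<lambda>g. c * r g"]) auto
qed

lemma ideal_gen_hpart:
  assumes "\<And>g. g \<in> G \<Longrightarrow> homog d g" "p \<in> ideal_gen (poly_ring V) G"
  shows "hpart e p \<in> ideal_gen (poly_ring V) G"
proof -
  obtain F r where p: "finite F" "F \<subseteq> G" "\<forall>g\<in>F. r g \<in> poly_ring V" "p = (\<Sum>g\<in>F. r g * g)"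
    using assms(2) unfolding ideal_gen_def by blast
  have "hpart e p = (\<Sum>g\<in>F. hpart (e - d) (r g) * g)"
    unfolding p(4) hpart_sum using p(2) assms(1) by (intro sum.cong hpart_mult) auto
  then show ?thesis using p unfolding ideal_gen_def
    by (intro CollectI exI[of _ F] exI[of _ "\<lambda>g. hpart (e - d) (r g)"]) auto
qed

lemma ideal_gen_induct:
  assumes "p \<in> ideal_gen S G" "P 0" "\<And>p q. P p \<Longrightarrow> P q \<Longrightarrow> P (p + q)" "\<And>c g. c \<in> S \<Longrightarrow> g \<in> G \<Longrightarrow> P (c * g)"
  shows "P p"
proof -
  obtain F r where p: "finite F" "F \<subseteq> G" "\<forall>g\<in>F. r g \<in> S" "p = (\<Sum>g\<in>F. r g * g)"
    using assms(1) unfolding ideal_gen_def by blast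
  show ?thesis unfolding p(4) using p(1-3)
    by (induction F rule: finite_induct) (auto intro: assms)
qed

lemma option_poly_mapping_eqI:
  assumes "lookup u None = lookup v None"
    "\<And>p. lookup u (Some p) = lookup v (Some p)"
  shows "u = v"
  using assms by (intro poly_mapping_eqI) (metis not_None_eq)

lemma mono_split:
  assumes "A \<in> keys m"
  obtains m' where "m = single A 1 + m'" "keys m' \<subseteq> keys m"
    "mono_deg m = Suc (mono_deg m')" "keys m = insert A (keys m')"
proof -
  define m' where "m' = m - single A 1"
  have l: "lookup m' B = lookup m B - (if B = A then 1 else 0)" for B
    by (auto simp: m'_def lookup_minus lookup_single when_def)
  have "m = single A 1 + m'"
    using assms by (intro poly_mapping_eqI) (auto simp: lookup_add l lookup_single when_def in_keys_iff)
  moreover from this have "mono_deg m = Suc (mono_deg m')" by (metis mono_deg_add mono_deg_single plus_1_eq_Suc)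
  moreover have "keys m' \<subseteq> keys m" by (auto simp: in_keys_iff l)
  moreover have "keys m = insert A (keys m')"
    using assms by (auto simp: in_keys_iff l split: if_splits)
  ultimately show ?thesis using that by blast
qed

lemma single_eq_mvar_mult: "single (single A 1 + m) 1 = mvar A * single m 1"
  by (simp add: mvar_def mult_single)

text \<open>\<open>wt\<close> is a natural labelling read backwards: going up in P lowers the
  weight. Listing P by decreasing weight is then a linear extension, and a descent of a linear
  extension will be a place where the weight rises.\<close>

locale weighted_poset =
  fixes P :: "'a set" and le :: "'a \<Rightarrow> 'a \<Rightarrow> bool" and wt :: "'a \<Rightarrow> nat"
  assumes fin: "finite P" and poset: "is_poset P le" and wt_inj: "inj_on wt P"
    and wt_mono: "p \<in> P \<Longrightarrow> q \<in> P \<Longrightarrow> le p q \<Longrightarrow> p \<noteq> q \<Longrightarrow> wt q < wt p"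
begin

section \<open>Poset ideals and their toric monomials\<close>

definition L :: "'a set set" where "L = poset_ideals P le"

lemma L_subset: "A \<in> L \<Longrightarrow> A \<subseteq> P"
  by (auto simp: L_def poset_ideals_def)

lemma finite_L: "finite L"
  using fin L_subset by (intro finite_subset[of L "Pow P"]) auto

lemma finite_ideal: "A \<in> L \<Longrightarrow> finite A"
  using fin L_subset finite_subset by blast

lemma L_Un: "A \<in> L \<Longrightarrow> B \<in> L \<Longrightarrow> A \<union> B \<in> L"
  and L_Int: "A \<in> L \<Longrightarrow> B \<in> L \<Longrightarrow> A \<inter> B \<in> L"
  by (auto simp: L_def poset_ideals_def)

text \<open>The exponent of a variable t times the product of variables x_p over the elements p of
  A, the image of A in the toric ring. \<open>None\<close> stands for t, which records the degree;
  \<open>Some p\<close> stands for x_p.\<close>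

definition emon :: "'a set \<Rightarrow> 'a option \<Rightarrow>\<^sub>0 nat" where
  "emon A = single None 1 + (\<Sum>p\<in>A. single (Some p) 1)"

lemma lookup_emon_None [simp]: "lookup (emon A) None = 1"
  by (simp add: emon_def lookup_add lookup_sum lookup_single)

lemma lookup_emon_Some: "finite A \<Longrightarrow> lookup (emon A) (Some p) = of_bool (p \<in> A)"
  by (simp add: emon_def lookup_add lookup_sum lookup_single when_def)

lemma emon_Un_Int: "finite A \<Longrightarrow> finite B \<Longrightarrow> emon A + emon B = emon (A \<union> B) + emon (A \<inter> B)"
  by (rule option_poly_mapping_eqI) (auto simp: lookup_add lookup_emon_Some)

definition Phi :: "('a set, 'k::comm_ring_1) mpoly \<Rightarrow> ('a option, 'k) mpoly" where
  "Phi = poly_subst (\<lambda>A. single (emon A) 1)"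

definition tor :: "('a set \<Rightarrow>\<^sub>0 nat) \<Rightarrow> 'a option \<Rightarrow>\<^sub>0 nat" where
  "tor m = (\<Sum>A\<in>keys m. \<Sum>i<lookup m A. emon A)"

lemma mono_subst_emon: 
  "mono_subst (\<lambda>A. single (emon A) (1::'k::comm_ring_1)) m = single (tor m) 1"
  by (simp add: mono_subst_def tor_def single_power prod_single)

lemma Phi_single: "Phi (single m c) = single (tor m) c"
  by (simp add: Phi_def poly_subst_single mono_subst_emon mult_single)

lemma Phi_mvar: "Phi (mvar A) = single (emon A) 1"
  by (simp add: Phi_def)

lemma tor_superset:
  assumes "finite X" "keys m \<subseteq> X"
  shows "tor m = (\<Sum>A\<in>X. \<Sum>i<lookup m A. emon A)"
  unfolding tor_def using assms by (intro sum.mono_neutral_left) (auto simp: in_keys_iff)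

lemma tor_add: "tor (m + n) = tor m + tor n"
proof -
  let ?A = "keys m \<union> keys n"
  have "keys (m + n) \<subseteq> ?A" by (rule keys_add)
  then show ?thesis
    by (subst (1 2 3) tor_superset[where X = ?A]) (auto simp: lookup_add sum_lessThan_plus sum.distrib)
qed

lemma tor_0 [simp]: "tor 0 = 0"
  by (simp add: tor_def)

lemma tor_single [simp]: "tor (single A (Suc 0)) = emon A"
  by (simp add: tor_def)

lemma lookup_tor_None: "lookup (tor m) None = mono_deg m"
  by (simp add: tor_def mono_deg_def lookup_sum)

lemma lookup_tor_Some:
  assumes "keys m \<subseteq> L"
  shows "lookup (tor m) (Some p) = (\<Sum>A\<in>keys m. lookup m A * of_bool (p \<in> A))"
  unfolding tor_def lookup_sum using assms finite_ideal by (intro sum.cong) (auto simp: lookup_emon_Some)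

text \<open>The largest ideal that straightening can produce is thus visible in the toric exponent;
  this lets two monomials with equal exponents be straightened in parallel.\<close>

lemma Union_keys_tor:
  assumes "keys m \<subseteq> L"
  shows "\<Union>(keys m) = {p. lookup (tor m) (Some p) \<noteq> 0}"
  by (auto simp: lookup_tor_Some[OF assms] in_keys_iff)

section \<open>The Hibi ideal as the kernel of the toric map\<close>

abbreviation I :: "('a set, 'k::comm_ring_1) mpoly set" where "I \<equiv> hibi_ideal L"

lemma I_0: "0 \<in> I" unfolding hibi_ideal_def by (rule ideal_gen_0)

lemma I_add: "p \<in> I \<Longrightarrow> q \<in> I \<Longrightarrow> p + q \<in> I" unfolding hibi_ideal_def by (rule ideal_gen_add)

lemma I_mult: "c \<in> poly_ring L \<Longrightarrow> p \<in> I \<Longrightarrow> c * p \<in> I" unfolding hibi_ideal_def by (rule ideal_gen_mult)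

lemma I_uminus: "p \<in> I \<Longrightarrow> - p \<in> I" using I_mult[of "- 1" p] by simp

lemma I_hpart: "p \<in> I \<Longrightarrow> hpart e p \<in> I"
  unfolding hibi_ideal_def
  by (rule ideal_gen_hpart[where d = 2]) (auto intro!: homog_diff homog_mult'[OF homog_mvar homog_mvar])

lemma I_subset: "I \<subseteq> poly_ring L"
proof
  fix p :: "('a set, 'k::comm_ring_1) mpoly" assume "p \<in> I"
  then show "p \<in> poly_ring L" unfolding hibi_ideal_def
    by (rule ideal_gen_induct) (auto intro!: poly_ring_mult poly_ring_diff poly_ring_mvar L_Un L_Int)
qed

lemma Phi_I: "p \<in> I \<Longrightarrow> Phi p = 0"
  unfolding hibi_ideal_def
proof (erule ideal_gen_induct)
  fix c g :: "('a set, 'k::comm_ring_1) mpoly"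
  assume "g \<in> {mvar a * mvar b - mvar (a \<union> b) * mvar (a \<inter> b) | a b.
        a \<in> L \<and> b \<in> L \<and> \<not> a \<subseteq> b \<and> \<not> b \<subseteq> a}"
  then obtain a b where ab: "g = mvar a * mvar b - mvar (a \<union> b) * mvar (a \<inter> b)" "a \<in> L" "b \<in> L" by blast
  have "Phi g = 0"
    unfolding ab(1) using emon_Un_Int[of a b] finite_ideal ab
    by (simp add: Phi_def poly_subst_diff poly_subst_mult mult_single)
  then show "Phi (c * g) = 0" by (simp add: Phi_def poly_subst_mult)
qed (simp_all add: Phi_def poly_subst_add)

lemma straighten:
  assumes "A \<in> L" "B \<in> L"
  shows "mvar A * mvar B - mvar (A \<union> B) * mvar (A \<inter> B) \<in> (I :: ('a set, 'k::comm_ring_1) mpoly set)"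
proof (cases "A \<subseteq> B \<or> B \<subseteq> A")
  case True
  then have "mvar A * mvar B = (mvar (A \<union> B) * mvar (A \<inter> B) :: ('a set, 'k) mpoly)"
    by (auto simp: Un_absorb1 Un_absorb2 Int_absorb1 Int_absorb2 mult.commute)
  then show ?thesis using I_0 by simp
next
  case False
  then show ?thesis unfolding hibi_ideal_def using assms by (intro ideal_gen_gen) blast
qed

text \<open>Recursively, all factors but one are straightened to have their union U as a factor; one
  more relation replaces A and U by their union and intersection. The intersection joins the rest,
  so the degree is kept.\<close>

lemma split_off_union:
  assumes "keys m \<subseteq> L" "m \<noteq> 0"
  shows "\<exists>m'. keys m' \<subseteq> L \<and> mono_deg m = Suc (mono_deg m') \<and> \<Union>(keys m) \<in> L \<and>
    single m 1 - mvar (\<Union>(keys m)) * single m' (1::'k::comm_ring_1) \<in> I"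
  using assms
proof (induction "mono_deg m" arbitrary: m)
  case 0
  obtain A where "A \<in> keys m" using 0 by (metis all_not_in_conv keys_eq_empty)
  then show ?case using 0(1) by (metis Zero_not_Suc mono_split)
next
  case (Suc n)
  obtain A where A: "A \<in> keys m" using Suc.prems by (metis all_not_in_conv keys_eq_empty)
  obtain m1 where m1: "m = single A 1 + m1" "keys m1 \<subseteq> keys m"
    "mono_deg m = Suc (mono_deg m1)" "keys m = insert A (keys m1)"
    using mono_split[OF A] by blast
  have AL: "A \<in> L" using A Suc.prems by blast
  show ?case
  proof (cases "m1 = 0")
    case True
    then show ?thesis using m1 AL I_0 by (intro exI[of _ 0]) (simp add: mvar_def)
  next
    case False
    define U where "U = \<Union>(keys m1)"
    obtain m2 where m2: "keys m2 \<subseteq> L" "mono_deg m1 = Suc (mono_deg m2)" "U \<in> L"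
      "single m1 1 - mvar U * single m2 (1::'k) \<in> I"
      using Suc.hyps(1)[of m1] Suc.hyps(2) m1 Suc.prems False unfolding U_def by auto
    have U: "\<Union>(keys m) = A \<union> U" unfolding m1(4) U_def by simp
    define m' where "m' = single (A \<inter> U) 1 + m2"
    have "mvar A * (single m1 1 - mvar U * single m2 (1::'k)) +
      single m2 1 * (mvar A * mvar U - mvar (A \<union> U) * mvar (A \<inter> U)) \<in> I"
      using m2 AL by (intro I_add I_mult straighten) (auto intro: poly_ring_single)
    moreover have "single m 1 - mvar (A \<union> U) * single m' (1::'k)
      = mvar A * (single m1 1 - mvar U * single m2 (1::'k)) +
      single m2 1 * (mvar A * mvar U - mvar (A \<union> U) * mvar (A \<inter> U))"
      unfolding m1(1) m'_def single_eq_mvar_mult by (simp add: algebra_simps)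
    moreover have "keys m' \<subseteq> L"
      using keys_add[of "single (A \<inter> U) 1" m2] m2 L_Int[OF AL m2(3)] by (auto simp: m'_def)
    moreover have "mono_deg m = Suc (mono_deg m')" using m1(3) m2(2) by (simp add: m'_def mono_deg_add)
    ultimately show ?thesis using L_Un[OF AL m2(3)] unfolding U by auto
  qed
qed

lemma Phi_eq_imp_tor_eq:
  assumes "single m 1 - mvar U * single m' (1::'k::comm_ring_1) \<in> I"
  shows "tor m = emon U + tor m'"
proof -
  have "Phi (single m 1 - mvar U * single m' (1::'k)) = 0" using assms by (rule Phi_I)
  then have "Phi (single m (1::'k)) = Phi (mvar U) * Phi (single m' 1)"
    by (simp add: Phi_def poly_subst_diff poly_subst_mult)
  then have "single (tor m) (1::'k) = single (emon U + tor m') 1"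
    by (simp add: Phi_single Phi_mvar mult_single)
  then have "keys (single (tor m) (1::'k)) = keys (single (emon U + tor m') (1::'k))"
    by simp
  then show ?thesis by simp
qed

text \<open>Equal exponents have equal unions. Splitting this common ideal off both monomials and
  cancelling its exponent leaves the same problem in one degree less.\<close>

lemma tor_eq_imp_cong:
  assumes "keys m \<subseteq> L" "keys m' \<subseteq> L" "tor m = tor m'"
  shows "single m 1 - single m' (1::'k::comm_ring_1) \<in> I"
  using assms
proof (induction "mono_deg m" arbitrary: m m')
  have deg0: "mono_deg m = 0 \<Longrightarrow> m = 0" for m :: "'a set \<Rightarrow>\<^sub>0 nat"
    by (metis Zero_not_Suc all_not_in_conv keys_eq_empty mono_split)
  {
    case 0
    then have "m = 0" "m' = 0" using deg0 lookup_tor_None by metis+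
    then show ?case using I_0 by simp
  next
    case (Suc n)
    have d: "mono_deg m' = Suc n" using Suc.hyps(2) Suc.prems(3) lookup_tor_None by metis
    have nz: "m \<noteq> 0" "m' \<noteq> 0" using d Suc.hyps(2) by auto
    define U where "U = \<Union>(keys m)"
    have U': "U = \<Union>(keys m')"
      using Union_keys_tor[OF Suc.prems(1)] Union_keys_tor[OF Suc.prems(2)] Suc.prems(3) by (simp add: U_def)
    obtain m1 where m1: "keys m1 \<subseteq> L" "mono_deg m = Suc (mono_deg m1)" "U \<in> L"
      "single m 1 - mvar U * single m1 (1::'k) \<in> I"
      using split_off_union[OF Suc.prems(1) nz(1)] unfolding U_def by blast
    obtain m1' where m1': "keys m1' \<subseteq> L" "mono_deg m' = Suc (mono_deg m1')"
      "single m' 1 - mvar U * single m1' (1::'k) \<in> I"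
      using split_off_union[OF Suc.prems(2) nz(2)] unfolding U' by blast
    have "tor m1 = tor m1'"
      using Phi_eq_imp_tor_eq[OF m1(4)] Phi_eq_imp_tor_eq[OF m1'(3)] Suc.prems(3) by simp
    then have "single m1 1 - single m1' (1::'k) \<in> I"
      using Suc.hyps m1(1,2) m1'(1) by auto
    then have "mvar U * (single m1 1 - single m1' (1::'k)) \<in> I"
      using m1(3) by (intro I_mult) auto
    from I_add[OF I_add[OF m1(4) this] I_uminus[OF m1'(3)]] show ?case by (simp add: algebra_simps)
  }
qed

text \<open>Choosing one monomial for each toric exponent gives an additive map
  \<open>\<Psi>\<close> back. It need not be multiplicative: that \<open>p\<close> agrees with
  \<open>\<Psi> (Phi p)\<close> modulo \<open>I\<close> can be checked on single terms, where it
  says that monomials with equal exponents are congruent.\<close>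

lemma Phi_kernel:
  fixes p :: "('a set, 'k::comm_ring_1) mpoly"
  assumes "p \<in> poly_ring L" "Phi p = 0"
  shows "p \<in> I"
proof -
  define \<rho> where "\<rho> u = (SOME m. keys m \<subseteq> L \<and> tor m = u)" for u
  define \<Psi> where "\<Psi> q = (\<Sum>u\<in>keys q. single (\<rho> u) (lookup q u))"
    for q :: "('a option, 'k) mpoly"
  have Psi_sup: "\<Psi> q = (\<Sum>u\<in>X. single (\<rho> u) (lookup q u))"
    if "finite X" "keys q \<subseteq> X" for q X
    unfolding \<Psi>_def using that by (intro sum.mono_neutral_left) (auto simp: in_keys_iff)
  have Psi_add: "\<Psi> (q + r) = \<Psi> q + \<Psi> r" for q r
  proof -
    let ?A = "keys q \<union> keys r"
    have "keys (q + r) \<subseteq> ?A" by (rule keys_add)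
    then show ?thesis
      by (subst (1 2 3) Psi_sup[of ?A]) (auto simp: lookup_add single_add sum.distrib)
  qed
  have Psi_single: "\<Psi> (single u c) = single (\<rho> u) c" for u c
    by (cases "c = 0") (auto simp: \<Psi>_def)
  have "p - \<Psi> (Phi p) \<in> I" using assms(1)
  proof (induction rule: poly_ring_induct)
    case zero
    then show ?case using I_0 by (simp add: Phi_def \<Psi>_def)
  next
    case (single m c)
    have "keys (\<rho> (tor m)) \<subseteq> L \<and> tor (\<rho> (tor m)) = tor m"
      unfolding \<rho>_def by (rule someI[of _ m]) (use single in auto)
    then have "single m 1 - single (\<rho> (tor m)) (1::'k) \<in> I"
      using single by (intro tor_eq_imp_cong) auto
    then have "single 0 c * (single m 1 - single (\<rho> (tor m)) 1) \<in> I"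
      by (intro I_mult) (auto intro: poly_ring_single)
    then show ?case by (simp add: Phi_single Psi_single right_diff_distrib mult_single)
  next
    case (add q r)
    then show ?case using I_add[OF add] by (simp add: Phi_def poly_subst_add Psi_add algebra_simps)
  qed
  then show ?thesis using assms(2) by (simp add: \<Psi>_def)
qed

end

section \<open>Linear extensions and their descents\<close>

lemma sum_strict_less_of_separated:
  fixes w :: "'a \<Rightarrow> nat"
  assumes "finite X" "finite Y" "card X = card Y" "X \<noteq> {}" "\<And>x y. x \<in> X \<Longrightarrow> y \<in> Y \<Longrightarrow> w x < w y"
  shows "sum w X < sum w Y"
proof -
  obtain h where h: "bij_betw h X Y" using finite_same_card_bij[OF assms(1-3)] by blast
  have "sum w X < (\<Sum>x\<in>X. w (h x))"
    using assms h by (intro sum_strict_mono) (auto dest: bij_betwE)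
  also have "\<dots> = sum w Y" by (rule sum.reindex_bij_betw[OF h])
  finally show ?thesis .
qed

context weighted_poset
begin

definition lin_ext :: "'a list \<Rightarrow> bool" where
  "lin_ext \<pi> \<longleftrightarrow> distinct \<pi> \<and> set \<pi> = P \<and> (\<forall>i. set (take i \<pi>) \<in> L)"

definition C :: "'a list \<Rightarrow> nat \<Rightarrow> 'a set" where
  "C \<pi> i = set (take i \<pi>)"

text \<open>A descent is recorded by the number of elements before the rise, so that
  \<open>C \<pi> i\<close> is the initial segment ending there. The bounds exclude the empty and the
  full segment.\<close>

definition Des :: "'a list \<Rightarrow> nat set" where
  "Des \<pi> = {i. 0 < i \<and> i < length \<pi> \<and> wt (\<pi> ! (i - 1)) < wt (\<pi> ! i)}"

lemma finite_Des [simp]: "finite (Des \<pi>)"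
  by (rule finite_subset[of _ "{..<length \<pi>}"]) (auto simp: Des_def)

lemma lin_ext_length: "lin_ext \<pi> \<Longrightarrow> length \<pi> = card P"
  by (metis lin_ext_def distinct_card)

lemma Des_lt: "lin_ext \<pi> \<Longrightarrow> i \<in> Des \<pi> \<Longrightarrow> i < card P"
  by (auto simp: Des_def lin_ext_length)

lemma C_in_L: "lin_ext \<pi> \<Longrightarrow> C \<pi> i \<in> L"
  by (simp add: C_def lin_ext_def)

lemma card_C: "lin_ext \<pi> \<Longrightarrow> i \<le> card P \<Longrightarrow> card (C \<pi> i) = i"
  by (simp add: C_def lin_ext_def distinct_card flip: lin_ext_length)

lemma C_mono: "i \<le> j \<Longrightarrow> C \<pi> i \<subseteq> C \<pi> j"
  by (simp add: C_def set_take_subset_set_take)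

lemma nth_mem_C: 
  assumes "distinct \<pi>" "a < length \<pi>" shows "\<pi> ! a \<in> C \<pi> r \<longleftrightarrow> a < r"
proof
  assume "\<pi> ! a \<in> C \<pi> r"
  then obtain i where i: "i < length (take r \<pi>)" "take r \<pi> ! i = \<pi> ! a" unfolding C_def by (metis in_set_conv_nth)
  then have "\<pi> ! i = \<pi> ! a" "i < r" "i < length \<pi>" by auto
  then show "a < r" using assms nth_eq_iff_index_eq by metis
next
  assume "a < r"
  then have "take r \<pi> ! a = \<pi> ! a" "a < length (take r \<pi>)" using assms by auto
  then show "\<pi> ! a \<in> C \<pi> r" unfolding C_def by (metis nth_mem)
qed

lemma wt_decreasing:
  assumes \<pi>: "distinct \<pi>" "set \<pi> = P" and ab: "a < b" "b < length \<pi>"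
    and no: "\<And>i. a < i \<Longrightarrow> i \<le> b \<Longrightarrow> i \<notin> Des \<pi>"
  shows "wt (\<pi> ! b) < wt (\<pi> ! a)"
  using ab no
proof (induction b)
  case (Suc b)
  have "\<not> wt (\<pi> ! b) < wt (\<pi> ! Suc b)" using Suc.prems(3)[of "Suc b"] Suc.prems by (auto simp: Des_def)
  moreover have "wt (\<pi> ! b) \<noteq> wt (\<pi> ! Suc b)"
    using wt_inj \<pi> Suc.prems(2) nth_eq_iff_index_eq[OF \<pi>(1), of b "Suc b"]
    by (auto dest!: inj_onD)
  ultimately have "wt (\<pi> ! Suc b) < wt (\<pi> ! b)" by linarith
  moreover have "wt (\<pi> ! b) < wt (\<pi> ! a)" if "a < b" using Suc.IH that Suc.prems by simp
  ultimately show ?case using Suc.prems(1) by (cases "a = b") auto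
qed simp

text \<open>Any y in the initial segment but not in A precedes any x in A outside the segment. A
  descent between them would give an initial segment containing y but not x, hence incomparable with
  A. So the weight falls from y to x, and exchanging the two difference sets, which have equal size,
  raises the total weight.\<close>

lemma weight_lt_C:
  assumes \<pi>: "lin_ext \<pi>" and A: "A \<in> L" "A \<noteq> C \<pi> (card A)"
    and comp: "\<And>i. i \<in> Des \<pi> \<Longrightarrow> A \<subseteq> C \<pi> i \<or> C \<pi> i \<subseteq> A"
  shows "sum wt A < sum wt (C \<pi> (card A))"
proof -
  define r where "r = card A"
  have d: "distinct \<pi>" "set \<pi> = P" using \<pi> by (auto simp: lin_ext_def)
  have fA: "finite A" "finite (C \<pi> r)" using A(1) finite_ideal by (auto simp: C_def)
  have "r \<le> card P" unfolding r_def by (rule card_mono[OF fin L_subset[OF A(1)]])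
  then have cC: "card (C \<pi> r) = card A" using card_C[OF \<pi>] by (simp add: r_def)
  have cA: "card (A - C \<pi> r) = card (C \<pi> r - A)"
    using cC card_Diff_subset_Int[of A "C \<pi> r"] card_Diff_subset_Int[of "C \<pi> r" A] fA by (simp add: Int_commute)
  have ne: "A - C \<pi> r \<noteq> {}"
  proof
    assume "A - C \<pi> r = {}"
    then have "A \<subseteq> C \<pi> r" by blast
    then have "A = C \<pi> r" using card_subset_eq[OF fA(2)] cC by simp
    then show False using A(2) unfolding r_def by contradiction
  qed
  have "wt x < wt y" if xy: "x \<in> A - C \<pi> r" "y \<in> C \<pi> r - A" for x y
  proof -
    obtain a where a: "a < length \<pi>" "y = \<pi> ! a"
      using xy(2) in_set_takeD[of y r \<pi>] by (auto simp: C_def in_set_conv_nth)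
    have "x \<in> set \<pi>" using xy(1) L_subset[OF A(1)] d(2) by blast
    then obtain b where b: "b < length \<pi>" "x = \<pi> ! b" unfolding in_set_conv_nth by blast
    have ar: "a < r" "r \<le> b" using xy a b nth_mem_C[OF d(1)] by (auto simp: not_less[symmetric])
    have "i \<notin> Des \<pi>" if "a < i" "i \<le> b" for i
    proof
      assume "i \<in> Des \<pi>"
      then have "A \<subseteq> C \<pi> i \<or> C \<pi> i \<subseteq> A" by (rule comp)
      moreover have "y \<in> C \<pi> i" "x \<notin> C \<pi> i" using a b that nth_mem_C[OF d(1)] by auto
      ultimately show False using xy by blast
    qed
    then show ?thesis using wt_decreasing[OF d, of a b] a b ar by auto
  qed
  then have "sum wt (A - C \<pi> r) < sum wt (C \<pi> r - A)"
    using cA ne fA by (intro sum_strict_less_of_separated) auto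
  moreover have "sum wt A = sum wt (A \<inter> C \<pi> r) + sum wt (A - C \<pi> r)"
    using fA by (intro sum.Int_Diff) auto
  moreover have "sum wt (C \<pi> r) = sum wt (A \<inter> C \<pi> r) + sum wt (C \<pi> r - A)"
    using sum.Int_Diff[of "C \<pi> r" wt A] fA by (simp add: Int_commute)
  ultimately show ?thesis by (simp add: r_def)
qed

section \<open>Families of ideals and their measure\<close>

definition fam_mon :: "'a set list \<Rightarrow> 'a option \<Rightarrow>\<^sub>0 nat" where
  "fam_mon As = (\<Sum>A\<leftarrow>As. emon A)"

lemma lookup_fam_mon_None: "lookup (fam_mon As) None = length As"
  by (induction As) (simp_all add: fam_mon_def lookup_add)

lemma lookup_fam_mon_Some:
  assumes "set As \<subseteq> L"
  shows "lookup (fam_mon As) (Some p) = (\<Sum>j<length As. of_bool (p \<in> As ! j))"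
proof -
  have *: "fam_mon As = (\<Sum>j<length As. emon (As ! j))"
    by (simp add: fam_mon_def sum_list_sum_nth atLeast0LessThan)
  have fin: "finite (As ! j)" if "j < length As" for j
    using assms that finite_ideal nth_mem by blast
  show ?thesis
    unfolding * lookup_sum by (intro sum.cong refl lookup_emon_Some fin) simp
qed

text \<open>A lexicographic comparison packed into one number. For a product of N emonomials the sum
  of squares counts all pairwise intersections, and the second sum is at most
  \<open>N * sum wt P\<close>; the factor \<open>1 + N * sum wt P\<close> lets the first sum
  dominate.\<close>

definition meas :: "('a option \<Rightarrow>\<^sub>0 nat) \<Rightarrow> nat" where
  "meas u = (\<Sum>p\<in>P. (lookup u (Some p))\<^sup>2) * (1 + lookup u None * sum wt P)
     + (\<Sum>p\<in>P. wt p * lookup u (Some p))"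

lemma sum_of_bool_mem: "A \<subseteq> P \<Longrightarrow> (\<Sum>p\<in>P. f p * of_bool (p \<in> A)) = (sum f A :: nat)"
  using fin by (simp add: sum.inter_restrict[symmetric] Int_absorb1 of_bool_def if_distrib cong: if_cong)

lemma meas_fam_mon:
  assumes "set As \<subseteq> L"
  shows "meas (fam_mon As) = (\<Sum>j<length As. \<Sum>k<length As. card (As ! j \<inter> As ! k)) * (1 + length As * sum wt P)
     + (\<Sum>j<length As. sum wt (As ! j))"
proof -
  have sub: "As ! j \<subseteq> P" if "j < length As" for j using assms that L_subset nth_mem by blast
  have "(\<Sum>p\<in>P. (lookup (fam_mon As) (Some p))\<^sup>2)
      = (\<Sum>p\<in>P. \<Sum>j<length As. \<Sum>k<length As. of_bool (p \<in> As ! j \<inter> As ! k))"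
    by (simp only: lookup_fam_mon_Some[OF assms] power2_eq_square sum_product of_bool_conj Int_iff)
  also have "\<dots> = (\<Sum>j<length As. \<Sum>k<length As. \<Sum>p\<in>P. of_bool (p \<in> As ! j \<inter> As ! k))"
    by (subst sum.swap, rule sum.cong[OF refl], subst sum.swap) simp
  also have "\<dots> = (\<Sum>j<length As. \<Sum>k<length As. card (As ! j \<inter> As ! k))"
  proof (intro sum.cong refl)
    fix j k assume "j \<in> {..<length As}"
    then have "As ! j \<inter> As ! k \<subseteq> P" using sub by auto
    then show "(\<Sum>p\<in>P. of_bool (p \<in> As ! j \<inter> As ! k)) = card (As ! j \<inter> As ! k)"
      using sum_of_bool_mem[of "As ! j \<inter> As ! k" "\<lambda>_. 1"] by simp
  qed
  finally have 1: "(\<Sum>p\<in>P. (lookup (fam_mon As) (Some p))\<^sup>2)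
      = (\<Sum>j<length As. \<Sum>k<length As. card (As ! j \<inter> As ! k))" .
  have "(\<Sum>p\<in>P. wt p * lookup (fam_mon As) (Some p))
      = (\<Sum>p\<in>P. \<Sum>j<length As. wt p * of_bool (p \<in> As ! j))"
    by (simp only: lookup_fam_mon_Some[OF assms] sum_distrib_left)
  also have "\<dots> = (\<Sum>j<length As. \<Sum>p\<in>P. wt p * of_bool (p \<in> As ! j))" by (rule sum.swap)
  also have "\<dots> = (\<Sum>j<length As. sum wt (As ! j))"
    using sub by (intro sum.cong sum_of_bool_mem) auto
  finally show ?thesis using 1 by (simp add: meas_def lookup_fam_mon_None)
qed

text \<open>The family of initial segments maximizes first the sum of all pairwise intersections, with
  equality only for chains, and then the total weight.\<close>
lemma meas_less:
  assumes \<pi>: "lin_ext \<pi>" and Bs: "set Bs \<subseteq> L" "length Bs = length rs" "\<And>j. j < length rs \<Longrightarrow> card (Bs ! j) = rs ! j"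
    and ds: "\<And>i. i \<in> Des \<pi> \<Longrightarrow> C \<pi> i \<in> set Bs" and ne: "Bs \<noteq> map (C \<pi>) rs"
  shows "meas (fam_mon Bs) < meas (fam_mon (map (C \<pi>) rs))"
proof -
  define N where "N = length rs"
  define X where "X = (\<Sum>j<N. \<Sum>k<N. card (Bs ! j \<inter> Bs ! k))"
  define Y where "Y = (\<Sum>j<N. \<Sum>k<N. card (C \<pi> (rs ! j) \<inter> C \<pi> (rs ! k)))"
  have BL: "Bs ! j \<in> L" if "j < N" for j using that Bs(1,2) nth_mem by (fastforce simp: N_def)
  have le: "rs ! j \<le> card P" if "j < N" for j
    using card_mono[OF fin L_subset[OF BL[OF that]]] Bs(3) that by (simp add: N_def)
  have inter: "card (C \<pi> (rs ! j) \<inter> C \<pi> (rs ! k)) = min (rs ! j) (rs ! k)" if "j < N" "k < N" for j k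
  proof -
    have "C \<pi> (rs ! j) \<inter> C \<pi> (rs ! k) = C \<pi> (min (rs ! j) (rs ! k))"
      using C_mono[of "rs ! j" "rs ! k" \<pi>] C_mono[of "rs ! k" "rs ! j" \<pi>] by (auto simp: min_def)
    then show ?thesis using card_C[OF \<pi>] le that by (simp add: min_le_iff_disj)
  qed
  have cle: "card (Bs ! j \<inter> Bs ! k) \<le> card (C \<pi> (rs ! j) \<inter> C \<pi> (rs ! k))" if "j < N" "k < N" for j k
    using card_mono[of "Bs ! j" "Bs ! j \<inter> Bs ! k"] card_mono[of "Bs ! k" "Bs ! j \<inter> Bs ! k"]
      finite_ideal[OF BL] Bs(3) that by (simp add: inter N_def)
  have mB: "meas (fam_mon Bs) = X * (1 + N * sum wt P) + (\<Sum>j<N. sum wt (Bs ! j))"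
    using meas_fam_mon[OF Bs(1)] by (simp add: X_def N_def Bs(2))
  have "meas (fam_mon (map (C \<pi>) rs)) = Y * (1 + N * sum wt P) + (\<Sum>j<N. sum wt (C \<pi> (rs ! j)))"
    using meas_fam_mon[of "map (C \<pi>) rs"] C_in_L[OF \<pi>] by (simp add: Y_def N_def image_subset_iff)
  note mC = this
  show ?thesis
  proof (cases "\<forall>j<N. \<forall>k<N. card (Bs ! j \<inter> Bs ! k) = card (C \<pi> (rs ! j) \<inter> C \<pi> (rs ! k))")
    case True
    then have "X = Y" by (simp add: X_def Y_def)
    have chain: "Bs ! j \<subseteq> Bs ! k \<or> Bs ! k \<subseteq> Bs ! j" if "j < N" "k < N" for j k
    proof -
      have "card (Bs ! j \<inter> Bs ! k) = min (card (Bs ! j)) (card (Bs ! k))"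
        using True inter Bs(3) that by (simp add: N_def)
      then have "Bs ! j \<inter> Bs ! k = Bs ! j \<or> Bs ! j \<inter> Bs ! k = Bs ! k"
        using card_subset_eq[OF finite_ideal[OF BL]] that by (metis Int_lower1 Int_lower2 min_def)
      then show ?thesis by blast
    qed
    \<comment> \<open>The family contains the segments at the descents, so being a chain makes each
      of its members comparable with them.\<close>
    have comp: "Bs ! j \<subseteq> C \<pi> i \<or> C \<pi> i \<subseteq> Bs ! j" if "j < N" "i \<in> Des \<pi>" for i j
      using ds[OF that(2)] chain[OF that(1)] Bs(2) by (metis N_def in_set_conv_nth)
    have wl: "sum wt (Bs ! j) < sum wt (C \<pi> (rs ! j))" if "j < N" "Bs ! j \<noteq> C \<pi> (rs ! j)" for j
      using weight_lt_C[OF \<pi> BL[OF that(1)]] comp that Bs(3)[of j] by (simp add: N_def)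
    obtain j0 where j0: "j0 < N" "Bs ! j0 \<noteq> C \<pi> (rs ! j0)"
      using ne Bs(2) by (auto simp: list_eq_iff_nth_eq N_def)
    have "(\<Sum>j<N. sum wt (Bs ! j)) < (\<Sum>j<N. sum wt (C \<pi> (rs ! j)))"
    proof (intro sum_strict_mono_ex1)
      show "\<forall>j\<in>{..<N}. sum wt (Bs ! j) \<le> sum wt (C \<pi> (rs ! j))"
        using wl by (metis lessThan_iff nat_less_le order_refl)
      show "\<exists>j\<in>{..<N}. sum wt (Bs ! j) < sum wt (C \<pi> (rs ! j))" using wl[OF j0] j0 by blast
    qed simp
    then show ?thesis using \<open>X = Y\<close> mB mC by simp
  next
    case False
    then obtain j k where jk: "j < N" "k < N" "card (Bs ! j \<inter> Bs ! k) < card (C \<pi> (rs ! j) \<inter> C \<pi> (rs ! k))"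
      using cle by (meson nat_less_le)
    have "X < Y"
      unfolding X_def Y_def
    proof (rule sum_strict_mono_ex1)
      show "\<forall>j\<in>{..<N}. (\<Sum>k<N. card (Bs ! j \<inter> Bs ! k)) \<le> (\<Sum>k<N. card (C \<pi> (rs ! j) \<inter> C \<pi> (rs ! k)))"
        using cle by (intro ballI sum_mono) auto
      have "(\<Sum>k<N. card (Bs ! j \<inter> Bs ! k)) < (\<Sum>k<N. card (C \<pi> (rs ! j) \<inter> C \<pi> (rs ! k)))"
        using cle jk by (intro sum_strict_mono_ex1) auto
      then show "\<exists>j\<in>{..<N}. (\<Sum>k<N. card (Bs ! j \<inter> Bs ! k)) < (\<Sum>k<N. card (C \<pi> (rs ! j) \<inter> C \<pi> (rs ! k)))"
        using jk by blast
    qed simp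
    \<comment> \<open>A deficit in the intersections costs at least one full factor
      \<open>1 + N * sum wt P\<close>, more than the weights of \<open>Bs\<close> can make
      up.\<close>
    have "(\<Sum>j<N. sum wt (Bs ! j)) \<le> (\<Sum>j<N. sum wt P)"
      using BL L_subset fin by (intro sum_mono sum_mono2) auto
    then have "meas (fam_mon Bs) < X * (1 + N * sum wt P) + (1 + N * sum wt P)" using mB by simp
    also have "\<dots> = Suc X * (1 + N * sum wt P)" by simp
    also have "\<dots> \<le> Y * (1 + N * sum wt P)" using \<open>X < Y\<close> by (intro mult_le_mono1) simp
    also have "\<dots> \<le> meas (fam_mon (map (C \<pi>) rs))" using mC by simp
    finally show ?thesis .
  qed
qed

end

section \<open>Leading monomials\<close>

lemma length_filter_mono:
  "(\<And>x. A x \<Longrightarrow> B x) \<Longrightarrow> length (filter A xs) \<le> length (filter B xs)"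
  by (induction xs) (auto simp: le_SucI)

lemma length_filter_strict_mono:
  assumes "\<And>x. A x \<Longrightarrow> B x" "x \<in> set xs" "B x" "\<not> A x"
  shows "length (filter A xs) < length (filter B xs)"
  using assms(2)
proof (induction xs)
  case (Cons y ys)
  have "length (filter A ys) \<le> length (filter B ys)" using assms(1) by (rule length_filter_mono)
  moreover have "A y \<Longrightarrow> B y" by (rule assms(1))
  ultimately show ?case using Cons assms(3,4) by auto
qed simp

lemma length_filter_ge: 
  "length (filter (\<lambda>x. r \<le> x) xs) = length (filter (\<lambda>x. r < x) xs) + count (mset xs) (r::nat)"
  by (induction xs) auto

text \<open>Multiplicities are differences of the numbers of entries above consecutive thresholds.
  Entries 0 lie above no threshold and are recovered from the length; they correspond to the empty
  ideal, visible only in the degree.\<close>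

lemma mset_eq_if_upper_counts_eq:
  assumes n: "set xs \<subseteq> {..n}" "set ys \<subseteq> {..n}" and len: "length xs = length ys"
    and c: "\<And>i. i < n \<Longrightarrow> length (filter (\<lambda>r. i < r) xs) = length (filter (\<lambda>r. i < r) ys)"
  shows "mset xs = mset (ys :: nat list)"
proof (rule multiset_eqI)
  have gt: "length (filter (\<lambda>r. i < r) xs) = length (filter (\<lambda>r. i < r) ys)" for i
  proof (cases "i < n")
    case False
    then have "filter (\<lambda>r. i < r) xs = []" "filter (\<lambda>r. i < r) ys = []"
      using n by (auto simp: filter_empty_conv)
    then show ?thesis by simp
  qed (rule c)
  fix r
  have "length (filter (\<lambda>x. r \<le> x) xs) = length (filter (\<lambda>x. r \<le> x) ys)"
  proof (cases r)
    case (Suc i)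
    then show ?thesis using gt[of i] by (simp add: Suc_le_eq)
  qed (use len in simp)
  then show "count (mset xs) r = count (mset ys) r"
    using gt[of r] by (simp add: length_filter_ge)
qed

context weighted_poset
begin

text \<open>Lexicographic again: multiplicity in \<open>u\<close> first, weight second. Sorting by
  decreasing \<open>key u\<close> makes the weight fall within each level of \<open>u\<close>, so a
  descent can occur only where \<open>u\<close> drops.\<close>

definition key :: "('a option \<Rightarrow>\<^sub>0 nat) \<Rightarrow> 'a \<Rightarrow> nat" where
  "key u p = lookup u (Some p) * (1 + sum wt P) + wt p"

lemma wt_le: "p \<in> P \<Longrightarrow> wt p \<le> sum wt P"
  using fin by (intro member_le_sum) auto

lemma key_less_if_lookup_less:
  assumes "p \<in> P" "lookup u (Some p) < lookup u (Some q)"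
  shows "key u p < key u q"
proof -
  have "key u p < (lookup u (Some p) + 1) * (1 + sum wt P)"
    using wt_le[OF assms(1)] by (simp add: key_def)
  also have "\<dots> \<le> lookup u (Some q) * (1 + sum wt P)"
    using assms(2) by (intro mult_le_mono1) simp
  also have "\<dots> \<le> key u q" by (simp add: key_def)
  finally show ?thesis .
qed

lemma key_less_iff:
  assumes "p \<in> P" "q \<in> P"
  shows "key u p < key u q \<longleftrightarrow> lookup u (Some p) < lookup u (Some q)
     \<or> lookup u (Some p) = lookup u (Some q) \<and> wt p < wt q"
proof -
  consider "lookup u (Some p) < lookup u (Some q)"
    | "lookup u (Some p) = lookup u (Some q)"
    | "lookup u (Some q) < lookup u (Some p)" by linarith
  then show ?thesis
  proof cases
    case 1
    then show ?thesis using key_less_if_lookup_less[OF assms(1)] by simp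
  next
    case 2
    then show ?thesis by (simp add: key_def)
  next
    case 3
    then show ?thesis using key_less_if_lookup_less[OF assms(2) 3] by simp
  qed
qed

lemma key_inj: "inj_on (key u) P"
proof (rule inj_onI)
  fix p q assume pq: "p \<in> P" "q \<in> P" "key u p = key u q"
  then have "wt p = wt q"
    using key_less_iff[of p q u] key_less_iff[of q p u] by auto
  then show "p = q" using wt_inj pq by (auto dest: inj_onD)
qed

lemma decreasing_key_unique:
  assumes "distinct \<pi>" "set \<pi> = P" "\<And>i j. i < j \<Longrightarrow> j < length \<pi> \<Longrightarrow> key u (\<pi> ! j) < key u (\<pi> ! i)"
    and "distinct \<pi>'" "set \<pi>' = P" "\<And>i j. i < j \<Longrightarrow> j < length \<pi>' \<Longrightarrow> key u (\<pi>' ! j) < key u (\<pi>' ! i)"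
  shows "\<pi> = \<pi>'"
proof -
  have s: "sorted_wrt (<) (rev (map (key u) \<pi>))" 
    if "\<And>i j. i < j \<Longrightarrow> j < length \<pi> \<Longrightarrow> key u (\<pi> ! j) < key u (\<pi> ! i)" for \<pi>
    using that unfolding sorted_wrt_rev sorted_wrt_map by (simp add: sorted_wrt_iff_nth_less)
  have "rev (map (key u) \<pi>) = rev (map (key u) \<pi>')"
    by (rule strict_sorted_equal[OF s s]) (use assms in auto)
  then have "map (key u) \<pi> = map (key u) \<pi>'" by simp
  then show ?thesis by (rule map_inj_on) (use key_inj assms(2,5) in simp)
qed

section \<open>Toric exponents as leading exponents, each in exactly one way\<close>

definition lead :: "'a list \<Rightarrow> nat list \<Rightarrow> 'a option \<Rightarrow>\<^sub>0 nat" where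
  "lead \<pi> rs = fam_mon (map (C \<pi>) (sorted_list_of_set (Des \<pi>) @ rs))"

lemma lookup_fam_mon_C:
  assumes "distinct \<pi>" "i < length \<pi>"
  shows "lookup (fam_mon (map (C \<pi>) xs)) (Some (\<pi> ! i)) = length (filter (\<lambda>r. i < r) xs)"
proof (induction xs)
  case (Cons r xs)
  then show ?case using nth_mem_C[OF assms]
    by (simp add: fam_mon_def lookup_add lookup_emon_Some C_def)
qed (simp add: fam_mon_def)

text \<open>The multiplicity of \<open>\<pi> ! k\<close> is the number of chosen segments longer
  than k. It drops across every descent, since the descents are among the chosen lengths; where
  there is no descent the weight falls. So \<open>\<pi>\<close> is the sorted list determined by its
  own leading exponent.\<close>

lemma key_lead_decreasing:
  assumes \<pi>: "lin_ext \<pi>" and ij: "i < j" "j < length \<pi>"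
  shows "key (lead \<pi> rs) (\<pi> ! j) < key (lead \<pi> rs) (\<pi> ! i)"
proof -
  define xs where "xs = sorted_list_of_set (Des \<pi>) @ rs"
  have d: "distinct \<pi>" "set \<pi> = P" using \<pi> by (auto simp: lin_ext_def)
  have f: "lookup (lead \<pi> rs) (Some (\<pi> ! k)) = length (filter (\<lambda>r. k < r) xs)" if "k < length \<pi>" for k
    unfolding lead_def xs_def by (rule lookup_fam_mon_C[OF d(1) that])
  have mem: "\<pi> ! i \<in> P" "\<pi> ! j \<in> P" using d(2) ij by auto
  show ?thesis
  proof (cases "\<exists>r\<in>Des \<pi>. i < r \<and> r \<le> j")
    case True
    then obtain r where r: "r \<in> Des \<pi>" "i < r" "r \<le> j" by blast
    have "length (filter (\<lambda>r. j < r) xs) < length (filter (\<lambda>r. i < r) xs)"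
      using ij r by (intro length_filter_strict_mono[of _ _ r]) (auto simp: xs_def)
    then show ?thesis using f ij mem by (simp add: key_less_iff)
  next
    case False
    then have "wt (\<pi> ! j) < wt (\<pi> ! i)" using wt_decreasing[OF d ij] by blast
    moreover have "length (filter (\<lambda>r. j < r) xs) \<le> length (filter (\<lambda>r. i < r) xs)"
      using ij by (intro length_filter_mono) auto
    ultimately show ?thesis using f ij mem by (auto simp: key_less_iff)
  qed
qed

text \<open>Sorting recovers \<open>\<pi>\<close> from the exponent. Its descents then contribute
  equally on both sides, and the remaining counts determine \<open>rs\<close> up to order.\<close>

lemma lead_inj:
  assumes \<pi>: "lin_ext \<pi>" "lin_ext \<pi>'" and rs: "set rs \<subseteq> {..card P}" "set rs' \<subseteq> {..card P}"
    and eq: "lead \<pi> rs = lead \<pi>' rs'"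
  shows "\<pi> = \<pi>' \<and> mset rs = mset rs'"
proof -
  have d: "distinct \<pi>" "set \<pi> = P" "distinct \<pi>'" "set \<pi>' = P" using \<pi> by (auto simp: lin_ext_def)
  have "\<pi> = \<pi>'"
    using key_lead_decreasing[OF \<pi>(1), of _ _ rs] key_lead_decreasing[OF \<pi>(2), of _ _ rs'] d
    unfolding eq by (intro decreasing_key_unique) auto
  moreover have "mset rs = mset rs'"
  proof (rule mset_eq_if_upper_counts_eq[OF rs])
    show "length rs = length rs'"
      using arg_cong[OF eq, of "\<lambda>u. lookup u None"] \<open>\<pi> = \<pi>'\<close>
      by (simp add: lead_def lookup_fam_mon_None)
    fix i assume "i < card P"
    then have "i < length \<pi>" using lin_ext_length[OF \<pi>(1)] by simp
    moreover have "lookup (lead \<pi> rs) (Some (\<pi> ! i)) = lookup (lead \<pi> rs') (Some (\<pi> ! i))"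
      using eq \<open>\<pi> = \<pi>'\<close> by simp
    ultimately show "length (filter (\<lambda>r. i < r) rs) = length (filter (\<lambda>r. i < r) rs')"
      unfolding lead_def by (simp only: lookup_fam_mon_C[OF d(1)]) simp
  qed
  ultimately show ?thesis by blast
qed

definition U :: "('a option \<Rightarrow>\<^sub>0 nat) set" where
  "U = {tor m | m. keys m \<subseteq> L}"

lemma fam_mon_in_U: "set As \<subseteq> L \<Longrightarrow> fam_mon As \<in> U"
proof (induction As)
  case Nil
  then show ?case by (auto simp: U_def fam_mon_def intro!: exI[of _ 0])
next
  case (Cons A As)
  then obtain m where m: "keys m \<subseteq> L" "fam_mon As = tor m" by (auto simp: U_def)
  have "keys (single A 1 + m) \<subseteq> L"
    using keys_add[of "single A 1" m] m Cons.prems by auto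
  moreover have "fam_mon (A # As) = tor (single A 1 + m)"
    using m(2) by (simp add: fam_mon_def tor_add)
  ultimately show ?case unfolding U_def by blast
qed

text \<open>Toric exponents are sums of indicator functions of down-sets of P, one for each unit of
  degree.\<close>

lemma U_lookup:
  assumes "u \<in> U"
  shows "lookup u (Some p) \<le> lookup u None"
    "p \<notin> P \<Longrightarrow> lookup u (Some p) = 0"
    "p \<in> P \<Longrightarrow> le p q \<Longrightarrow> lookup u (Some q) \<le> lookup u (Some p)"
proof -
  obtain m where m: "keys m \<subseteq> L" "u = tor m" using assms by (auto simp: U_def)
  show "lookup u (Some p) \<le> lookup u None"
    unfolding m(2) lookup_tor_Some[OF m(1)] lookup_tor_None mono_deg_def by (intro sum_mono) auto
  show "lookup u (Some p) = 0" if "p \<notin> P"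
    unfolding m(2) lookup_tor_Some[OF m(1)] using m(1) L_subset that by (intro sum.neutral) auto
  show "lookup u (Some q) \<le> lookup u (Some p)" if "p \<in> P" "le p q"
    unfolding m(2) lookup_tor_Some[OF m(1)]
  proof (intro sum_mono mult_le_mono2)
    fix A assume "A \<in> keys m"
    then have "A \<in> L" using m(1) by blast
    then show "of_bool (q \<in> A) \<le> (of_bool (p \<in> A) :: nat)"
      using that by (auto simp: L_def poset_ideals_def)
  qed
qed

lemma fam_mon_cong_mset: "mset xs = mset ys \<Longrightarrow> fam_mon (map f xs) = fam_mon (map f ys)"
  unfolding fam_mon_def by (metis mset_map sum_mset_sum_list)

text \<open>P is sorted by decreasing \<open>key u\<close>. As \<open>u\<close> and
  \<open>wt\<close> both decrease along P, this is a linear extension. The sets of elements with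
  multiplicity above j, for j below the degree, are then initial segments whose indicators add up to
  \<open>u\<close>. Their sizes include all descents; the remaining sizes form
  \<open>rs\<close>.\<close>

lemma lead_surj:
  assumes "u \<in> U"
  shows "\<exists>\<pi> rs. lin_ext \<pi> \<and> set rs \<subseteq> {..card P} \<and> u = lead \<pi> rs"
proof -
  define f where "f p = lookup u (Some p)" for p
  obtain xs where xs: "distinct xs" "set xs = P" using finite_distinct_list[OF fin] by blast
  define \<pi> where "\<pi> = rev (sort_key (key u) xs)"
  have d: "distinct \<pi>" "set \<pi> = P" using xs by (auto simp: \<pi>_def)
  have len: "length \<pi> = card P" using distinct_card[OF d(1)] d(2) by simp
  have memP: "\<pi> ! i \<in> P" if "i < card P" for i using that d(2) len nth_mem by fastforce
  have kd: "key u (\<pi> ! j) < key u (\<pi> ! i)" if ij: "i < j" "j < card P" for i j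
  proof -
    have "sorted (rev (map (key u) \<pi>))" by (simp add: \<pi>_def rev_map[symmetric] sorted_sort_key)
    then have "key u (\<pi> ! j) \<le> key u (\<pi> ! i)"
      using ij len unfolding sorted_wrt_rev sorted_wrt_map by (simp add: sorted_wrt_iff_nth_less)
    moreover have "\<pi> ! j \<noteq> \<pi> ! i" using ij len nth_eq_iff_index_eq[OF d(1)] by simp
    ultimately show ?thesis
      using key_inj[of u] memP ij by (metis inj_onD nat_less_le order.strict_trans)
  qed
  have fd: "f (\<pi> ! j) \<le> f (\<pi> ! i)" if "i \<le> j" "j < card P" for i j
    using kd[of i j] key_less_iff[OF memP[of j] memP[of i], of u] that by (cases "i = j") (auto simp: f_def)
  have "set (take i \<pi>) \<in> L" for i
    unfolding L_def poset_ideals_def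
  proof (intro CollectI conjI ballI impI)
    show "set (take i \<pi>) \<subseteq> P" using set_take_subset[of i \<pi>] d(2) by simp
    fix x y assume x: "x \<in> set (take i \<pi>)" and y: "y \<in> P" "le y x"
    obtain j where j: "j < length \<pi>" "x = \<pi> ! j" using in_set_takeD[OF x] by (auto simp: in_set_conv_nth)
    then have ji: "j < i" using x nth_mem_C[OF d(1) j(1)] by (simp add: C_def)
    obtain k where k: "k < length \<pi>" "y = \<pi> ! k" using y(1) d(2) by (auto simp: in_set_conv_nth)
    have "k < i"
    proof (rule ccontr)
      \<comment> \<open>Otherwise y would be listed after x although it lies below x. But below x
        the multiplicity is at least as large and the weight strictly larger, so sorting places y
        first.\<close>
      assume "\<not> k < i"
      then have jk: "j < k" using ji by simp
      then have ne: "y \<noteq> x" using j k nth_eq_iff_index_eq[OF d(1), of j k] by simp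
      have xP: "x \<in> P" using j memP len by simp
      have "key u y < key u x" using kd[OF jk] j k len by simp
      moreover have "lookup u (Some x) \<le> lookup u (Some y)"
        using U_lookup(3)[OF assms y] .
      moreover have "wt x < wt y" using wt_mono[OF y(1) xP y(2) ne] .
      ultimately show False using key_less_iff[OF y(1) xP, of u] by auto
    qed
    then show "y \<in> set (take i \<pi>)" using nth_mem_C[OF d(1) k(1), of i] k(2) by (simp add: C_def)
  qed
  then have lin: "lin_ext \<pi>" using d by (simp add: lin_ext_def)
  define N where "N = lookup u None"
  \<comment> \<open>The size of the level set above j. The list is sorted, so this level set
    consists of the first \<open>r j\<close> positions.\<close>
  define r where "r j = card {i. i < card P \<and> j < f (\<pi> ! i)}" for j
  have r: "{i. i < card P \<and> j < f (\<pi> ! i)} = {..<r j}" for j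
  proof -
    have down: "{i. i < card P \<and> j < f (\<pi> ! i)} = {..<m}" if "m = (LEAST m. m = card P \<or> f (\<pi> ! m) \<le> j)" for m
    proof -
      have "m = card P \<or> f (\<pi> ! m) \<le> j" unfolding that by (rule LeastI[of _ "card P"]) simp
      moreover have "m \<le> card P" unfolding that by (rule Least_le) simp
      moreover have "j < f (\<pi> ! i)" if "i < m" for i
        using not_less_Least[of i "\<lambda>m. m = card P \<or> f (\<pi> ! m) \<le> j"] that \<open>m = _\<close> by auto
      moreover have "i < m" if "i < card P" "j < f (\<pi> ! i)" for i
        using fd[of m i] that calculation(1) by (force simp: not_less[symmetric])
      ultimately show ?thesis by auto
    qed
    show ?thesis using down[OF refl] by (simp add: r_def)
  qed
  define ys where "ys = map r [0..<N]"
  have r_le: "r j \<le> card P" for j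
    using card_mono[of "{..<card P}" "{i. i < card P \<and> j < f (\<pi> ! i)}"] by (auto simp: r_def)
  have fle: "f p \<le> N" for p using U_lookup(1)[OF assms] by (simp add: f_def N_def)
  \<comment> \<open>At a descent the weight rises, so the key can fall only because the multiplicity
    does. The level set above the multiplicity just after the descent then has size exactly
    \<open>r'\<close>.\<close>
  have "r' \<in> set ys" if r': "r' \<in> Des \<pi>" for r'
  proof -
    have 1: "0 < r'" "r' < card P" "wt (\<pi> ! (r' - 1)) < wt (\<pi> ! r')" using r' len by (auto simp: Des_def)
    have lt: "f (\<pi> ! r') < f (\<pi> ! (r' - 1))"
      using kd[of "r' - 1" r'] key_less_iff[OF memP[of r'] memP[of "r' - 1"], of u] 1 by (auto simp: f_def)
    have "{i. i < card P \<and> f (\<pi> ! r') < f (\<pi> ! i)} = {..<r'}"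
    proof (intro equalityI subsetI)
      fix i assume "i \<in> {i. i < card P \<and> f (\<pi> ! r') < f (\<pi> ! i)}"
      then show "i \<in> {..<r'}" using fd[of r' i] by (force simp: not_less[symmetric])
    next
      fix i assume "i \<in> {..<r'}"
      then show "i \<in> {i. i < card P \<and> f (\<pi> ! r') < f (\<pi> ! i)}" using fd[of i "r' - 1"] lt 1 by force
    qed
    then have "r (f (\<pi> ! r')) = r'" by (simp add: r_def)
    moreover have "f (\<pi> ! r') < N" using lt fle[of "\<pi> ! (r' - 1)"] by simp
    ultimately show ?thesis by (auto simp: ys_def intro!: image_eqI[of _ _ "f (\<pi> ! r')"])
  qed
  then have "mset_set (Des \<pi>) \<subseteq># mset ys"
    by (intro mset_subset_eqI) (auto simp: count_mset_set' Suc_le_eq split: if_splits)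
  then obtain M where M: "mset ys = mset_set (Des \<pi>) + M" by (metis subset_mset.add_diff_inverse)
  obtain rs where rs: "mset rs = M" using ex_mset by blast
  have ms: "mset ys = mset (sorted_list_of_set (Des \<pi>) @ rs)"
    using mset_set_set[of "sorted_list_of_set (Des \<pi>)"] by (simp add: M rs)
  have "u = fam_mon (map (C \<pi>) ys)"
  proof (rule option_poly_mapping_eqI)
    show "lookup u None = lookup (fam_mon (map (C \<pi>) ys)) None"
      by (simp add: lookup_fam_mon_None ys_def N_def)
    fix p
    show "lookup u (Some p) = lookup (fam_mon (map (C \<pi>) ys)) (Some p)"
    proof (cases "p \<in> P")
      case True
      then obtain i where i: "i < length \<pi>" "p = \<pi> ! i" using d(2) by (auto simp: in_set_conv_nth)
      have "i < r j \<longleftrightarrow> j < f (\<pi> ! i)" for j using r[of j] i(1) len by auto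
      then have "length (filter (\<lambda>r. i < r) ys) = length (filter (\<lambda>j. j < f (\<pi> ! i)) [0..<N])"
        by (simp add: ys_def filter_map o_def)
      also have "\<dots> = card {j. j < N \<and> j < f (\<pi> ! i)}"
        by (simp add: length_filter_conv_card cong: conj_cong)
      also have "{j. j < N \<and> j < f (\<pi> ! i)} = {..<f (\<pi> ! i)}" using fle[of "\<pi> ! i"] by auto
      finally show ?thesis unfolding i(2) lookup_fam_mon_C[OF d(1) i(1)] by (simp add: f_def)
    next
      case False
      have "p \<notin> C \<pi> j" for j using False d(2) in_set_takeD by (fastforce simp: C_def)
      then have "lookup (fam_mon (map (C \<pi>) zs)) (Some p) = 0" for zs
        by (induction zs) (simp_all add: fam_mon_def lookup_add lookup_emon_Some C_def)
      then show ?thesis using U_lookup(2)[OF assms False] by simp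
    qed
  qed
  then have "u = lead \<pi> rs" unfolding lead_def using fam_mon_cong_mset[OF ms] by simp
  moreover have "set rs \<subseteq> set ys" using arg_cong[OF ms, of set_mset] by auto
  then have "set rs \<subseteq> {..card P}" using r_le by (auto simp: ys_def)
  ultimately show ?thesis using lin by blast
qed

end

section \<open>The basis indexed by linear extensions\<close>

lemma listset_iff_list_all2: "xs \<in> listset Ss \<longleftrightarrow> list_all2 (\<in>) xs Ss"
  by (induction Ss arbitrary: xs) (auto simp: set_Cons_def list_all2_Cons2)

lemma ex_maximal_nat:
  assumes "finite X" "X \<noteq> {}"
  obtains x where "x \<in> X" "\<And>y. y \<in> X \<Longrightarrow> (h y :: nat) \<le> h x"
proof -
  have "Max (h ` X) \<in> h ` X" using assms by (intro Max_in) auto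
  then obtain x where "x \<in> X" "Max (h ` X) = h x" by blast
  moreover from this have "h y \<le> h x" if "y \<in> X" for y using that assms by (metis Max_ge finite_imageI imageI)
  ultimately show ?thesis using that by blast
qed

text \<open>\<open>\<pi>\<^sub>0\<close> selects one ideal of each rank, whose variable is to be
  exchanged with the rank sum. Having no descents, it also contributes the basis element 1 in degree
  0.\<close>

locale hibi_basis = weighted_poset +
  fixes \<pi>\<^sub>0 :: "'a list"
  assumes \<pi>0: "lin_ext \<pi>\<^sub>0" "Des \<pi>\<^sub>0 = {}"
begin

definition Z :: "'a set set" where "Z = C \<pi>\<^sub>0 ` {..card P}"

definition Lr :: "nat \<Rightarrow> 'a set set" where "Lr r = {A \<in> L. card A = r}"

definition theta :: "nat \<Rightarrow> ('a set, 'k::comm_ring_1) mpoly" where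
  "theta r = (\<Sum>A\<in>Lr r. mvar A)"

text \<open>Mutually inverse changes of coordinates: the variables in \<open>Z\<close> (the initial segments of
  \<open>\<pi>\<^sub>0\<close>) correspond to the rank sums \<open>theta\<close>.\<close>
definition fsub :: "'a set \<Rightarrow> ('a set, 'k::comm_ring_1) mpoly" where
  "fsub A = (if A \<in> Z then theta (card A) else mvar A)"

definition gsub :: "'a set \<Rightarrow> ('a set, 'k::comm_ring_1) mpoly" where
  "gsub A = (if A \<in> Z then mvar A - (\<Sum>B\<in>Lr (card A) - {A}. mvar B) else mvar A)"

lemma finite_Lr: "finite (Lr r)"
  using finite_L by (simp add: Lr_def)

lemma Z_L: "A \<in> Z \<Longrightarrow> A \<in> L"
  using C_in_L[OF \<pi>0(1)] by (auto simp: Z_def)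

lemma Z_unique: "A \<in> Z \<Longrightarrow> B \<in> Z \<Longrightarrow> card A = card B \<Longrightarrow> A = B"
  using card_C[OF \<pi>0(1)] by (auto simp: Z_def)

lemma fsub_Z: "r \<le> card P \<Longrightarrow> fsub (C \<pi>\<^sub>0 r) = theta r"
  using card_C[OF \<pi>0(1)] by (auto simp: fsub_def Z_def)

lemma Z_Lr: "A \<in> Z \<Longrightarrow> A \<in> Lr (card A)"
  using Z_L by (simp add: Lr_def)

lemma not_Z: "A \<in> Z \<Longrightarrow> B \<in> Lr (card A) - {A} \<Longrightarrow> B \<notin> Z"
  using Z_unique by (auto simp: Lr_def)

lemma fsub_gsub: "poly_subst fsub (gsub A) = mvar A"
proof (cases "A \<in> Z")
  case True
  have "poly_subst fsub (gsub A) = theta (card A) - (\<Sum>B\<in>Lr (card A) - {A}. fsub B)"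
    using True by (simp add: gsub_def poly_subst_diff poly_subst_sum fsub_def)
  also have "(\<Sum>B\<in>Lr (card A) - {A}. fsub B) = (\<Sum>B\<in>Lr (card A) - {A}. mvar B)"
    using not_Z[OF True] by (intro sum.cong) (auto simp: fsub_def)
  also have "theta (card A) = mvar A + (\<Sum>B\<in>Lr (card A) - {A}. mvar B)"
    unfolding theta_def using Z_Lr[OF True] finite_Lr by (intro sum.remove) auto
  finally show ?thesis by simp
qed (simp add: gsub_def fsub_def)

lemma gsub_fsub: "poly_subst gsub (fsub A) = mvar A"
proof (cases "A \<in> Z")
  case True
  have "poly_subst gsub (fsub A) = (\<Sum>B\<in>Lr (card A). gsub B)"
    using True by (simp add: fsub_def theta_def poly_subst_sum)
  also have "\<dots> = gsub A + (\<Sum>B\<in>Lr (card A) - {A}. gsub B)"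
    using Z_Lr[OF True] finite_Lr by (intro sum.remove) auto
  also have "(\<Sum>B\<in>Lr (card A) - {A}. gsub B) = (\<Sum>B\<in>Lr (card A) - {A}. mvar B)"
    using not_Z[OF True] by (intro sum.cong) (auto simp: gsub_def)
  also have "gsub A = mvar A - (\<Sum>B\<in>Lr (card A) - {A}. mvar B)" using True by (simp add: gsub_def)
  finally show ?thesis by simp
qed (simp add: gsub_def fsub_def)

lemma fsub_L: "A \<in> L \<Longrightarrow> fsub A \<in> poly_ring L"
  and gsub_L: "A \<in> L \<Longrightarrow> gsub A \<in> poly_ring L"
  by (auto simp: fsub_def gsub_def theta_def Lr_def intro!: poly_ring_sum poly_ring_diff)

lemma fsub_homog: "homog 1 (fsub A)" and gsub_homog: "homog 1 (gsub A)"
  by (auto simp: fsub_def gsub_def theta_def intro!: homog_sum homog_diff)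

lemma fg: "poly_subst fsub (poly_subst gsub p) = p" and gf: "poly_subst gsub (poly_subst fsub p) = p"
  by (simp_all add: poly_subst_poly_subst fsub_gsub gsub_fsub)

section \<open>Products of rank sums with basis monomials\<close>

definition tz :: "nat list \<Rightarrow> 'a set \<Rightarrow>\<^sub>0 nat" where
  "tz rs = (\<Sum>r\<leftarrow>rs. single (C \<pi>\<^sub>0 r) 1)"

lemma tz_cong: "mset rs = mset rs' \<Longrightarrow> tz rs = tz rs'"
  unfolding tz_def by (metis mset_map sum_mset_sum_list)

lemma keys_tz: "set rs \<subseteq> {..card P} \<Longrightarrow> keys (tz rs) \<subseteq> Z"
proof (induction rs)
  case (Cons r rs)
  then show ?case
    using keys_add[of "single (C \<pi>\<^sub>0 r) 1" "tz rs"] by (auto simp: tz_def Z_def)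
qed (simp add: tz_def)

lemma tz_surj:
  assumes "keys t \<subseteq> Z"
  shows "\<exists>rs. set rs \<subseteq> {..card P} \<and> tz rs = t"
  using assms
proof (induction "mono_deg t" arbitrary: t)
  case 0
  have "t = 0"
  proof (rule ccontr)
    assume "t \<noteq> 0"
    then obtain A where "A \<in> keys t" by (metis all_not_in_conv keys_eq_empty)
    then show False by (rule mono_split) (use 0(1) in simp)
  qed
  then show ?case by (intro exI[of _ "[]"]) (simp add: tz_def)
next
  case (Suc n)
  then have "t \<noteq> 0" by auto
  then obtain A where A: "A \<in> keys t" by (metis all_not_in_conv keys_eq_empty)
  obtain t' where t': "t = single A 1 + t'" "keys t' \<subseteq> keys t"
    "mono_deg t = Suc (mono_deg t')" "keys t = insert A (keys t')"
    by (rule mono_split[OF A])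
  obtain rs where rs: "set rs \<subseteq> {..card P}" "tz rs = t'" using Suc.hyps(1)[of t'] Suc.hyps(2) Suc.prems t' by auto
  obtain r where "r \<le> card P" "A = C \<pi>\<^sub>0 r" using A Suc.prems by (auto simp: Z_def)
  then show ?case using rs t'(1) by (intro exI[of _ "r # rs"]) (auto simp: tz_def)
qed

definition xmon :: "'a list \<Rightarrow> ('a set, 'k::comm_ring_1) mpoly" where
  "xmon \<pi> = (\<Prod>i\<in>Des \<pi>. mvar (C \<pi> i))"

lemma xmon_L: "lin_ext \<pi> \<Longrightarrow> xmon \<pi> \<in> poly_ring L"
  using C_in_L by (auto simp: xmon_def intro!: poly_ring_prod)

lemma xmon_homog: "homog (int (card (Des \<pi>))) (xmon \<pi>)"
  using homog_prod[of "Des \<pi>" "\<lambda>_. 1" "\<lambda>i. mvar (C \<pi> i)"] by (simp add: xmon_def)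

lemma Phi_xmon: "Phi (xmon \<pi>) = single (fam_mon (map (C \<pi>) (sorted_list_of_set (Des \<pi>)))) 1"
proof -
  have "(\<Sum>i\<in>Des \<pi>. emon (C \<pi> i)) = fam_mon (map (C \<pi>) (sorted_list_of_set (Des \<pi>)))"
    using sum.distinct_set_conv_list[of "sorted_list_of_set (Des \<pi>)" "\<lambda>i. emon (C \<pi> i)"]
    by (simp add: fam_mon_def o_def)
  then show ?thesis
    by (simp add: xmon_def Phi_def poly_subst_prod prod_single)
qed

text \<open>The toric image of the basis monomial of \<open>\<pi>\<close> times the product of the
  rank sums with indices \<open>rs\<close>: \<open>fsub\<close> turns each variable in
  \<open>Z\<close> into its rank sum.\<close>

definition V :: "'a list \<Rightarrow> nat list \<Rightarrow> ('a option, 'k::comm_ring_1) mpoly" where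
  "V \<pi> rs = Phi (poly_subst fsub (single (tz rs) 1)) * Phi (xmon \<pi>)"

text \<open>Expanding the product chooses one ideal of each prescribed size independently. Summing
  over lists keeps the multiplicity with which an exponent arises.\<close>

lemma Phi_theta_prod:
  assumes "set rs \<subseteq> {..card P}"
  shows "Phi (poly_subst fsub (single (tz rs) (1::'k::comm_ring_1)))
    = (\<Sum>As\<in>listset (map Lr rs). single (fam_mon As) 1)"
  using assms
proof (induction rs)
  case Nil
  then show ?case by (simp add: tz_def fam_mon_def Phi_def)
next
  case (Cons r rs)
  have img: "listset (map Lr (r # rs)) = (\<lambda>(A, As). A # As) ` (Lr r \<times> listset (map Lr rs))"
    by (auto simp: set_Cons_def)
  have "single (tz (r # rs)) (1::'k) = mvar (C \<pi>\<^sub>0 r) * single (tz rs) 1"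
    by (simp add: tz_def mvar_def mult_single)
  then have "Phi (poly_subst fsub (single (tz (r # rs)) (1::'k)))
     = Phi (theta r) * (\<Sum>As\<in>listset (map Lr rs). single (fam_mon As) 1)"
    using Cons by (simp add: poly_subst_mult fsub_Z Phi_def)
  also have "Phi (theta r) = (\<Sum>A\<in>Lr r. single (emon A) (1::'k))"
    by (simp add: theta_def Phi_def poly_subst_sum)
  also have "\<dots> * (\<Sum>As\<in>listset (map Lr rs). single (fam_mon As) 1)
     = (\<Sum>(A, As)\<in>Lr r \<times> listset (map Lr rs). single (fam_mon (A # As)) 1)"
    by (simp add: sum_product sum.cartesian_product mult_single fam_mon_def)
  also have "\<dots> = (\<Sum>As\<in>listset (map Lr (r # rs)). single (fam_mon As) 1)"
    unfolding img by (subst sum.reindex) (auto simp: inj_on_def case_prod_unfold)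
  finally show ?case .
qed

text \<open>Each term of the expansion comes from a family made of the segments at the descents and
  one ideal for each entry of \<open>rs\<close>, so \<open>meas_less\<close> applies. Strictness
  also shows that no second choice contributes to the leading exponent: its coefficient is 1 in
  every characteristic.\<close>

lemma V_lead:
  assumes \<pi>: "lin_ext \<pi>" and rs: "set rs \<subseteq> {..card P}"
  shows "keys (V \<pi> rs - single (lead \<pi> rs) (1::'k::comm_ring_1))
    \<subseteq> {u \<in> U. meas u < meas (lead \<pi> rs)}"
proof -
  define ds where "ds = sorted_list_of_set (Des \<pi>)"
  define X where "X = listset (map Lr rs)"
  have X: "As \<in> X \<longleftrightarrow> length As = length rs \<and> (\<forall>j<length rs. As ! j \<in> L \<and> card (As ! j) = rs ! j)" for As
    by (auto simp: X_def listset_iff_list_all2 list_all2_conv_all_nth Lr_def)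
  have "finite X"
    by (rule finite_subset[OF _ finite_lists_length_eq[OF finite_L, of "length rs"]])
      (auto simp: X in_set_conv_nth)
  have mem: "map (C \<pi>) rs \<in> X"
    unfolding X
  proof (intro conjI allI impI)
    fix j assume j: "j < length rs"
    then have "rs ! j \<le> card P" using rs nth_mem by fastforce
    then show "map (C \<pi>) rs ! j \<in> L" "card (map (C \<pi>) rs ! j) = rs ! j"
      using j C_in_L[OF \<pi>] card_C[OF \<pi>] by simp_all
  qed simp
  have "V \<pi> rs = (\<Sum>As\<in>X. single (fam_mon (map (C \<pi>) ds @ As)) (1::'k))"
    by (simp add: V_def Phi_theta_prod[OF rs] Phi_xmon X_def ds_def sum_distrib_right mult_single fam_mon_def add.commute)
  also have "\<dots> = single (lead \<pi> rs) 1
      + (\<Sum>As\<in>X - {map (C \<pi>) rs}. single (fam_mon (map (C \<pi>) ds @ As)) 1)"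
    using \<open>finite X\<close> mem by (subst sum.remove[OF _ mem]) (auto simp: lead_def ds_def)
  finally have "keys (V \<pi> rs - single (lead \<pi> rs) (1::'k))
    \<subseteq> (\<Union>As\<in>X - {map (C \<pi>) rs}. keys (single (fam_mon (map (C \<pi>) ds @ As)) (1::'k)))"
    using keys_sum[of "\<lambda>As. single (fam_mon (map (C \<pi>) ds @ As)) (1::'k)" "X - {map (C \<pi>) rs}"]
    by simp
  also have "\<dots> \<subseteq> (\<lambda>As. fam_mon (map (C \<pi>) ds @ As)) ` (X - {map (C \<pi>) rs})" by auto
  also have "\<dots> \<subseteq> {u \<in> U. meas u < meas (lead \<pi> rs)}"
  proof (intro image_subsetI CollectI conjI)
    fix As assume As: "As \<in> X - {map (C \<pi>) rs}"
    define Bs where "Bs = map (C \<pi>) ds @ As"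
    have len: "length As = length rs" using As X by blast
    have BL: "set Bs \<subseteq> L" using As C_in_L[OF \<pi>] by (auto simp: Bs_def X in_set_conv_nth)
    then show "fam_mon (map (C \<pi>) ds @ As) \<in> U" unfolding Bs_def by (rule fam_mon_in_U)
    have "meas (fam_mon Bs) < meas (fam_mon (map (C \<pi>) (ds @ rs)))"
    proof (rule meas_less[OF \<pi> BL])
      show "length Bs = length (ds @ rs)" by (simp add: Bs_def len)
      show "Bs \<noteq> map (C \<pi>) (ds @ rs)" using As by (simp add: Bs_def)
      show "C \<pi> i \<in> set Bs" if "i \<in> Des \<pi>" for i using that by (simp add: Bs_def ds_def)
      fix j assume j: "j < length (ds @ rs)"
      show "card (Bs ! j) = (ds @ rs) ! j"
      proof (cases "j < length ds")
        case True
        then have "ds ! j \<in> Des \<pi>" using nth_mem[OF True] by (simp add: ds_def)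
        then have "ds ! j \<le> card P" using Des_lt[OF \<pi>] by (simp add: less_imp_le)
        then show ?thesis using True card_C[OF \<pi>] by (simp add: Bs_def nth_append)
      next
        case False
        then show ?thesis using As j X[of As] by (simp add: Bs_def nth_append)
      qed
    qed
    then show "meas (fam_mon (map (C \<pi>) ds @ As)) < meas (lead \<pi> rs)"
      by (simp only: Bs_def lead_def ds_def)
  qed
  finally show ?thesis .
qed

lemma keys_Phi: "p \<in> poly_ring L \<Longrightarrow> keys (Phi p) \<subseteq> U"
proof (induction rule: poly_ring_induct)
  case (single m c)
  then show ?case by (auto simp: Phi_single U_def)
next
  case (add q r)
  then show ?case using keys_add[of "Phi q" "Phi r"] by (auto simp: Phi_def poly_subst_add)
qed (simp add: Phi_def)

section \<open>Spanning and independence over the rank sums\<close>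

definition comb :: "'a list list \<Rightarrow> (nat \<Rightarrow> ('a set, 'k::comm_ring_1) mpoly) \<Rightarrow> ('a option, 'k) mpoly" where
  "comb \<pi>s v = (\<Sum>k<length \<pi>s. Phi (poly_subst fsub (v k)) * Phi (xmon (\<pi>s ! k)))"

lemma comb_add: "comb \<pi>s (u + v) = comb \<pi>s u + comb \<pi>s v"
  by (simp add: comb_def Phi_def poly_subst_add ring_distribs sum.distrib)

lemma comb_smul_const: "comb \<pi>s (smul (single 0 c) v) = single 0 c * comb \<pi>s v"
  by (simp add: comb_def Phi_def poly_subst_mult sum_distrib_left mult.assoc)

lemma comb_unit: 
  assumes "k < length \<pi>s"
  shows "comb \<pi>s (smul (single (tz rs) 1) (unit_vec k)) = V (\<pi>s ! k) rs"
proof -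
  have "comb \<pi>s (smul (single (tz rs) 1) (unit_vec k))
     = (\<Sum>i<length \<pi>s. if i = k then V (\<pi>s ! k) rs else 0)"
    unfolding comb_def by (rule sum.cong) (auto simp: unit_vec_def V_def Phi_def)
  then show ?thesis using assms by simp
qed

text \<open>Induction on the measure: an exponent is the leading one of some product, and
  subtracting the remainder of that product leaves exponents of smaller measure.\<close>

lemma comb_span:
  fixes q :: "('a option, 'k::comm_ring_1) mpoly"
  assumes \<pi>s: "set \<pi>s = {\<pi>. lin_ext \<pi>}" and q: "keys q \<subseteq> U"
  shows "\<exists>v\<in>free_mod (poly_ring Z) (length \<pi>s). q = comb \<pi>s v"
proof -
  let ?S = "\<lambda>q :: ('a option, 'k) mpoly. \<exists>v\<in>free_mod (poly_ring Z) (length \<pi>s). q = comb \<pi>s v"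
  have S_add: "?S (q + r)" if "?S q" "?S r" for q r :: "('a option, 'k) mpoly"
    using that comb_add free_mod_add by metis
  have S_smul: "?S (single 0 c * q)" if S: "?S q" for q :: "('a option, 'k) mpoly" and c
  proof -
    obtain v where "v \<in> free_mod (poly_ring Z) (length \<pi>s)" "q = comb \<pi>s v" using S by blast
    moreover have "single 0 c \<in> poly_ring Z" by (simp add: poly_ring_single)
    ultimately show ?thesis using comb_smul_const free_mod_smul by metis
  qed
  have S_0: "?S (0 :: ('a option, 'k) mpoly)"
    by (intro bexI[of _ 0]) (auto simp: comb_def Phi_def)
  have S_single: "?S (single u (c::'k))" if "u \<in> U" for u c
    using that
  proof (induction "meas u" arbitrary: u c rule: less_induct)
    case less
    obtain \<pi> rs where u: "lin_ext \<pi>" "set rs \<subseteq> {..card P}" "u = lead \<pi> rs"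
      using lead_surj[OF less.prems] by blast
    obtain k where k: "k < length \<pi>s" "\<pi>s ! k = \<pi>" using \<pi>s u(1) by (metis in_set_conv_nth mem_Collect_eq)
    define R where "R = V \<pi> rs - single u (1::'k)"
    have "?S (V \<pi> rs)"
    proof (rule bexI)
      show "V \<pi> rs = comb \<pi>s (smul (single (tz rs) 1) (unit_vec k))" by (simp add: comb_unit[OF k(1)] k(2))
      show "smul (single (tz rs) 1) (unit_vec k) \<in> free_mod (poly_ring Z) (length \<pi>s)"
        using keys_tz[OF u(2)] k(1) by (intro free_mod_smul poly_ring_single) auto
    qed
    moreover have "?S R"
    proof (rule poly_mapping_add_induct)
      fix m :: "'a option \<Rightarrow>\<^sub>0 nat" and c :: 'k
      assume "m \<in> keys R"
      then have "m \<in> U" "meas m < meas u" using V_lead[OF u(1,2)] unfolding R_def u(3) by auto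
      then show "?S (single m c)" using less.hyps by blast
    qed (rule S_0, rule S_add)
    ultimately have "?S (single 0 c * (V \<pi> rs + single 0 (-1) * R))"
      by (intro S_smul S_add)
    moreover have "V \<pi> rs + single 0 (-1) * R = single u 1"
      by (simp add: R_def single_uminus)
    ultimately show ?case by (simp add: mult_single)
  qed
  show ?thesis
    by (rule poly_mapping_add_induct[of ?S q]) (use q S_0 S_add S_single in auto)
qed

text \<open>Among the terms of \<open>v\<close>, take one whose leading exponent has maximal
  measure. No other term has the same leading exponent, and all remainders have smaller measure than
  their leading exponents, so the coefficient of the chosen term survives in the sum.\<close>

lemma comb_indep:
  fixes v :: "nat \<Rightarrow> ('a set, 'k::comm_ring_1) mpoly"
  assumes \<pi>s: "distinct \<pi>s" "set \<pi>s = {\<pi>. lin_ext \<pi>}"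
    and v: "v \<in> free_mod (poly_ring Z) (length \<pi>s)" "comb \<pi>s v = 0"
  shows "v = 0"
proof (rule ccontr)
  assume "v \<noteq> 0"
  define B where "B = length \<pi>s"
  define X where "X = (SIGMA k:{..<B}. keys (v k))"
  obtain k where "v k \<noteq> 0" using \<open>v \<noteq> 0\<close> by (auto simp: fun_eq_iff)
  then have "k < B" using free_mod_out[OF v(1), of k] by (simp add: B_def linorder_not_le[symmetric]) blast
  obtain t where "t \<in> keys (v k)" using \<open>v k \<noteq> 0\<close> by (metis all_not_in_conv keys_eq_empty)
  then have "(k, t) \<in> X" using \<open>k < B\<close> by (simp add: X_def)
  then have "X \<noteq> {}" by blast
  moreover have "finite X" by (simp add: X_def)
  moreover define rsof where "rsof t = (SOME rs. set rs \<subseteq> {..card P} \<and> tz rs = t)" for t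
  define ld where "ld = (\<lambda>(k, t). lead (\<pi>s ! k) (rsof t))"
  ultimately obtain x0 where x0: "x0 \<in> X" "\<And>x. x \<in> X \<Longrightarrow> meas (ld x) \<le> meas (ld x0)"
    using ex_maximal_nat[of X "\<lambda>x. meas (ld x)"] by metis
  have lin: "lin_ext (\<pi>s ! k)" if "k < B" for k using that \<pi>s(2) nth_mem unfolding B_def by blast
  have rs: "set (rsof t) \<subseteq> {..card P} \<and> tz (rsof t) = t" if "(k, t) \<in> X" for k t
  proof -
    have "keys t \<subseteq> Z" using that free_mod_poly_ring[OF v(1), of k] by (auto simp: X_def B_def poly_ring_def)
    then show ?thesis unfolding rsof_def by (rule someI_ex[OF tz_surj])
  qed
  have expand: "Phi (poly_subst fsub (v k)) * Phi (xmon (\<pi>s ! k))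
    = (\<Sum>t\<in>keys (v k). single 0 (lookup (v k) t) * V (\<pi>s ! k) (rsof t))"
    if "k < B" for k
  proof -
    have "v k = (\<Sum>t\<in>keys (v k). single t (lookup (v k) t))"
      by (rule poly_mapping_sum_single) auto
    also have "\<dots> = (\<Sum>t\<in>keys (v k). single 0 (lookup (v k) t) * single t 1)"
      by (simp add: mult_single)
    finally have "Phi (poly_subst fsub (v k)) * Phi (xmon (\<pi>s ! k)) = 
       Phi (poly_subst fsub (\<Sum>t\<in>keys (v k). single 0 (lookup (v k) t) * single t 1))
         * Phi (xmon (\<pi>s ! k))" by (rule arg_cong)
    also have "\<dots> = (\<Sum>t\<in>keys (v k). single 0 (lookup (v k) t) * 
        (Phi (poly_subst fsub (single t 1)) * Phi (xmon (\<pi>s ! k))))"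
      by (simp only: Phi_def poly_subst_sum poly_subst_mult poly_subst_const sum_distrib_right mult.assoc)
    also have "\<dots> = (\<Sum>t\<in>keys (v k). single 0 (lookup (v k) t) * V (\<pi>s ! k) (rsof t))"
    proof (rule sum.cong[OF refl])
      fix t assume "t \<in> keys (v k)"
      then have "tz (rsof t) = t" using rs[of k t] that by (simp add: X_def)
      then show "single 0 (lookup (v k) t) * 
        (Phi (poly_subst fsub (single t 1)) * Phi (xmon (\<pi>s ! k)))
        = single 0 (lookup (v k) t) * V (\<pi>s ! k) (rsof t)"
        by (simp add: V_def)
    qed
    finally show ?thesis .
  qed
  have look: "lookup (V (\<pi>s ! k) (rsof t) :: ('a option, 'k) mpoly) (ld x0) = (if (k, t) = x0 then 1 else 0)"
    if kt: "(k, t) \<in> X" for k t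
  proof -
    define R where "R = V (\<pi>s ! k) (rsof t) - single (ld (k, t)) (1::'k)"
    have k: "k < B" using kt by (simp add: X_def)
    have "ld x0 \<notin> keys R"
      using V_lead[OF lin[OF k] conjunct1[OF rs[OF kt]], where 'k = 'k] x0(2)[OF kt]
      unfolding R_def ld_def by fastforce
    then have "lookup R (ld x0) = 0" by (simp add: in_keys_iff)
    then have 1: "lookup (V (\<pi>s ! k) (rsof t) :: ('a option, 'k) mpoly) (ld x0)
       = lookup (single (ld (k, t)) (1::'k)) (ld x0)"
      by (simp add: R_def lookup_minus)
    have "ld (k, t) = ld x0 \<longleftrightarrow> (k, t) = x0"
    proof
      obtain k' t' where x0': "x0 = (k', t')" by (cases x0)
      have k': "k' < B" "(k', t') \<in> X" using x0(1) by (auto simp: x0' X_def)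
      assume "ld (k, t) = ld x0"
      then have "\<pi>s ! k = \<pi>s ! k' \<and> mset (rsof t) = mset (rsof t')"
        unfolding ld_def x0' prod.case
        by (rule lead_inj[OF lin[OF k] lin[OF k'(1)] conjunct1[OF rs[OF kt]] conjunct1[OF rs[OF k'(2)]]])
      then have eq: "\<pi>s ! k = \<pi>s ! k'" "mset (rsof t) = mset (rsof t')" by simp_all
      have "k = k'" using nth_eq_iff_index_eq[OF \<pi>s(1)] k k'(1) eq(1) by (simp add: B_def)
      moreover have "t = t'"
        using tz_cong[OF eq(2)] conjunct2[OF rs[OF kt]] conjunct2[OF rs[OF k'(2)]] by simp
      ultimately show "(k, t) = x0" by (simp add: x0')
    qed auto
    then show ?thesis unfolding 1 by (auto simp: lookup_single when_def)
  qed
  have "0 = lookup (comb \<pi>s v) (ld x0)" using v(2) by simp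
  also have "comb \<pi>s v = (\<Sum>k<B. \<Sum>t\<in>keys (v k). single 0 (lookup (v k) t) * V (\<pi>s ! k) (rsof t))"
    unfolding comb_def B_def[symmetric] using expand by (intro sum.cong) auto
  also have "\<dots> = (\<Sum>(k, t)\<in>X. single 0 (lookup (v k) t) * V (\<pi>s ! k) (rsof t))"
    unfolding X_def by (rule sum.Sigma) auto
  also have "lookup \<dots> (ld x0) = (\<Sum>x\<in>X. if x = x0 then lookup (v (fst x0)) (snd x0) else 0)"
    unfolding lookup_sum
  proof (rule sum.cong[OF refl])
    fix x assume x: "x \<in> X"
    obtain k t where kt: "x = (k, t)" by (cases x)
    have "lookup (single 0 (lookup (v k) t) * V (\<pi>s ! k) (rsof t)) (ld x0)
       = lookup (v k) t * lookup (V (\<pi>s ! k) (rsof t)) (ld x0)"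
      using lookup_single_mult[of 0 "lookup (v k) t" "V (\<pi>s ! k) (rsof t)" "ld x0"] by simp
    then show "lookup (case x of (k, t) \<Rightarrow> single 0 (lookup (v k) t) * V (\<pi>s ! k) (rsof t)) (ld x0)
       = (if x = x0 then lookup (v (fst x0)) (snd x0) else 0)"
      using look[of k t] x by (auto simp: kt)
  qed
  also have "\<dots> = lookup (v (fst x0)) (snd x0)"
    using x0(1) \<open>finite X\<close> by (subst sum.delta) auto
  finally have "lookup (v (fst x0)) (snd x0) = 0" by simp
  then show False using x0(1) by (auto simp: X_def in_keys_iff)
qed

lemma finite_lin_ext: "finite {\<pi>. lin_ext \<pi>}"
  by (rule finite_subset[OF _ finite_lists_length_eq[OF fin, of "card P"]])
    (use lin_ext_length lin_ext_def in auto)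

text \<open>Applying \<open>gsub\<close> turns the rank sum of rank r into the variable of
  \<open>C \<pi>\<^sub>0 r\<close>. In these coordinates the parameter ring is generated by
  variables, as the cone construction demands.\<close>

lemma hibi_quotient: "quotient L (poly_subst gsub ` (I :: ('a set, 'k::comm_ring_1) mpoly set))"
proof
  show "0 \<in> poly_subst gsub ` I" by (rule image_eqI[of _ _ 0]) (auto simp: I_0)
next
  fix p q :: "('a set, 'k) mpoly" assume "p \<in> poly_subst gsub ` I" "q \<in> poly_subst gsub ` I"
  then obtain p' q' where "p' \<in> I" "q' \<in> I" "p + q = poly_subst gsub (p' + q')" by (auto simp: poly_subst_add)
  then show "p + q \<in> poly_subst gsub ` I" using I_add by blast
next
  fix c p :: "('a set, 'k) mpoly" assume c: "c \<in> poly_ring L" and "p \<in> poly_subst gsub ` I"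
  then obtain q where q: "q \<in> I" "p = poly_subst gsub q" by blast
  have "poly_subst fsub c * q \<in> I" using poly_subst_poly_ring[OF c fsub_L] q(1) by (rule I_mult)
  moreover have "c * p = poly_subst gsub (poly_subst fsub c * q)" by (simp add: poly_subst_mult gf q(2))
  ultimately show "c * p \<in> poly_subst gsub ` I" by blast
next
  fix e and p :: "('a set, 'k) mpoly" assume "p \<in> poly_subst gsub ` I"
  then obtain q where "q \<in> I" "p = poly_subst gsub q" by blast
  then show "hpart e p \<in> poly_subst gsub ` I"
    using I_hpart[of q e] by (auto simp: hpart_poly_subst[OF gsub_homog])
qed

theorem cm_reg_hibi:
  "cm_reg (poly_ring L) (I :: ('a set, 'k::comm_ring_1) mpoly set) = Max ((\<lambda>\<pi>. int (card (Des \<pi>))) ` {\<pi>. lin_ext \<pi>})"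
proof -
  define J where "J = poly_subst gsub ` (I :: ('a set, 'k) mpoly set)"
  interpret Q: quotient L J unfolding J_def by (rule hibi_quotient)
  obtain ys where ys: "distinct ys" "set ys = {\<pi>. lin_ext \<pi>} - {\<pi>\<^sub>0}"
    using finite_distinct_list[of "{\<pi>. lin_ext \<pi>} - {\<pi>\<^sub>0}"] finite_lin_ext by auto
  \<comment> \<open>Placing \<open>\<pi>\<^sub>0\<close> first makes the generator with index 0
    equal to 1, as the passage to a cyclic resolution requires.\<close>
  define \<pi>s where "\<pi>s = \<pi>\<^sub>0 # ys"
  have \<pi>s: "distinct \<pi>s" "set \<pi>s = {\<pi>. lin_ext \<pi>}" "\<pi>s ! 0 = \<pi>\<^sub>0"
    using ys \<pi>0(1) by (auto simp: \<pi>s_def)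
  define B where "B = length \<pi>s"
  define \<beta> where "\<beta> k = poly_subst gsub (xmon (\<pi>s ! k) :: ('a set, 'k) mpoly)" for k
  define d where "d k = int (card (Des (\<pi>s ! k)))" for k
  define s where "s = Max ((\<lambda>\<pi>. int (card (Des \<pi>))) ` {\<pi>. lin_ext \<pi>})"
  have lin: "lin_ext (\<pi>s ! k)" if "k < B" for k using that \<pi>s(2) nth_mem unfolding B_def by blast
  have Phi_ev: "Phi (poly_subst fsub (ev \<beta> B v)) = comb \<pi>s v" for v
    by (simp add: ev_def comb_def B_def \<beta>_def Phi_def poly_subst_sum poly_subst_mult fg)
  have "s \<in> (\<lambda>\<pi>. int (card (Des \<pi>))) ` {\<pi>. lin_ext \<pi>}"
    unfolding s_def using \<pi>0(1) finite_lin_ext by (intro Max_in) auto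
  then obtain \<pi> where "lin_ext \<pi>" "int (card (Des \<pi>)) = s" by blast
  then have "\<pi> \<in> set \<pi>s" using \<pi>s(2) by simp
  then obtain k0 where "k0 < length \<pi>s" "\<pi>s ! k0 = \<pi>" unfolding in_set_conv_nth by blast
  then have k0: "k0 < B" "d k0 = s" using \<open>int (card (Des \<pi>)) = s\<close> by (simp_all add: B_def d_def)
  have "cm_reg (poly_ring L) J = s"
  proof (rule Q.cm_reg_eqI[where Z = Z and Y = "L - Z" and B = B and \<beta> = \<beta> and d = d])
    show "L = Z \<union> (L - Z)" using Z_L by blast
    show "J \<subseteq> poly_ring L"
      unfolding J_def using poly_subst_poly_ring[OF subsetD[OF I_subset] gsub_L] by (rule image_subsetI)
    show "\<beta> k \<in> poly_ring L" if "k < B" for k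
      unfolding \<beta>_def using xmon_L[OF lin[OF that]] gsub_L by (rule poly_subst_poly_ring)
    show "homog (d k) (\<beta> k)" if "k < B" for k
      unfolding \<beta>_def d_def by (rule poly_subst_homog[OF xmon_homog gsub_homog])
    show "d k \<le> s" if "k < B" for k
      unfolding s_def d_def using finite_lin_ext lin[OF that] by (intro Max_ge) auto
    show "\<beta> 0 = 1" "d 0 = 0" using \<pi>s(3) \<pi>0(2) by (simp_all add: \<beta>_def d_def xmon_def)
  next
    fix p :: "('a set, 'k) mpoly" assume p: "p \<in> poly_ring L"
    then have fp: "poly_subst fsub p \<in> poly_ring L" using fsub_L by (rule poly_subst_poly_ring)
    obtain v where v: "v \<in> free_mod (poly_ring Z) B" "Phi (poly_subst fsub p) = comb \<pi>s v"
      using comb_span[OF \<pi>s(2) keys_Phi[OF fp]] unfolding B_def by blast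
    have "ev \<beta> B v \<in> poly_ring L"
    proof (rule ev_poly_ring)
      fix k assume "k < B"
      show "\<beta> k \<in> poly_ring L"
        unfolding \<beta>_def using xmon_L[OF lin[OF \<open>k < B\<close>]] gsub_L by (rule poly_subst_poly_ring)
      show "v k \<in> poly_ring L" using free_mod_poly_ring[OF v(1) \<open>k < B\<close>] poly_ring_mono[of Z L] Z_L by blast
    qed
    then have "poly_subst fsub (p - ev \<beta> B v) \<in> poly_ring L"
      using p by (intro poly_subst_poly_ring[OF _ fsub_L] poly_ring_diff) auto
    moreover have "Phi (poly_subst fsub (p - ev \<beta> B v)) = 0"
      using v(2) Phi_ev[of v] by (simp add: Phi_def poly_subst_diff)
    ultimately have "poly_subst fsub (p - ev \<beta> B v) \<in> I" by (rule Phi_kernel)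
    then have "p - ev \<beta> B v \<in> J" unfolding J_def by (rule image_eqI[rotated]) (simp add: gf)
    then show "\<exists>v\<in>free_mod (poly_ring Z) B. p - ev \<beta> B v \<in> J" using v(1) by blast
  next
    fix v assume v: "v \<in> free_mod (poly_ring Z) B" "ev \<beta> B v \<in> J"
    then have "poly_subst fsub (ev \<beta> B v) \<in> I" by (auto simp: J_def fg)
    then have "comb \<pi>s v = 0" using Phi_I Phi_ev by metis
    then show "v = 0" using comb_indep[OF \<pi>s(1,2)] v(1) unfolding B_def by blast
  qed (use finite_L k0 in auto)
  moreover have "cm_reg (poly_ring L) J = cm_reg (poly_ring L) (I :: ('a set, 'k) mpoly set)"
    unfolding J_def
    by (rule cm_reg_subst[OF gsub_fsub fsub_gsub gsub_L fsub_L gsub_homog fsub_homog])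
  ultimately show ?thesis by (simp add: s_def)
qed

end

section \<open>Descents and antichains\<close>

text \<open>Written in base n, the weight of p has last digit \<open>g p\<close>, which makes
  weights distinct; the leading part counts the elements above p and drops strictly on going
  up.\<close>

lemma ex_weighted_poset:
  assumes "finite P" "is_poset P le"
  shows "\<exists>wt. weighted_poset P le wt"
proof -
  obtain g :: "'a \<Rightarrow> nat" and n where g: "g ` P = {i. i < n}" "inj_on g P"
    using finite_imp_inj_to_nat_seg[OF assms(1)] by blast
  define up where "up p = {q \<in> P. le p q}" for p
  define wt where "wt p = card (up p) * n + g p" for p
  have gn: "g p < n" if "p \<in> P" for p using g(1) that by blast
  have wt_mod: "wt p mod n = g p" if "p \<in> P" for p using gn[OF that] by (simp add: wt_def)
  have "weighted_poset P le wt"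
  proof
    show "inj_on wt P"
    proof (rule inj_onI)
      fix p q assume pq: "p \<in> P" "q \<in> P" "wt p = wt q"
      have "g p = g q" using wt_mod[OF pq(1)] wt_mod[OF pq(2)] unfolding pq(3) by simp
      then show "p = q" using g(2) pq by (auto dest: inj_onD)
    qed
  next
    fix p q assume pq: "p \<in> P" "q \<in> P" "le p q" "p \<noteq> q"
    have "up q \<subset> up p"
      using assms(2) pq unfolding is_poset_def up_def by blast
    moreover have "finite (up p)" using assms(1) by (simp add: up_def)
    ultimately have "card (up q) < card (up p)" by (rule psubset_card_mono[rotated])
    then have "Suc (card (up q)) * n \<le> card (up p) * n" by (intro mult_le_mono1) simp
    then show "wt q < wt p" using gn[OF pq(2)] by (simp add: wt_def)
  qed (use assms in auto)
  then show ?thesis by blast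
qed

context weighted_poset
begin

text \<open>The exponent 0 has degree 0, so the family of segments representing it is empty, and the
  segments at descents belong to that family.\<close>

lemma ex_lin_ext_no_descents: "\<exists>\<pi>. lin_ext \<pi> \<and> Des \<pi> = {}"
proof -
  have "0 \<in> U" by (auto simp: U_def intro!: exI[of _ 0])
  then obtain \<pi> rs where \<pi>: "lin_ext \<pi>" "0 = lead \<pi> rs" using lead_surj by blast
  have "length (sorted_list_of_set (Des \<pi>)) = 0"
    using arg_cong[OF \<pi>(2), of "\<lambda>u. lookup u None"] by (simp add: lead_def lookup_fam_mon_None)
  then show ?thesis using \<pi>(1) by (intro exI[of _ \<pi>]) simp
qed

lemma ex_descent_between:
  assumes "lin_ext \<pi>" "a < b" "b < length \<pi>" "wt (\<pi> ! a) < wt (\<pi> ! b)"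
  shows "\<exists>i\<in>Des \<pi>. a < i \<and> i \<le> b"
  using wt_decreasing[of \<pi> a b] assms by (fastforce simp: lin_ext_def)

text \<open>The ideals generated by the initial segments of the antichain, listed by increasing weight,
  force a linear extension to list the antichain by increasing weight as well.\<close>
lemma ex_lin_ext_descents:
  assumes Q: "Q \<subseteq> P" "\<And>p q. p \<in> Q \<Longrightarrow> q \<in> Q \<Longrightarrow> le p q \<Longrightarrow> p = q"
  shows "\<exists>\<pi>. lin_ext \<pi> \<and> card Q - 1 \<le> card (Des \<pi>)"
proof -
  have finQ: "finite Q" using Q(1) fin by (rule finite_subset)
  define m where "m = card Q"
  obtain xs where xs: "distinct xs" "set xs = Q" using finite_distinct_list[OF finQ] by blast
  define qs where "qs = sort_key wt xs"
  have qs: "distinct qs" "set qs = Q" using xs by (auto simp: qs_def)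
  have len: "length qs = m" using distinct_card[OF qs(1)] qs(2) by (simp add: m_def)
  have qP: "qs ! i \<in> P" if "i < m" for i using that Q(1) qs(2) len nth_mem by blast
  have wlt: "wt (qs ! i) < wt (qs ! j)" if ij: "i < j" "j < m" for i j
  proof -
    have "sorted (map wt qs)" by (simp add: qs_def)
    then have "wt (qs ! i) \<le> wt (qs ! j)" using ij len by (simp add: sorted_wrt_map sorted_wrt_iff_nth_less)
    moreover have "qs ! i \<noteq> qs ! j" using ij len nth_eq_iff_index_eq[OF qs(1)] by simp
    ultimately show ?thesis using wt_inj qP ij by (metis inj_onD nat_less_le order.strict_trans)
  qed
  define D where "D j = {x \<in> P. \<exists>i\<le>j. le x (qs ! i)}" for j
  have DL: "D j \<in> L" if "j < m" for j
    unfolding L_def poset_ideals_def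
  proof (intro CollectI conjI ballI impI)
    fix x y assume "x \<in> D j" "y \<in> P" "le y x"
    then obtain i where "i \<le> j" "le x (qs ! i)" "x \<in> P" by (auto simp: D_def)
    moreover have "qs ! i \<in> P" using qP that \<open>i \<le> j\<close> by simp
    ultimately have "le y (qs ! i)" using poset \<open>y \<in> P\<close> \<open>le y x\<close> unfolding is_poset_def by blast
    then show "y \<in> D j" using \<open>y \<in> P\<close> \<open>i \<le> j\<close> by (auto simp: D_def)
  qed (auto simp: D_def)
  have Dmem: "qs ! i \<in> D j \<longleftrightarrow> i \<le> j" if "i < m" "j < m" for i j
  proof
    assume "qs ! i \<in> D j"
    then obtain k where k: "k \<le> j" "le (qs ! i) (qs ! k)" by (auto simp: D_def)
    have "qs ! i \<in> Q" "qs ! k \<in> Q" using qs(2) len that k(1) nth_mem by (metis, metis le_less_trans)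
    then have "qs ! i = qs ! k" using Q(2) k(2) by blast
    then have "i = k" using nth_eq_iff_index_eq[OF qs(1)] len that k(1) by simp
    then show "i \<le> j" using k(1) by simp
  next
    assume "i \<le> j"
    then show "qs ! i \<in> D j" using qP[OF that(1)] poset unfolding D_def is_poset_def by blast
  qed
  define As where "As = map D [0..<m]"
  have AsL: "set As \<subseteq> L" using DL by (auto simp: As_def)
  define u where "u = fam_mon As"
  \<comment> \<open>The antichain condition puts \<open>qs ! i\<close> into exactly the ideals
    \<open>D j\<close> with \<open>i \<le> j < m\<close>.\<close>
  have lu: "lookup u (Some (qs ! i)) = m - i" if "i < m" for i
  proof -
    have "lookup u (Some (qs ! i)) = (\<Sum>j<m. of_bool (i \<le> j))"
      unfolding u_def lookup_fam_mon_Some[OF AsL] using Dmem that by (intro sum.cong) (auto simp: As_def)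
    also have "\<dots> = card ({..<m} \<inter> {j. i \<le> j})" by simp
    also have "{..<m} \<inter> {j. i \<le> j} = {i..<m}" by auto
    finally show ?thesis by simp
  qed
  obtain \<pi> rs where \<pi>: "lin_ext \<pi>" "u = lead \<pi> rs" using lead_surj[OF fam_mon_in_U[OF AsL]] unfolding u_def by blast
  have d: "distinct \<pi>" "set \<pi> = P" using \<pi>(1) by (auto simp: lin_ext_def)
  have "\<exists>a. a < length \<pi> \<and> \<pi> ! a = qs ! i" if "i < m" for i
    using qP[OF that] d(2) by (metis in_set_conv_nth)
  then obtain pos where pos: "\<And>i. i < m \<Longrightarrow> pos i < length \<pi>" "\<And>i. i < m \<Longrightarrow> \<pi> ! pos i = qs ! i" by metis
  \<comment> \<open>Multiplicities in \<open>u\<close> fall strictly along \<open>qs\<close>, and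
    \<open>\<pi>\<close> lists P by decreasing key. Each step thus moves forward in
    \<open>\<pi>\<close> while the weight rises, which forces a descent in between; descents for
    different steps lie in disjoint intervals of positions.\<close>
  have pos_less: "pos i < pos (Suc i)" if i: "Suc i < m" for i
  proof (rule ccontr)
    assume "\<not> pos i < pos (Suc i)"
    moreover have "key u (qs ! Suc i) < key u (qs ! i)"
      using lu i qP diff_less_mono2[of i "Suc i" m] by (simp add: key_less_iff)
    moreover from this have "pos i \<noteq> pos (Suc i)" using pos i by (metis Suc_lessD less_irrefl)
    ultimately show False
      using key_lead_decreasing[OF \<pi>(1), of "pos (Suc i)" "pos i" rs] pos i \<pi>(2) by simp
  qed
  have "\<exists>d\<in>Des \<pi>. pos i < d \<and> d \<le> pos (Suc i)" if i: "Suc i < m" for i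
    using ex_descent_between[OF \<pi>(1) pos_less[OF i]] pos i wlt[of i "Suc i"] by simp
  then obtain ds where ds: "\<And>i. Suc i < m \<Longrightarrow> ds i \<in> Des \<pi> \<and> pos i < ds i \<and> ds i \<le> pos (Suc i)" by metis
  have pos_mono: "pos i \<le> pos j" if "i \<le> j" "j < m" for i j
    using that
  proof (induction j)
    case (Suc j)
    then show ?case using pos_less[of j] by (cases "i = Suc j") auto
  qed simp
  have ds_less: "ds i < ds j" if "i < j" "Suc j < m" for i j
    using ds[of i] ds[of j] pos_mono[of "Suc i" j] that by simp
  have "inj_on ds {..<m - 1}"
  proof (rule inj_onI)
    fix i j assume "i \<in> {..<m - 1}" "j \<in> {..<m - 1}" "ds i = ds j"
    then show "i = j" using ds_less[of i j] ds_less[of j i] by (cases i j rule: linorder_cases) (auto simp: less_diff_conv)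
  qed
  then have "card {..<m - 1} \<le> card (Des \<pi>)"
    using ds by (intro card_inj_on_le[of ds]) auto
  then show ?thesis using \<pi>(1) by (auto simp: m_def)
qed

lemma card_Des_le:
  assumes "lin_ext \<pi>"
  shows "card (Des \<pi>) \<le> card P - 1"
proof -
  have "card (Des \<pi>) \<le> card {1..<card P}"
    using lin_ext_length[OF assms] by (intro card_mono) (auto simp: Des_def)
  then show ?thesis by simp
qed

text \<open>An ideal is the finite union of the principal ideals of its elements, and irreducibility
  discards them one at a time until one is left. Being different from the bottom element excludes
  the empty union.\<close>

lemma join_irreducible_principal:
  assumes a: "a \<in> join_irreducibles L"
  shows "\<exists>p\<in>P. a = {x \<in> P. le x p}"
proof -
  define dn where "dn p = {x \<in> P. le x p}" for p
  have aL: "a \<in> L" and ne: "a \<noteq> \<Inter>L" and irr: "\<And>b c. b \<in> L \<Longrightarrow> c \<in> L \<Longrightarrow> a = b \<union> c \<Longrightarrow> a = b \<or> a = c"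
    using a by (auto simp: join_irreducibles_def)
  have empty: "{} \<in> L" by (simp add: L_def poset_ideals_def)
  then have a_ne: "a \<noteq> {}" using ne by auto
  have dnL: "dn p \<in> L" if "p \<in> P" for p
    using poset that unfolding L_def poset_ideals_def dn_def is_poset_def by blast
  have UL: "\<Union>(dn ` F) \<in> L" if "finite F" "F \<subseteq> P" for F
    using that
  proof (induction F rule: finite_induct)
    case (insert x F)
    then have "dn x \<union> \<Union>(dn ` F) \<in> L" by (intro L_Un dnL) auto
    then show ?case by simp
  qed (simp add: empty)
  have "\<exists>p\<in>F. a = dn p" if "finite F" "F \<subseteq> P" "a = \<Union>(dn ` F)" for F
    using that
  proof (induction F rule: finite_induct)
    case empty
    then show ?case using a_ne by simp
  next
    case (insert x F)
    then have "a = dn x \<or> a = \<Union>(dn ` F)" by (intro irr dnL UL) auto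
    then show ?case using insert by auto
  qed
  moreover have "a = \<Union>(dn ` a)"
    using aL poset L_subset[OF aL] unfolding L_def poset_ideals_def dn_def is_poset_def by blast
  ultimately have "\<exists>p\<in>a. a = dn p" using finite_ideal[OF aL] L_subset[OF aL] by blast
  then show ?thesis using L_subset[OF aL] unfolding dn_def by blast
qed

text \<open>If one generator lies below another, transitivity gives inclusion of the principal
  ideals, so incomparable join-irreducibles have incomparable generators.\<close>

lemma antichain_of_ji_antichain:
  assumes "ji_antichain L Q"
  shows "\<exists>R\<subseteq>P. (\<forall>p\<in>R. \<forall>q\<in>R. le p q \<longrightarrow> p = q) \<and> card R = card Q"
proof -
  have Q: "Q \<subseteq> join_irreducibles L" "\<And>a b. a \<in> Q \<Longrightarrow> b \<in> Q \<Longrightarrow> a \<noteq> b \<Longrightarrow> \<not> a \<subseteq> b"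
    using assms by (auto simp: ji_antichain_def)
  have "\<forall>a\<in>Q. \<exists>p. p \<in> P \<and> a = {x \<in> P. le x p}"
    using join_irreducible_principal Q(1) by blast
  from bchoice[OF this] obtain g where g: "\<And>a. a \<in> Q \<Longrightarrow> g a \<in> P" "\<And>a. a \<in> Q \<Longrightarrow> a = {x \<in> P. le x (g a)}"
    by blast
  have inj: "inj_on g Q"
  proof (rule inj_onI)
    fix a b assume "a \<in> Q" "b \<in> Q" "g a = g b"
    then show "a = b" using g(2)[of a] g(2)[of b] by simp
  qed
  show ?thesis
  proof (intro exI[of _ "g ` Q"] conjI ballI impI)
    show "g ` Q \<subseteq> P" using g(1) by blast
    show "card (g ` Q) = card Q" by (rule card_image[OF inj])
    fix p q assume "p \<in> g ` Q" "q \<in> g ` Q" "le p q"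
    then obtain a b where ab: "a \<in> Q" "b \<in> Q" "p = g a" "q = g b" by blast
    have "x \<in> b" if "x \<in> a" for x
    proof -
      have "x \<in> P" "le x p" using that g(2)[OF ab(1)] ab(3) by auto
      then have "le x q" using poset \<open>le p q\<close> g(1) ab unfolding is_poset_def by blast
      then show ?thesis using g(2)[OF ab(2)] ab(4) \<open>x \<in> P\<close> by auto
    qed
    then show "p = q" using Q(2)[OF ab(1,2)] ab by blast
  qed
qed

end

lemma is_planar_empty: "is_planar (poset_ideals {} le)"
proof -
  have "planar_dist_lattice {(0, 0)}"
    unfolding planar_dist_lattice_def by (auto intro!: exI[of _ "[(0, 0)]"])
  then show ?thesis
    unfolding is_planar_def
    by (intro exI[of _ "{(0, 0)}"] exI[of _ "\<lambda>_. (0, 0)"]) (auto simp: poset_ideals_def bij_betw_def le2_def)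
qed

theorem theorem8:
  fixes P :: "'a set" and le :: "'a \<Rightarrow> 'a \<Rightarrow> bool"
  assumes "finite P" and "is_poset P le"
    and "\<not> is_planar (poset_ideals P le)"
  shows "int (card P) - 1 \<ge> reg_hibi TYPE('k::field) (poset_ideals P le)
       \<and> reg_hibi TYPE('k::field) (poset_ideals P le)
           \<ge> int (Max (card ` {Q. ji_antichain (poset_ideals P le) Q})) - 1"
proof -
  obtain wt where "weighted_poset P le wt" using ex_weighted_poset[OF assms(1,2)] by blast
  then interpret weighted_poset P le wt .
  obtain \<pi>\<^sub>0 where "lin_ext \<pi>\<^sub>0" "Des \<pi>\<^sub>0 = {}" using ex_lin_ext_no_descents by blast
  then interpret hibi_basis P le wt \<pi>\<^sub>0 by unfold_locales
  \<comment> \<open>The empty poset gives the one-point lattice, which is planar. For nonempty P the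
    truncated subtraction in \<open>card_Des_le\<close> agrees with the integer
    \<open>card P - 1\<close>.\<close>
  have P: "P \<noteq> {}" using assms(3) is_planar_empty by auto
  define s where "s = Max ((\<lambda>\<pi>. int (card (Des \<pi>))) ` {\<pi>. lin_ext \<pi>})"
  have reg: "reg_hibi TYPE('k) (poset_ideals P le) = s"
    unfolding reg_hibi_def s_def by (rule cm_reg_hibi[unfolded L_def])
  have "s \<le> int (card P) - 1"
    unfolding s_def
  proof (rule Max.boundedI)
    show "(\<lambda>\<pi>. int (card (Des \<pi>))) ` {\<pi>. lin_ext \<pi>} \<noteq> {}" using \<pi>0(1) by blast
    fix x assume "x \<in> (\<lambda>\<pi>. int (card (Des \<pi>))) ` {\<pi>. lin_ext \<pi>}"
    then obtain \<pi> where "lin_ext \<pi>" "x = int (card (Des \<pi>))" by blast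
    moreover have "card P > 0" using P assms(1) by (simp add: card_gt_0_iff)
    ultimately show "x \<le> int (card P) - 1" using card_Des_le[of \<pi>] by linarith
  qed (use finite_lin_ext in simp)
  moreover have "int (Max (card ` {Q. ji_antichain L Q})) - 1 \<le> s"
  proof -
    have "{Q. ji_antichain L Q} \<subseteq> Pow L"
      unfolding ji_antichain_def join_irreducibles_def by blast
    then have "finite {Q. ji_antichain L Q}" using finite_L by (rule finite_subset[OF _ finite_Pow_iff[THEN iffD2]])
    \<comment> \<open>The empty antichain guarantees that the maximum is taken over a nonempty set
      and hence attained.\<close>
    moreover have "{} \<in> {Q. ji_antichain L Q}" by (simp add: ji_antichain_def)
    ultimately have "Max (card ` {Q. ji_antichain L Q}) \<in> card ` {Q. ji_antichain L Q}"
      by (intro Max_in) auto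
    then obtain Q where Q: "ji_antichain L Q" "Max (card ` {Q. ji_antichain L Q}) = card Q"
      by (elim imageE CollectE) simp
    obtain R where R: "R \<subseteq> P" "\<forall>p\<in>R. \<forall>q\<in>R. le p q \<longrightarrow> p = q" "card R = card Q"
      using antichain_of_ji_antichain[OF Q(1)] by blast
    obtain \<pi> where \<pi>: "lin_ext \<pi>" "card R - 1 \<le> card (Des \<pi>)" using ex_lin_ext_descents[OF R(1)] R(2) by blast
    have "int (card (Des \<pi>)) \<le> s" unfolding s_def using \<pi>(1) finite_lin_ext by (intro Max_ge) auto
    then show ?thesis using \<pi>(2) R(3) Q(2) by linarith
  qed
  ultimately show ?thesis unfolding reg by (simp add: L_def)
qed

end
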